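(* Let $\varepsilon\in[0,1]$, $\sigma>0$ and $f\in\mathcal V'$. The discrete problem: find $(u_h^{\varepsilon,\sigma},\xi_h^{\varepsilon,\sigma})\in V_h\times V_h$ such that $$a(u_h^{\varepsilon,\sigma},v_h)+(1-\varepsilon)a_\|(\xi_h^{\varepsilon,\sigma},v_h)=(f,v_h)\ \ \forall v_h\in V_h,$$ $$a_\|(u_h^{\varepsilon,\sigma},w_h)-\varepsilon a_\|(\xi_h^{\varepsilon,\sigma},w_h)-\sigma(\xi_h^{\varepsilon,\sigma},w_h)=0\ \ \forall w_h\in V_h,$$ admits a unique solution, and $$\|u_h^{\varepsilon,\sigma},\xi_h^{\varepsilon,\sigma}\|_{X_{\varepsilon,\sigma,h}}\le\frac1\beta\|f\|_{\mathcal V'},$$ where $\beta>0$ is the constant, independent of the mesh, $\varepsilon$ and $\sigma$, described in the context. Moreover, for any fixed $\varepsilon\in[0,1]$, $$u_h^{\varepsilon,\sigma}\to u_h^{\varepsilon,0},\qquad \xi_h^{\varepsilon,\sigma}\to\xi_h^{\varepsilon,0}\qquad\text{as }\sigma\to0,$$ where $(u_h^{\varepsilon,0},\xi_h^{\varepsilon,0})\in V_h\times A_h$ is the unique solution of $$a(u_h^{\varepsilon,0},v_h)+(1-\varepsilon)a_\|(\xi_h^{\varepsilon,0},v_h)=(f,v_h)\ \ \forall v_h\in V_h,\qquad a_\|(u_h^{\varepsilon,0},w_h)-\varepsilon a_\|(\xi_h^{\varepsilon,0},w_h)=0\ \ \forall w_h\in A_h .$$ Also $$u_h^{\varepsilon,0}\to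 u_h^{0,0},\qquad \xi_h^{\varepsilon,0}\to\xi_h^{0,0}\qquad\text{as }\varepsilon\to0,$$ where $(u_h^{0,0},\xi_h^{0,0})\in V_h\times A_h$ is the unique solution of the last problem with $\varepsilon=0$. Finally, the condition number (in the matrix 2-norm) of the matrix corresponding to the first discrete problem (posed on $V_h\times V_h$) is bounded by a constant that depends on $\sigma$ but not on $\varepsilon$ (assuming that the same bases of the discrete spaces are chosen for all values of $\varepsilon,\sigma$).
   Context: Let $\Omega\subset\mathbb R^d$, $d\in\{2,3\}$, be a domain with regular boundary $\Gamma$ and unit outward normal $n$, and let $b\in(C^\infty(\Omega))^d$ be a smooth vector field with $|b(x)|=1$ for all $x\in\Omega$ (field lines may be open or closed). Put $\Gamma_D=\{x\in\Gamma: b\cdot n=0\}$, which has nonempty relative interior. For scalar $\phi$, $\nabla_\|\phi:=(b\cdot\nabla\phi)\,b$. Coefficients: $A_\|\in W^{2,\infty}(\Omega)$ (scalar) and $A_\perp\in\mathbb M_{d\times d}(W^{2,\infty}(\Omega))$ satisfy, for constants $0<A_0\le A_1$ and a.a. $x\in\Omega$, $A_0\le A_\|(x)\le A_1$ and $A_0\|v\|^2\le v^tA_\perp(x)v\le A_1\|v\|^2$ for all $v\in\mathbb R^d$ with $v\cdot b(x)=0$. Put $A:=(b\otimes b)A_\|(b\otimes b)+(Id-b\otimes b)A_\perp(Id-b\otimes b)$. Spaces and forms: $\mathcal V=\{v\in H^1(\Omega): v|_{\Gamma_D}=0\}$ with scalar product $a(u,v):=\int_\Omega A\nabla u\cdot\nabla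 v\,dx$ and norm $|\cdot|_{\mathcal V}$; $\mathcal V'$ is its dual with dual norm, and $(\cdot,\cdot)$ denotes the $L^2(\Omega)$ product or duality pairing. $a_\|(u,v):=\int_\Omega A_\|\nabla_\|u\cdot\nabla_\|v\,dx$, $|u|_\|:=\sqrt{a_\|(u,u)}$. Discretization: $\mathcal T_h$ is a fixed mesh on $\Omega$ of triangles (resp. rectangles) of maximal size $h$, and $V_h\subset\mathcal V$ is the space of $\mathbb P_k$ (resp. $\mathbb Q_k$) finite elements on $\mathcal T_h$. $G_h:=\{v_h\in V_h:\nabla_\|v_h=0\}$ and $A_h$ is the $L^2$-orthogonal complement of $G_h$ in $V_h$ (for $\sigma>0$ the component $\xi_h^{\varepsilon,\sigma}$ lies in $A_h$). On $A_h$, $|\xi_h|_{*h}:=\sup_{v_h\in V_h}\frac{a_\|(\xi_h,v_h)}{|v_h|_{\mathcal V}}$. $X_h:=V_h\times A_h$ with norm $\|u_h,\xi_h\|_{X_{\varepsilon,\sigma,h}}:=(|u_h|_{\mathcal V}^2+|\xi_h|_{*h}^2+\varepsilon|\xi_h|_\|^2+\sigma\|\xi_h\|_{L^2}^2)^{1/2}$. The constant $\beta>0$ is independent of the mesh, of $\varepsilon\in[0,1]$ and of $\sigma\ge0$ and such that the form $C_{\varepsilon,\sigma}((u,\xi),(v,w)):=a(u,v)+(1-\varepsilon)a_\|(\xi,v)+a_\|(u,w)-\varepsilon a_\|(\xi,w)-\sigma(\xi,w)$ satisfies $\inf_{(u_h,\xi_h)\in X_h}\sup_{(v_h,w_h)\in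 X_h}\frac{C_{\varepsilon,\sigma}((u_h,\xi_h),(v_h,w_h))}{\|u_h,\xi_h\|_{X_{\varepsilon,\sigma,h}}\|v_h,w_h\|_{X_{\varepsilon,\sigma,h}}}\ge\beta$ (such a constant exists). The matrix of the discrete problem is the matrix of $C_{\varepsilon,\sigma}$ on $V_h\times V_h$ with respect to a chosen basis of $V_h$. *)

theory Defs
  imports "HOL-Analysis.Analysis"
begin

text \<open>\<open>Ck_on S f k\<close> is used for open \<open>S\<close> only.\<close>

primrec Ck_on :: "'a::real_normed_vector set \<Rightarrow> ('a \<Rightarrow> 'b::real_normed_vector) \<Rightarrow> nat \<Rightarrow> bool" where
  "Ck_on S f 0 \<longleftrightarrow> continuous_on S f"
| "Ck_on S f (Suc k) \<longleftrightarrow>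
     (\<forall>x\<in>S. f differentiable (at x)) \<and> (\<forall>v. Ck_on S (\<lambda>x. frechet_derivative f (at x) v) k)"

definition smooth_on :: "'a::real_normed_vector set \<Rightarrow> ('a \<Rightarrow> 'b::real_normed_vector) \<Rightarrow> bool" where
  "smooth_on S f \<longleftrightarrow> (\<forall>k. Ck_on S f k)"

text \<open>A bounded domain lying locally, in direction of a unit vector \<open>e\<close>, strictly above the graph
  of a Lipschitz function of the component orthogonal to \<open>e\<close>. A smooth boundary would exclude every
  set that is exactly covered by finitely many simplices or boxes.\<close>

definition lipschitz_domain :: "'a::euclidean_space set \<Rightarrow> bool" where
  "lipschitz_domain \<Omega> \<longleftrightarrow> open \<Omega> \<and> connected \<Omega> \<and> \<Omega> \<noteq> {} \<and> bounded \<Omega> \<and>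
     (\<forall>x\<in>frontier \<Omega>. \<exists>e \<gamma> L r. norm e = 1 \<and> L-lipschitz_on UNIV \<gamma> \<and> 0 < r \<and>
        \<Omega> \<inter> ball x r = {y \<in> ball x r. \<gamma> (y - (y \<bullet> e) *\<^sub>R e) < y \<bullet> e})"

text \<open>For Lipschitz domains such a vector exists, and is unique, exactly where the local graph
  function is differentiable; at a corner there is none.\<close>

definition outward_normal :: "'a::euclidean_space set \<Rightarrow> 'a \<Rightarrow> 'a \<Rightarrow> bool" where
  "outward_normal \<Omega> x n \<longleftrightarrow> norm n = 1 \<and>
     (\<forall>e>0. \<exists>r>0. \<forall>y\<in>ball x r.
        ((y - x) \<bullet> n < - e * norm (y - x) \<longrightarrow> y \<in> \<Omega>) \<and>
        ((y - x) \<bullet> n > e * norm (y - x) \<longrightarrow> y \<notin> \<Omega>))"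

definition Gamma_D :: "'a::euclidean_space set \<Rightarrow> ('a \<Rightarrow> 'a) \<Rightarrow> 'a set" where
  "Gamma_D \<Omega> b = {x \<in> frontier \<Omega>. \<exists>n. outward_normal \<Omega> x n \<and> b x \<bullet> n = 0}"

text \<open>Functions are defined on the whole space, but only their values on \<open>\<Omega>\<close> matter, and they are
  not identified when they agree almost everywhere.\<close>

definition L2 :: "'a::euclidean_space set \<Rightarrow> ('a \<Rightarrow> 'b::euclidean_space) \<Rightarrow> bool" where
  "L2 \<Omega> u \<longleftrightarrow> u \<in> borel_measurable (lebesgue_on \<Omega>) \<and>
     integrable (lebesgue_on \<Omega>) (\<lambda>x. (norm (u x))\<^sup>2)"

definition Linf :: "'a::euclidean_space set \<Rightarrow> ('a \<Rightarrow> 'b::euclidean_space) \<Rightarrow> bool" where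
  "Linf \<Omega> u \<longleftrightarrow> u \<in> borel_measurable (lebesgue_on \<Omega>) \<and>
     (\<exists>C. AE x in lebesgue_on \<Omega>. norm (u x) \<le> C)"

definition L2_inner :: "'a::euclidean_space set \<Rightarrow> ('a \<Rightarrow> real) \<Rightarrow> ('a \<Rightarrow> real) \<Rightarrow> real" where
  "L2_inner \<Omega> u v = (LINT x|lebesgue_on \<Omega>. u x * v x)"

definition test_function :: "'a::euclidean_space set \<Rightarrow> ('a \<Rightarrow> real) \<Rightarrow> bool" where
  "test_function \<Omega> \<phi> \<longleftrightarrow> smooth_on UNIV \<phi> \<and> (\<exists>K. compact K \<and> K \<subseteq> \<Omega> \<and> (\<forall>x. x \<notin> K \<longrightarrow> \<phi> x = 0))"

definition locally_L1 :: "'a::euclidean_space set \<Rightarrow> ('a \<Rightarrow> 'b::euclidean_space) \<Rightarrow> bool" where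
  "locally_L1 \<Omega> u \<longleftrightarrow> (\<forall>K. compact K \<and> K \<subseteq> \<Omega> \<longrightarrow> set_integrable lebesgue K u)"

definition has_weak_grad :: "'a::euclidean_space set \<Rightarrow> ('a \<Rightarrow> real) \<Rightarrow> ('a \<Rightarrow> 'a) \<Rightarrow> bool" where
  "has_weak_grad \<Omega> u g \<longleftrightarrow> locally_L1 \<Omega> u \<and> locally_L1 \<Omega> g \<and>
     (\<forall>\<phi> v. test_function \<Omega> \<phi> \<longrightarrow>
        (LINT x|lebesgue_on \<Omega>. u x * frechet_derivative \<phi> (at x) v) =
        - (LINT x|lebesgue_on \<Omega>. (g x \<bullet> v) * \<phi> x))"

text \<open>The weak gradient is determined almost everywhere on \<open>\<Omega>\<close>; a representative is chosen.\<close>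

definition weak_grad :: "'a::euclidean_space set \<Rightarrow> ('a \<Rightarrow> real) \<Rightarrow> 'a \<Rightarrow> 'a" where
  "weak_grad \<Omega> u = (SOME g. has_weak_grad \<Omega> u g)"

definition H1 :: "'a::euclidean_space set \<Rightarrow> ('a \<Rightarrow> real) set" where
  "H1 \<Omega> = {u. L2 \<Omega> u \<and> (\<exists>g. has_weak_grad \<Omega> u g \<and> L2 \<Omega> g)}"

definition H1_norm :: "'a::euclidean_space set \<Rightarrow> ('a \<Rightarrow> real) \<Rightarrow> real" where
  "H1_norm \<Omega> u = sqrt ((LINT x|lebesgue_on \<Omega>. (u x)\<^sup>2) +
                        (LINT x|lebesgue_on \<Omega>. (norm (weak_grad \<Omega> u x))\<^sup>2))"

definition W1inf :: "'a::euclidean_space set \<Rightarrow> ('a \<Rightarrow> real) \<Rightarrow> bool" where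
  "W1inf \<Omega> u \<longleftrightarrow> Linf \<Omega> u \<and> (\<exists>g. has_weak_grad \<Omega> u g \<and> Linf \<Omega> g)"

definition W2inf :: "'a::euclidean_space set \<Rightarrow> ('a \<Rightarrow> real) \<Rightarrow> bool" where
  "W2inf \<Omega> u \<longleftrightarrow> Linf \<Omega> u \<and> (\<exists>g. has_weak_grad \<Omega> u g \<and> (\<forall>i\<in>Basis. W1inf \<Omega> (\<lambda>x. g x \<bullet> i)))"

text \<open>\<open>s\<close>-dimensional Hausdorff outer measure for integers \<open>s \<ge> 1\<close>, normalised so that it agrees
  with surface area. For \<open>s \<ge> 1\<close> empty sets in a cover contribute nothing.\<close>

definition hausdorff_content :: "nat \<Rightarrow> real \<Rightarrow> 'a::euclidean_space set \<Rightarrow> ennreal" where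
  "hausdorff_content s \<delta> S =
     (INF U \<in> {U :: nat \<Rightarrow> 'a set. S \<subseteq> (\<Union>i. U i) \<and> (\<forall>i. bounded (U i) \<and> diameter (U i) \<le> \<delta>)}.
        \<Sum>i. ennreal (unit_ball_vol (real s) * (diameter (U i) / 2) ^ s))"

definition hausdorff_outer :: "nat \<Rightarrow> 'a::euclidean_space set \<Rightarrow> ennreal" where
  "hausdorff_outer s S = (SUP \<delta> \<in> {0<..}. hausdorff_content s \<delta> S)"

definition surface_measure :: "'a::euclidean_space measure" where
  "surface_measure = measure_of UNIV (sets borel) (hausdorff_outer (DIM('a) - 1))"

text \<open>The trace operator as the continuous extension, from smooth functions on the closure of \<open>\<Omega>\<close> to
  \<open>H1 \<Omega>\<close> and with values in \<open>L\<^sup>2\<close> of the boundary, of the restriction to the boundary.\<close>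

definition has_trace :: "'a::euclidean_space set \<Rightarrow> ('a \<Rightarrow> real) \<Rightarrow> ('a \<Rightarrow> real) \<Rightarrow> bool" where
  "has_trace \<Omega> v g \<longleftrightarrow> g \<in> borel_measurable borel \<and>
     (\<exists>\<phi> :: nat \<Rightarrow> 'a \<Rightarrow> real. (\<forall>n. smooth_on UNIV (\<phi> n)) \<and>
        (\<lambda>n. H1_norm \<Omega> (\<lambda>x. \<phi> n x - v x)) \<longlonglongrightarrow> 0 \<and>
        (\<lambda>n. \<integral>\<^sup>+x\<in>frontier \<Omega>. ennreal ((\<phi> n x - g x)\<^sup>2) \<partial>surface_measure) \<longlonglongrightarrow> 0)"

definition V_space :: "'a::euclidean_space set \<Rightarrow> ('a \<Rightarrow> 'a) \<Rightarrow> ('a \<Rightarrow> real) set" where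
  "V_space \<Omega> b = {v \<in> H1 \<Omega>. \<exists>g. has_trace \<Omega> v g \<and>
                      (AE x in surface_measure. x \<in> Gamma_D \<Omega> b \<longrightarrow> g x = 0)}"

definition tensor_sq :: "real^'d \<Rightarrow> real^'d^'d" where
  "tensor_sq b = (\<chi> i j. b $ i * b $ j)"

definition diffusion ::
  "(real^'d \<Rightarrow> real^'d) \<Rightarrow> (real^'d \<Rightarrow> real) \<Rightarrow> (real^'d \<Rightarrow> real^'d^'d) \<Rightarrow> real^'d \<Rightarrow> real^'d^'d" where
  "diffusion b Apar Aperp x =
     tensor_sq (b x) ** (Apar x *\<^sub>R tensor_sq (b x)) +
     (mat 1 - tensor_sq (b x)) ** Aperp x ** (mat 1 - tensor_sq (b x))"

definition a_form ::
  "(real^'d) set \<Rightarrow> (real^'d \<Rightarrow> real^'d) \<Rightarrow> (real^'d \<Rightarrow> real) \<Rightarrow> (real^'d \<Rightarrow> real^'d^'d) \<Rightarrow>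
   (real^'d \<Rightarrow> real) \<Rightarrow> (real^'d \<Rightarrow> real) \<Rightarrow> real" where
  "a_form \<Omega> b Apar Aperp u v =
     (LINT x|lebesgue_on \<Omega>. (diffusion b Apar Aperp x *v weak_grad \<Omega> u x) \<bullet> weak_grad \<Omega> v x)"

definition par_grad ::
  "(real^'d) set \<Rightarrow> (real^'d \<Rightarrow> real^'d) \<Rightarrow> (real^'d \<Rightarrow> real) \<Rightarrow> real^'d \<Rightarrow> real^'d" where
  "par_grad \<Omega> b u x = (b x \<bullet> weak_grad \<Omega> u x) *\<^sub>R b x"

definition a_par ::
  "(real^'d) set \<Rightarrow> (real^'d \<Rightarrow> real^'d) \<Rightarrow> (real^'d \<Rightarrow> real) \<Rightarrow>
   (real^'d \<Rightarrow> real) \<Rightarrow> (real^'d \<Rightarrow> real) \<Rightarrow> real" where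
  "a_par \<Omega> b Apar u v =
     (LINT x|lebesgue_on \<Omega>. Apar x * (par_grad \<Omega> b u x \<bullet> par_grad \<Omega> b v x))"

definition V_norm ::
  "(real^'d) set \<Rightarrow> (real^'d \<Rightarrow> real^'d) \<Rightarrow> (real^'d \<Rightarrow> real) \<Rightarrow> (real^'d \<Rightarrow> real^'d^'d) \<Rightarrow>
   (real^'d \<Rightarrow> real) \<Rightarrow> real" where
  "V_norm \<Omega> b Apar Aperp u = sqrt (a_form \<Omega> b Apar Aperp u u)"

definition par_norm ::
  "(real^'d) set \<Rightarrow> (real^'d \<Rightarrow> real^'d) \<Rightarrow> (real^'d \<Rightarrow> real) \<Rightarrow> (real^'d \<Rightarrow> real) \<Rightarrow> real" where
  "par_norm \<Omega> b Apar u = sqrt (a_par \<Omega> b Apar u u)"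

definition V_dual ::
  "(real^'d) set \<Rightarrow> (real^'d \<Rightarrow> real^'d) \<Rightarrow> (real^'d \<Rightarrow> real) \<Rightarrow> (real^'d \<Rightarrow> real^'d^'d) \<Rightarrow>
   ((real^'d \<Rightarrow> real) \<Rightarrow> real) set" where
  "V_dual \<Omega> b Apar Aperp = {f.
     (\<forall>u\<in>V_space \<Omega> b. \<forall>v\<in>V_space \<Omega> b. f (\<lambda>x. u x + v x) = f u + f v) \<and>
     (\<forall>c. \<forall>v\<in>V_space \<Omega> b. f (\<lambda>x. c * v x) = c * f v) \<and>
     (\<exists>C. \<forall>v\<in>V_space \<Omega> b. \<bar>f v\<bar> \<le> C * V_norm \<Omega> b Apar Aperp v)}"

text \<open>Here and below, elements of norm 0 contribute \<open>0 / 0 = 0\<close> to a supremum of quotients that is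
  nonnegative anyway.\<close>

definition V_dual_norm ::
  "(real^'d) set \<Rightarrow> (real^'d \<Rightarrow> real^'d) \<Rightarrow> (real^'d \<Rightarrow> real) \<Rightarrow> (real^'d \<Rightarrow> real^'d^'d) \<Rightarrow>
   ((real^'d \<Rightarrow> real) \<Rightarrow> real) \<Rightarrow> real" where
  "V_dual_norm \<Omega> b Apar Aperp f = (SUP v\<in>V_space \<Omega> b. \<bar>f v\<bar> / V_norm \<Omega> b Apar Aperp v)"

datatype mesh_type = Simplicial | Rectangular

fun mesh_element :: "mesh_type \<Rightarrow> (real^'d) set \<Rightarrow> bool" where
  "mesh_element Simplicial K \<longleftrightarrow> int CARD('d) simplex K"
| "mesh_element Rectangular K \<longleftrightarrow> (\<exists>l u. box l u \<noteq> {} \<and> K = cbox l u)"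

definition fe_mesh :: "(real^'d) set \<Rightarrow> mesh_type \<Rightarrow> real \<Rightarrow> (real^'d) set set \<Rightarrow> bool" where
  "fe_mesh \<Omega> ty h \<T> \<longleftrightarrow> finite \<T> \<and> \<Union>\<T> = closure \<Omega> \<and> (\<forall>K\<in>\<T>. mesh_element ty K) \<and>
     (\<forall>K\<in>\<T>. \<forall>L\<in>\<T>. (K \<inter> L) face_of K \<and> (K \<inter> L) face_of L) \<and> h = Max (diameter ` \<T>)"

fun exponents :: "mesh_type \<Rightarrow> nat \<Rightarrow> ('d::finite \<Rightarrow> nat) set" where
  "exponents Simplicial k = {\<alpha>. (\<Sum>i\<in>UNIV. \<alpha> i) \<le> k}"
| "exponents Rectangular k = {\<alpha>. \<forall>i. \<alpha> i \<le> k}"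

definition poly_space :: "mesh_type \<Rightarrow> nat \<Rightarrow> (real^'d \<Rightarrow> real) set" where
  "poly_space ty k = {\<lambda>x. \<Sum>\<alpha>\<in>exponents ty k. c \<alpha> * (\<Prod>i\<in>UNIV. x $ i ^ \<alpha> i) | c. True}"

text \<open>Finite element functions are genuine functions on the closure of \<open>\<Omega>\<close>, extended by zero, so that
  equality of functions is equality in the space.\<close>

definition fe_space ::
  "(real^'d) set \<Rightarrow> (real^'d \<Rightarrow> real^'d) \<Rightarrow> mesh_type \<Rightarrow> nat \<Rightarrow> (real^'d) set set \<Rightarrow>
   (real^'d \<Rightarrow> real) set" where
  "fe_space \<Omega> b ty k \<T> = {v \<in> V_space \<Omega> b.
     continuous_on (closure \<Omega>) v \<and> (\<forall>x. x \<notin> closure \<Omega> \<longrightarrow> v x = 0) \<and>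
     (\<forall>K\<in>\<T>. \<exists>p\<in>poly_space ty k. \<forall>x\<in>K. v x = p x)}"

definition G_space ::
  "(real^'d) set \<Rightarrow> (real^'d \<Rightarrow> real^'d) \<Rightarrow> (real^'d \<Rightarrow> real) set \<Rightarrow> (real^'d \<Rightarrow> real) set" where
  "G_space \<Omega> b Vh = {v \<in> Vh. AE x in lebesgue_on \<Omega>. par_grad \<Omega> b v x = 0}"

definition A_space ::
  "(real^'d) set \<Rightarrow> (real^'d \<Rightarrow> real^'d) \<Rightarrow> (real^'d \<Rightarrow> real) set \<Rightarrow> (real^'d \<Rightarrow> real) set" where
  "A_space \<Omega> b Vh = {v \<in> Vh. \<forall>w\<in>G_space \<Omega> b Vh. L2_inner \<Omega> v w = 0}"

definition star_norm ::
  "(real^'d) set \<Rightarrow> (real^'d \<Rightarrow> real^'d) \<Rightarrow> (real^'d \<Rightarrow> real) \<Rightarrow> (real^'d \<Rightarrow> real^'d^'d) \<Rightarrow>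
   (real^'d \<Rightarrow> real) set \<Rightarrow> (real^'d \<Rightarrow> real) \<Rightarrow> real" where
  "star_norm \<Omega> b Apar Aperp Vh \<xi> = (SUP v\<in>Vh. a_par \<Omega> b Apar \<xi> v / V_norm \<Omega> b Apar Aperp v)"

definition X_norm ::
  "(real^'d) set \<Rightarrow> (real^'d \<Rightarrow> real^'d) \<Rightarrow> (real^'d \<Rightarrow> real) \<Rightarrow> (real^'d \<Rightarrow> real^'d^'d) \<Rightarrow>
   (real^'d \<Rightarrow> real) set \<Rightarrow> real \<Rightarrow> real \<Rightarrow> (real^'d \<Rightarrow> real) \<times> (real^'d \<Rightarrow> real) \<Rightarrow> real" where
  "X_norm \<Omega> b Apar Aperp Vh \<epsilon> \<sigma> = (\<lambda>(u, \<xi>).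
     sqrt ((V_norm \<Omega> b Apar Aperp u)\<^sup>2 + (star_norm \<Omega> b Apar Aperp Vh \<xi>)\<^sup>2 +
           \<epsilon> * (par_norm \<Omega> b Apar \<xi>)\<^sup>2 + \<sigma> * L2_inner \<Omega> \<xi> \<xi>))"

definition C_form ::
  "(real^'d) set \<Rightarrow> (real^'d \<Rightarrow> real^'d) \<Rightarrow> (real^'d \<Rightarrow> real) \<Rightarrow> (real^'d \<Rightarrow> real^'d^'d) \<Rightarrow>
   real \<Rightarrow> real \<Rightarrow> (real^'d \<Rightarrow> real) \<times> (real^'d \<Rightarrow> real) \<Rightarrow>
   (real^'d \<Rightarrow> real) \<times> (real^'d \<Rightarrow> real) \<Rightarrow> real" where
  "C_form \<Omega> b Apar Aperp \<epsilon> \<sigma> = (\<lambda>(u, \<xi>) (v, w).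
     a_form \<Omega> b Apar Aperp u v + (1 - \<epsilon>) * a_par \<Omega> b Apar \<xi> v +
     a_par \<Omega> b Apar u w - \<epsilon> * a_par \<Omega> b Apar \<xi> w - \<sigma> * L2_inner \<Omega> \<xi> w)"

definition inf_sup ::
  "(real^'d) set \<Rightarrow> (real^'d \<Rightarrow> real^'d) \<Rightarrow> (real^'d \<Rightarrow> real) \<Rightarrow> (real^'d \<Rightarrow> real^'d^'d) \<Rightarrow>
   (real^'d \<Rightarrow> real) set \<Rightarrow> real \<Rightarrow> real \<Rightarrow> ereal" where
  "inf_sup \<Omega> b Apar Aperp Vh \<epsilon> \<sigma> =
     (INF p \<in> Vh \<times> A_space \<Omega> b Vh - {((\<lambda>_. 0), (\<lambda>_. 0))}.
      SUP q \<in> Vh \<times> A_space \<Omega> b Vh - {((\<lambda>_. 0), (\<lambda>_. 0))}.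
        ereal (C_form \<Omega> b Apar Aperp \<epsilon> \<sigma> p q /
               (X_norm \<Omega> b Apar Aperp Vh \<epsilon> \<sigma> p * X_norm \<Omega> b Apar Aperp Vh \<epsilon> \<sigma> q)))"

definition uniform_inf_sup_constant ::
  "(real^'d) set \<Rightarrow> (real^'d \<Rightarrow> real^'d) \<Rightarrow> (real^'d \<Rightarrow> real) \<Rightarrow> (real^'d \<Rightarrow> real^'d^'d) \<Rightarrow>
   mesh_type \<Rightarrow> nat \<Rightarrow> real \<Rightarrow> bool" where
  "uniform_inf_sup_constant \<Omega> b Apar Aperp ty k \<beta> \<longleftrightarrow> 0 < \<beta> \<and>
     (\<forall>h \<T>. fe_mesh \<Omega> ty h \<T> \<longrightarrow>
        (\<forall>\<epsilon>\<in>{0..1}. \<forall>\<sigma>\<ge>0. inf_sup \<Omega> b Apar Aperp (fe_space \<Omega> b ty k \<T>) \<epsilon> \<sigma> \<ge> ereal \<beta>))"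

text \<open>\<open>Vh\<close> contains \<open>u\<close> and the first test functions, \<open>Wh\<close> contains \<open>\<xi>\<close> and the second test
  functions: \<open>Wh = Vh\<close> for the stabilised problem, \<open>Wh = A_space \<Omega> b Vh\<close> and \<open>\<sigma> = 0\<close> for the
  limit problem.\<close>

definition solves ::
  "(real^'d) set \<Rightarrow> (real^'d \<Rightarrow> real^'d) \<Rightarrow> (real^'d \<Rightarrow> real) \<Rightarrow> (real^'d \<Rightarrow> real^'d^'d) \<Rightarrow>
   (real^'d \<Rightarrow> real) set \<Rightarrow> (real^'d \<Rightarrow> real) set \<Rightarrow> ((real^'d \<Rightarrow> real) \<Rightarrow> real) \<Rightarrow> real \<Rightarrow> real \<Rightarrow>
   (real^'d \<Rightarrow> real) \<times> (real^'d \<Rightarrow> real) \<Rightarrow> bool" where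
  "solves \<Omega> b Apar Aperp Vh Wh f \<epsilon> \<sigma> = (\<lambda>(u, \<xi>). u \<in> Vh \<and> \<xi> \<in> Wh \<and>
     (\<forall>v\<in>Vh. a_form \<Omega> b Apar Aperp u v + (1 - \<epsilon>) * a_par \<Omega> b Apar \<xi> v = f v) \<and>
     (\<forall>w\<in>Wh. a_par \<Omega> b Apar u w - \<epsilon> * a_par \<Omega> b Apar \<xi> w - \<sigma> * L2_inner \<Omega> \<xi> w = 0))"

definition is_fe_basis :: "('n::finite \<Rightarrow> 'a \<Rightarrow> real) \<Rightarrow> ('a \<Rightarrow> real) set \<Rightarrow> bool" where
  "is_fe_basis \<phi> Vh \<longleftrightarrow> range \<phi> \<subseteq> Vh \<and>
     (\<forall>v\<in>Vh. \<exists>!c :: 'n \<Rightarrow> real. v = (\<lambda>x. \<Sum>i\<in>UNIV. c i * \<phi> i x))"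

fun product_basis ::
  "('n \<Rightarrow> 'a \<Rightarrow> real) \<Rightarrow> 'n + 'n \<Rightarrow> ('a \<Rightarrow> real) \<times> ('a \<Rightarrow> real)" where
  "product_basis \<phi> (Inl i) = (\<phi> i, \<lambda>_. 0)"
| "product_basis \<phi> (Inr i) = (\<lambda>_. 0, \<phi> i)"

definition system_matrix ::
  "(real^'d) set \<Rightarrow> (real^'d \<Rightarrow> real^'d) \<Rightarrow> (real^'d \<Rightarrow> real) \<Rightarrow> (real^'d \<Rightarrow> real^'d^'d) \<Rightarrow>
   ('n::finite \<Rightarrow> real^'d \<Rightarrow> real) \<Rightarrow> real \<Rightarrow> real \<Rightarrow> real^('n + 'n)^('n + 'n)" where
  "system_matrix \<Omega> b Apar Aperp \<phi> \<epsilon> \<sigma> =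
     (\<chi> I J. C_form \<Omega> b Apar Aperp \<epsilon> \<sigma> (product_basis \<phi> J) (product_basis \<phi> I))"

text \<open>The norm on \<open>real^'m\<close> is Euclidean, so \<open>onorm\<close> is the matrix 2-norm. Meaningful for invertible
  matrices only.\<close>

definition cond2 :: "real^'m^'m \<Rightarrow> real" where
  "cond2 M = onorm ((*v) M) * onorm ((*v) (matrix_inv M))"

end

theory Submission
  imports Defs "HOL-Library.Function_Algebras"
begin

text \<open>The problem is finite dimensional, so solvability is injectivity, and injectivity comes from the
  inf-sup condition. Testing the second equation with elements of \<open>G\<^sub>h\<close> shows that for \<open>\<sigma> > 0\<close> the
  component \<open>\<xi>\<close> lies in \<open>A\<^sub>h\<close>, so that the inf-sup condition on \<open>V\<^sub>h \<times> A\<^sub>h\<close> applies and yields the bound.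
  No trace theorem or Poincare inequality is needed: since \<open>x / 0 = 0\<close>, a nonzero element of
  norm zero would violate the inf-sup condition, which therefore forces the norms to be definite.

  For the limits, the difference of two solutions solves the limit problem with a right-hand side of
  order \<open>\<sigma>\<close> (resp. \<open>\<epsilon>\<close>), and the inf-sup condition turns this into convergence at that rate, because
  on \<open>A\<^sub>h\<close> the dual seminorm dominates every bilinear form. The system matrix is affine in \<open>\<epsilon>\<close> and
  injective for every \<open>\<epsilon> \<in> [0,1]\<close>, so compactness of \<open>[0,1]\<close> times the unit sphere bounds the
  condition number.

  The forms are bilinear on \<open>V\<^sub>h\<close> because weak gradients are unique almost everywhere (fundamental
  lemma, with explicit bump functions on boxes). That the functions with vanishing trace form a linear
  space also needs weak gradients of smooth functions (integration by parts, from translation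
  invariance of Lebesgue measure).\<close>

subsection \<open>Bilinear forms on finite-dimensional subspaces\<close>

text \<open>The delicate quantity is the second component. When epsilon and sigma vanish, the norm
  of \<open>X\<^sub>h\<close> sees it only through the dual seminorm, whereas the perturbations
  contain its L2 product and its parallel energy. Definiteness at epsilon = sigma = 0 makes the
  parallel form nondegenerate on \<open>A\<^sub>h\<close>, so every linear functional there is
  pairing with some p in that form, and is at most the energy norm of p times the dual seminorm.
  Coordinates are such functionals; hence products of dual seminorms bound all bilinear forms on
  \<open>A\<^sub>h\<close>. The constants depend on the mesh, which stays fixed in both limits.
  Uniformity of beta is the other half: perturbed solutions obey one bound F / beta for all
  parameters, so their residuals have the order of the parameter, and the inf-sup condition is used
  a second time at the limit parameters. The argument is carried out for three forms
  \<open>a\<close>, \<open>s\<close>, \<open>l\<close> with \<open>s\<close> positive semidefinite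
  and dominated by \<open>a\<close> on the diagonal. That domination is where ellipticity of the
  perpendicular coefficient enters.\<close>

definition bilinear_on :: "'v::real_vector set \<Rightarrow> ('v \<Rightarrow> 'v \<Rightarrow> real) \<Rightarrow> bool" where
  "bilinear_on W B \<longleftrightarrow>
     (\<forall>x\<in>W. \<forall>y\<in>W. \<forall>z\<in>W. B (x + y) z = B x z + B y z \<and> B z (x + y) = B z x + B z y) \<and>
     (\<forall>c. \<forall>x\<in>W. \<forall>y\<in>W. B (c *\<^sub>R x) y = c * B x y \<and> B x (c *\<^sub>R y) = c * B x y)"

text \<open>Linearity is relative to a carrier, here and in \<open>bilinear_on\<close>: outside
  \<open>H1\<close> the chosen weak gradient is arbitrary and integrals may take default values, so
  the concrete forms are linear only on suitable sets of functions.\<close>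

definition functional_on :: "'v::real_vector set \<Rightarrow> ('v \<Rightarrow> real) \<Rightarrow> bool" where
  "functional_on W F \<longleftrightarrow> (\<forall>x\<in>W. \<forall>y\<in>W. F (x + y) = F x + F y) \<and> (\<forall>c. \<forall>x\<in>W. F (c *\<^sub>R x) = c * F x)"

text \<open>The spanning set may leave \<open>W\<close>. This is what finite elements need, since
  they are spanned most easily by discontinuous pieces.\<close>

definition fin_dim_subspace :: "'v::real_vector set \<Rightarrow> bool" where
  "fin_dim_subspace W \<longleftrightarrow> subspace W \<and> (\<exists>S. finite S \<and> W \<subseteq> span S)"

lemma bilinear_on_left: "bilinear_on W B \<Longrightarrow> y \<in> W \<Longrightarrow> functional_on W (\<lambda>x. B x y)"
  and bilinear_on_right: "bilinear_on W B \<Longrightarrow> x \<in> W \<Longrightarrow> functional_on W (B x)"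
  by (auto simp: bilinear_on_def functional_on_def)

lemma bilinear_on_subset: "bilinear_on W B \<Longrightarrow> W' \<subseteq> W \<Longrightarrow> bilinear_on W' B"
  unfolding bilinear_on_def by blast

lemma functional_on_zero: "functional_on W F \<Longrightarrow> 0 \<in> W \<Longrightarrow> F 0 = 0"
  unfolding functional_on_def by (metis mult_zero_left scaleR_zero_left)

lemma functional_on_sum:
  assumes "functional_on W F" "subspace W" "\<And>i. i \<in> I \<Longrightarrow> x i \<in> W"
  shows "F (\<Sum>i\<in>I. c i *\<^sub>R x i) = (\<Sum>i\<in>I. c i * F (x i))"
  using assms(3)
proof (induction I rule: infinite_finite_induct)
  case (infinite I)
  then show ?case using functional_on_zero[OF assms(1) subspace_0[OF assms(2)]] by simp
next
  case empty
  then show ?case using functional_on_zero[OF assms(1) subspace_0[OF assms(2)]] by simp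
next
  case (insert i I)
  then have "c i *\<^sub>R x i \<in> W" "(\<Sum>i\<in>I. c i *\<^sub>R x i) \<in> W"
    using assms(2) by (auto intro: subspace_sum subspace_scale)
  then show ?case
    using insert assms(1) by (simp add: functional_on_def)
qed

lemma functional_on_diff:
  assumes "functional_on W F" "subspace W" "x \<in> W" "y \<in> W"
  shows "F (x - y) = F x - F y"
proof -
  have "F (x + (-1) *\<^sub>R y) = F x + (-1) * F y"
    using assms by (metis functional_on_def subspace_scale)
  then show ?thesis by simp
qed

lemma bilinear_on_diff:
  assumes "bilinear_on W B" "subspace W" "x \<in> W" "y \<in> W" "z \<in> W"
  shows "B (x - y) z = B x z - B y z" "B z (x - y) = B z x - B z y"
  using functional_on_diff[OF bilinear_on_left[OF assms(1,5)] assms(2-4)]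
    functional_on_diff[OF bilinear_on_right[OF assms(1,5)] assms(2-4)] by auto

lemma fin_dim_subspace_basis:
  assumes "fin_dim_subspace W"
  obtains B where "finite B" "independent B" "B \<subseteq> W" "span B = W"
proof -
  obtain S where S: "finite S" "W \<subseteq> span S" and W: "subspace W"
    using assms by (auto simp: fin_dim_subspace_def)
  obtain B where B: "B \<subseteq> W" "independent B" "W \<subseteq> span B"
    by (rule real_vector.maximal_independent_subset)
  moreover have "finite B"
    using real_vector.independent_span_bound[of S B] S B by blast
  moreover have "span B = W"
    using B W by (simp add: span_minimal subset_antisym)
  ultimately show ?thesis using that by blast
qed

lemma fin_dim_subspace_subset: "fin_dim_subspace W \<Longrightarrow> subspace U \<Longrightarrow> U \<subseteq> W \<Longrightarrow> fin_dim_subspace U"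
  unfolding fin_dim_subspace_def by blast

lemma fin_dim_subspace_Times:
  assumes "fin_dim_subspace U" "fin_dim_subspace W"
  shows "fin_dim_subspace (U \<times> W)"
proof -
  obtain S T where ST: "finite S" "U \<subseteq> span S" "finite T" "W \<subseteq> span T"
    using assms by (auto simp: fin_dim_subspace_def)
  let ?R = "(\<lambda>x. (x, 0)) ` S \<union> (\<lambda>x. (0, x)) ` T"
  have l: "linear (\<lambda>x. (x, 0::'b))" "linear (\<lambda>x. (0::'a, x))"
    by (auto intro!: linearI)
  have "(x, y) \<in> span ?R" if "x \<in> U" "y \<in> W" for x y
  proof -
    have "(x, 0) \<in> span ((\<lambda>x. (x, 0::'b)) ` S)" "(0, y) \<in> span ((\<lambda>x. (0::'a, x)) ` T)"
      using that ST(2,4) unfolding real_vector.linear_span_image[OF l(1)] real_vector.linear_span_image[OF l(2)]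
      by blast+
    then have "(x, 0) \<in> span ?R" "(0, y) \<in> span ?R"
      by (meson Un_upper1 Un_upper2 span_mono subsetD)+
    then have "(x, 0) + (0, y) \<in> span ?R" by (rule span_add)
    then show ?thesis by simp
  qed
  moreover have "subspace (U \<times> W)"
    using assms by (auto simp: fin_dim_subspace_def subspace_Times)
  ultimately show ?thesis
    unfolding fin_dim_subspace_def using ST by (intro conjI exI[of _ ?R]) auto
qed

text \<open>Sending p to the vector whose basis coordinates are the values \<open>B p q\<close> is
  linear, and injective by nondegeneracy. In finite dimension it is then onto, and a preimage of the
  vector with coordinates \<open>F q\<close> represents \<open>F\<close>.\<close>

lemma nondegenerate_representation:
  assumes W: "fin_dim_subspace W" and B: "bilinear_on W B" and F: "functional_on W F"
    and nondeg: "\<And>p. p \<in> W \<Longrightarrow> (\<And>q. q \<in> W \<Longrightarrow> B p q = 0) \<Longrightarrow> p = 0"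
  shows "\<exists>p\<in>W. \<forall>q\<in>W. B p q = F q"
proof -
  obtain S where S: "finite S" "independent S" "S \<subseteq> W" "span S = W"
    using fin_dim_subspace_basis[OF W] .
  have sub: "subspace W" using W by (simp add: fin_dim_subspace_def)
  \<comment> \<open>\<open>T\<close> is linear only on \<open>W\<close>. The globally linear
    \<open>g\<close> below agrees with it there and gives access to the facts about linear
    maps.\<close>
  define T where "T p = (\<Sum>q\<in>S. B p q *\<^sub>R q)" for p
  obtain g where g: "linear g" "\<And>x. x \<in> S \<Longrightarrow> g x = T x"
    using real_vector.linear_independent_extend[OF S(2)] by metis
  have coord: "c q = d q" if "(\<Sum>q\<in>S. c q *\<^sub>R q) = (\<Sum>q\<in>S. d q *\<^sub>R q)" "q \<in> S" for c d q
  proof -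
    have "(\<Sum>q\<in>S. (c q - d q) *\<^sub>R q) = 0"
      using that by (simp add: scaleR_diff_left sum_subtractf)
    from real_vector.independentD[OF S(2) S(1) subset_refl this that(2)] have "c q - d q = 0" .
    then show ?thesis by simp
  qed
  have expand: "\<exists>c. p = (\<Sum>q\<in>S. c q *\<^sub>R q)" if "p \<in> W" for p
    using real_vector.span_finite[OF S(1)] that S(4) by auto
  have gT: "g p = T p" if p: "p \<in> W" for p
  proof -
    obtain c where c: "p = (\<Sum>q\<in>S. c q *\<^sub>R q)" using expand[OF p] by blast
    have "g p = (\<Sum>r\<in>S. c r *\<^sub>R T r)"
      unfolding c using g by (simp add: linear_sum linear_scale)
    also have "\<dots> = (\<Sum>q\<in>S. (\<Sum>r\<in>S. c r * B r q) *\<^sub>R q)"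
      unfolding T_def by (simp add: scaleR_sum_right scaleR_sum_left) (subst sum.swap, simp)
    also have "\<dots> = T p"
      unfolding T_def c using functional_on_sum[OF bilinear_on_left[OF B] sub, of _ S "\<lambda>x. x" c] S(3)
      by (intro sum.cong) (auto simp: subset_iff)
    finally show ?thesis .
  qed
  have eq: "B p q = F' q"
    if pq: "p \<in> W" "q \<in> W" "functional_on W F'" "\<And>q. q \<in> S \<Longrightarrow> B p q = F' q" for p q F'
  proof -
    obtain c where c: "q = (\<Sum>q\<in>S. c q *\<^sub>R q)" using expand[OF pq(2)] by blast
    show ?thesis
      unfolding c using functional_on_sum[OF bilinear_on_right[OF B pq(1)] sub, of S "\<lambda>x. x" c] 
        functional_on_sum[OF pq(3) sub, of S "\<lambda>x. x" c] S(3) pq(4)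
      by (auto simp: subset_iff)
  qed
  have z: "functional_on W (\<lambda>_. 0)" by (simp add: functional_on_def)
  have inj: "inj_on g (span S)"
  proof (subst real_vector.linear_inj_on_iff_eq_0[OF g(1) real_vector.subspace_span], intro ballI impI)
    fix p assume p: "p \<in> span S" "g p = 0"
    then have "(\<Sum>q\<in>S. B p q *\<^sub>R q) = (\<Sum>q\<in>S. 0 *\<^sub>R q)"
      using gT S(4) by (simp add: T_def)
    then have "\<And>q. q \<in> S \<Longrightarrow> B p q = 0" using coord[of "B p" "\<lambda>_. 0"] by blast
    then show "p = 0" using nondeg eq[OF _ _ z] p S(4) by blast
  qed
  have ind: "independent (g ` S)"
    using real_vector.linear_independent_injective_image[OF g(1) S(2) inj] .
  have card: "card (g ` S) = card S"
    using inj real_vector.span_superset by (intro card_image) (rule inj_on_subset)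
  have gS: "g ` S \<subseteq> W"
    using g(2) S(3) sub by (auto simp: T_def subset_iff intro!: subspace_sum subspace_scale)
  \<comment> \<open>A missed \<open>y\<close>, together with the independent image of the basis,
    would be one independent vector too many in \<open>span S\<close>.\<close>
  have onto: "y \<in> g ` W" if y: "y \<in> W" for y
  proof (rule ccontr)
    assume "y \<notin> g ` W"
    then have "y \<notin> span (g ` S)" using real_vector.linear_span_image[OF g(1), of S] S(4) by simp
    then have "independent (insert y (g ` S))" "y \<notin> g ` S"
      using ind real_vector.independent_insertI real_vector.span_superset by blast+
    moreover have "insert y (g ` S) \<subseteq> span S" using y gS S(4) by simp
    ultimately have "Suc (card (g ` S)) \<le> card S"
      using real_vector.independent_span_bound[OF S(1), of "insert y (g ` S)"] S(1) by simp
    then show False using card by simp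
  qed
  have "(\<Sum>q\<in>S. F q *\<^sub>R q) \<in> W"
    using S(3) sub by (auto simp: subset_iff intro!: subspace_sum subspace_scale)
  from onto[OF this] obtain p where p: "p \<in> W" "g p = (\<Sum>q\<in>S. F q *\<^sub>R q)" by auto
  then have "(\<Sum>q\<in>S. B p q *\<^sub>R q) = (\<Sum>q\<in>S. F q *\<^sub>R q)" using gT by (simp add: T_def)
  then have "\<And>q. q \<in> S \<Longrightarrow> B p q = F q" using coord by blast
  then show ?thesis using eq[OF p(1) _ F] p(1) by blast
qed

lemma psd_cauchy_schwarz:
  assumes W: "subspace W" and B: "bilinear_on W B" and sym: "\<And>x y. x \<in> W \<Longrightarrow> y \<in> W \<Longrightarrow> B x y = B y x"
    and nonneg: "\<And>x. x \<in> W \<Longrightarrow> 0 \<le> B x x" and xy: "x \<in> W" "y \<in> W"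
  shows "\<bar>B x y\<bar> \<le> sqrt (B x x) * sqrt (B y y)"
proof -
  have q: "0 \<le> B x x + 2 * t * B x y + t\<^sup>2 * B y y" for t
  proof -
    have ty: "t *\<^sub>R y \<in> W" "x + t *\<^sub>R y \<in> W" using W xy by (auto intro: subspace_scale subspace_add)
    have "B (x + t *\<^sub>R y) (x + t *\<^sub>R y) = B x x + 2 * t * B x y + t\<^sup>2 * B y y"
      using B sym[OF xy] xy ty by (simp add: bilinear_on_def power2_eq_square algebra_simps)
    then show ?thesis using nonneg[OF ty(2)] by simp
  qed
  have "(B x y)\<^sup>2 \<le> B x x * B y y"
  proof (cases "B y y = 0")
    case True
    have "B x y = 0"
    proof (rule ccontr)
      assume "B x y \<noteq> 0"
      \<comment> \<open>With \<open>B y y = 0\<close> the quadratic is affine in t, and this t gives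
        it the value -1. In the other case the witness below is its minimiser.\<close>
      then show False using q[of "- (B x x + 1) / (2 * B x y)"] True by (simp add: field_simps)
    qed
    then show ?thesis using True by simp
  next
    case False
    then have "B y y > 0" using nonneg[OF xy(2)] by simp
    then show ?thesis using q[of "- B x y / B y y"] by (simp add: field_simps power2_eq_square)
  qed
  then show ?thesis
    by (metis real_sqrt_abs real_sqrt_le_iff real_sqrt_mult)
qed

text \<open>Riesz representation and coordinates replace the equivalence of norms on a finite-dimensional
  space: \<open>N\<close> only has to dominate every linear functional.\<close>

lemma bilinear_on_bounded:
  assumes W: "fin_dim_subspace W" and N: "\<And>F. functional_on W F \<Longrightarrow> \<exists>C. \<forall>w\<in>W. \<bar>F w\<bar> \<le> C * N w"
    and Nn: "\<And>w. w \<in> W \<Longrightarrow> 0 \<le> N w" and Q: "bilinear_on W Q"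
  shows "\<exists>K\<ge>0. \<forall>w\<in>W. \<forall>z\<in>W. \<bar>Q w z\<bar> \<le> K * N w * N z"
proof -
  obtain S where S: "finite S" "independent S" "S \<subseteq> W" "span S = W"
    using fin_dim_subspace_basis[OF W] .
  have sub: "subspace W" using W by (simp add: fin_dim_subspace_def)
  define r where "r w b = representation S w b" for w b
  have "functional_on W (\<lambda>w. r w b)" for b
    unfolding r_def functional_on_def using S
    by (simp add: real_vector.representation_add real_vector.representation_scale)
  then have "\<forall>b. \<exists>C. \<forall>w\<in>W. \<bar>r w b\<bar> \<le> C * N w" by (intro allI N)
  then obtain C where C: "\<And>w b. w \<in> W \<Longrightarrow> \<bar>r w b\<bar> \<le> C b * N w"
    unfolding choice_iff by blast
  have rep: "w = (\<Sum>b\<in>S. r w b *\<^sub>R b)" if "w \<in> W" for w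
    unfolding r_def using real_vector.sum_representation_eq[OF S(2), of w S] that S by simp
  \<comment> \<open>Expanding both arguments in the basis, each coordinate costs a factor
    \<open>C b\<close> times \<open>N\<close>, and the entries \<open>Q b c\<close> are fixed
    numbers.\<close>
  define K where "K = (\<Sum>b\<in>S. \<Sum>c\<in>S. \<bar>Q b c\<bar> * \<bar>C b\<bar> * \<bar>C c\<bar>)"
  have C': "\<bar>r w b\<bar> \<le> \<bar>C b\<bar> * N w" if "w \<in> W" for w b
    using C[OF that] Nn[OF that] by (meson abs_ge_self mult_right_mono order_trans)
  have "\<bar>Q w z\<bar> \<le> K * N w * N z" if wz: "w \<in> W" "z \<in> W" for w z
  proof -
    have "Q w z = Q (\<Sum>b\<in>S. r w b *\<^sub>R b) z" using rep[OF wz(1)] by simp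
    also have "\<dots> = (\<Sum>b\<in>S. r w b * Q b z)"
      using functional_on_sum[OF bilinear_on_left[OF Q wz(2)] sub, of S "\<lambda>x. x"] S(3) by (simp add: subset_iff)
    also have "\<dots> = (\<Sum>b\<in>S. r w b * (\<Sum>c\<in>S. r z c * Q b c))"
    proof (intro sum.cong refl)
      fix b assume b: "b \<in> S"
      have "Q b z = Q b (\<Sum>c\<in>S. r z c *\<^sub>R c)" using rep[OF wz(2)] by simp
      also have "\<dots> = (\<Sum>c\<in>S. r z c * Q b c)"
        using functional_on_sum[OF bilinear_on_right[OF Q] sub, of b S "\<lambda>x. x"] S(3) b by (simp add: subset_iff)
      finally show "r w b * Q b z = r w b * (\<Sum>c\<in>S. r z c * Q b c)" by simp
    qed
    finally have "\<bar>Q w z\<bar> \<le> (\<Sum>b\<in>S. \<Sum>c\<in>S. \<bar>r w b * (r z c * Q b c)\<bar>)"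
      by (simp only: sum_distrib_left) (rule order_trans[OF sum_abs], rule sum_mono, rule sum_abs)
    also have "\<dots> \<le> (\<Sum>b\<in>S. \<Sum>c\<in>S. (\<bar>C b\<bar> * N w) * ((\<bar>C c\<bar> * N z) * \<bar>Q b c\<bar>))"
      unfolding abs_mult using C' wz Nn by (intro sum_mono mult_mono) (auto intro!: mult_nonneg_nonneg)
    also have "\<dots> = K * N w * N z"
      unfolding K_def by (simp add: sum_distrib_right sum_distrib_left mult_ac)
    finally show ?thesis .
  qed
  moreover have "K \<ge> 0" unfolding K_def by (intro sum_nonneg) auto
  ultimately show ?thesis by blast
qed

subsection \<open>The condition number of a compact family of matrices\<close>

lemma matrix_inverse_cancel:
  fixes M :: "real^'m^'m"
  assumes "invertible M" shows "M *v (matrix_inv M *v y) = y"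
proof -
  have "M ** matrix_inv M = mat 1"
    using assms unfolding invertible_def matrix_inv_def by (rule someI2_ex) blast
  then show ?thesis by (simp add: matrix_vector_mul_assoc)
qed

text \<open>The norm of \<open>M t *v x\<close> attains its extrema over parameters and unit
  vectors. Its maximum bounds all the matrices; its minimum is positive because it is attained where
  injectivity applies, and its reciprocal bounds all the inverses.\<close>

lemma cond2_bounded:
  fixes M :: "'t::metric_space \<Rightarrow> real^'m^'m"
  assumes T: "compact T" and cont: "continuous_on T M" and inj: "\<And>t x. t \<in> T \<Longrightarrow> M t *v x = 0 \<Longrightarrow> x = 0"
  shows "\<exists>K. \<forall>t\<in>T. invertible (M t) \<and> cond2 (M t) \<le> K"
proof (cases "T = {}")
  case False
  define g where "g = (\<lambda>(t, x). norm (M t *v x))"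
  define S where "S = T \<times> (sphere 0 1 :: (real^'m) set)"
  have "axis undefined 1 \<in> (sphere 0 1 :: (real^'m) set)" by simp
  then have S: "compact S" "S \<noteq> {}"
    unfolding S_def using T False by (auto intro!: compact_Times)
  have "continuous_on S (\<lambda>p. M (fst p))"
    unfolding S_def by (rule continuous_on_compose2[OF cont continuous_on_fst[OF continuous_on_id]]) auto
  then have "continuous_on S g"
    unfolding g_def split_beta matrix_vector_mult_def
    by (intro continuous_on_norm continuous_on_vec_lambda continuous_on_sum continuous_on_mult
        continuous_on_component continuous_on_snd continuous_on_id)
  then obtain p q where p: "p \<in> S" "\<And>z. z \<in> S \<Longrightarrow> g p \<le> g z" and q: "q \<in> S" "\<And>z. z \<in> S \<Longrightarrow> g z \<le> g q"
    using continuous_attains_inf[OF S] continuous_attains_sup[OF S] by metis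
  have "g p > 0" using p(1) inj by (force simp: S_def g_def)
  have scale: "norm (M t *v x) = norm x * g (t, x /\<^sub>R norm x)" if "x \<noteq> 0" for t x
    using that by (simp add: g_def matrix_vector_mult_scaleR)
  have unit: "(t, x /\<^sub>R norm x) \<in> S" if "t \<in> T" "x \<noteq> 0" for t x using that by (simp add: S_def)
  have upper: "norm (M t *v x) \<le> g q * norm x" if "t \<in> T" for t x
    using scale[of x t] q(2)[OF unit[OF that]] by (cases "x = 0") (auto simp: mult.commute mult_right_mono)
  have lower: "g p * norm x \<le> norm (M t *v x)" if "t \<in> T" for t x
    using scale[of x t] p(2)[OF unit[OF that]] by (cases "x = 0") (auto simp: mult.commute mult_right_mono)
  have "invertible (M t) \<and> cond2 (M t) \<le> g q * (1 / g p)" if t: "t \<in> T" for t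
  proof -
    have inv: "invertible (M t)"
      using inj[OF t] matrix_left_invertible_ker invertible_left_inverse by blast
    have "norm (matrix_inv (M t) *v y) \<le> 1 / g p * norm y" for y
      using lower[OF t, of "matrix_inv (M t) *v y"] \<open>g p > 0\<close>
      by (simp add: matrix_inverse_cancel[OF inv] field_simps)
    moreover have "0 \<le> g q" by (simp add: g_def split_beta)
    ultimately have "onorm ((*v) (M t)) \<le> g q" "onorm ((*v) (matrix_inv (M t))) \<le> 1 / g p"
      using upper[OF t] \<open>g p > 0\<close> by (auto intro!: onorm_bound)
    moreover have "0 \<le> onorm ((*v) (matrix_inv (M t)))"
      by (rule onorm_pos_le) (rule matrix_vector_mul_bounded_linear)
    ultimately show ?thesis
      unfolding cond2_def using inv \<open>0 \<le> g q\<close> by (blast intro: mult_mono)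
  qed
  then show ?thesis by blast
qed auto

subsection \<open>The abstract mixed problem\<close>

text \<open>Abstract counterparts of \<open>star_norm\<close>, \<open>X_norm\<close>,
  \<open>C_form\<close> and \<open>A_space\<close>, with \<open>a\<close>, \<open>s\<close>,
  \<open>l\<close> for \<open>a_form\<close>, \<open>a_par\<close>, \<open>L2_inner\<close>. The
  squared square roots are kept so that the concrete norm matches by unfolding.\<close>

definition dual_seminorm :: "'v set \<Rightarrow> ('v \<Rightarrow> 'v \<Rightarrow> real) \<Rightarrow> ('v \<Rightarrow> 'v \<Rightarrow> real) \<Rightarrow> 'v \<Rightarrow> real" where
  "dual_seminorm V a s \<xi> = (SUP v\<in>V. s \<xi> v / sqrt (a v v))"

definition mixed_norm ::
  "'v set \<Rightarrow> ('v \<Rightarrow> 'v \<Rightarrow> real) \<Rightarrow> ('v \<Rightarrow> 'v \<Rightarrow> real) \<Rightarrow> ('v \<Rightarrow> 'v \<Rightarrow> real) \<Rightarrow> real \<Rightarrow> real \<Rightarrow> 'v \<times> 'v \<Rightarrow> real" where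
  "mixed_norm V a s l \<epsilon> \<sigma> = (\<lambda>(u, \<xi>).
     sqrt ((sqrt (a u u))\<^sup>2 + (dual_seminorm V a s \<xi>)\<^sup>2 + \<epsilon> * (sqrt (s \<xi> \<xi>))\<^sup>2 + \<sigma> * l \<xi> \<xi>))"

definition mixed_form ::
  "('v \<Rightarrow> 'v \<Rightarrow> real) \<Rightarrow> ('v \<Rightarrow> 'v \<Rightarrow> real) \<Rightarrow> ('v \<Rightarrow> 'v \<Rightarrow> real) \<Rightarrow> real \<Rightarrow> real \<Rightarrow> 'v \<times> 'v \<Rightarrow> 'v \<times> 'v \<Rightarrow> real" where
  "mixed_form a s l \<epsilon> \<sigma> = (\<lambda>(u, \<xi>) (v, w).
     a u v + (1 - \<epsilon>) * s \<xi> v + s u w - \<epsilon> * s \<xi> w - \<sigma> * l \<xi> w)"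

text \<open>The kernel is given as the null set of the quadratic form of \<open>s\<close>, which
  makes sense without gradients; \<open>a_par_eq_0_iff\<close> provides the link to
  \<open>G_space\<close>.\<close>

definition kernel_complement :: "'v set \<Rightarrow> ('v \<Rightarrow> 'v \<Rightarrow> real) \<Rightarrow> ('v \<Rightarrow> 'v \<Rightarrow> real) \<Rightarrow> 'v set" where
  "kernel_complement V s l = {v\<in>V. \<forall>w\<in>V. s w w = 0 \<longrightarrow> l v w = 0}"

text \<open>The inf-sup condition appears in eliminated form, without quotients: any
  \<open>M\<close> bounding the form against \<open>N q\<close> also bounds beta times the norm of
  \<open>p\<close>. Positivity of the norm, which the quotient form hides in its denominators, is an
  assumption of its own.\<close>

locale mixed_problem =
  fixes V :: "'v::real_vector set" and a s l :: "'v \<Rightarrow> 'v \<Rightarrow> real" and \<beta> :: real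
  assumes V: "fin_dim_subspace V"
    and bilin: "bilinear_on V a" "bilinear_on V s" "bilinear_on V l"
    and s_sym: "\<And>x y. s x y = s y x"
    and s_nonneg: "\<And>v. v \<in> V \<Longrightarrow> 0 \<le> s v v" and s_le_a: "\<And>v. v \<in> V \<Longrightarrow> s v v \<le> a v v"
    and l_nonneg: "\<And>v. v \<in> V \<Longrightarrow> 0 \<le> l v v"
    and beta_pos: "0 < \<beta>"
    and mixed_norm_pos: "\<And>\<epsilon> \<sigma> p. \<epsilon> \<in> {0..1} \<Longrightarrow> 0 \<le> \<sigma> \<Longrightarrow> p \<in> V \<times> kernel_complement V s l \<Longrightarrow> p \<noteq> 0 \<Longrightarrow>
      0 < mixed_norm V a s l \<epsilon> \<sigma> p"
    and inf_sup_nonzero: "\<And>\<epsilon> \<sigma> p M. \<epsilon> \<in> {0..1} \<Longrightarrow> 0 \<le> \<sigma> \<Longrightarrow> p \<in> V \<times> kernel_complement V s l \<Longrightarrow> p \<noteq> 0 \<Longrightarrow>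
      (\<And>q. q \<in> V \<times> kernel_complement V s l \<Longrightarrow> mixed_form a s l \<epsilon> \<sigma> p q \<le> M * mixed_norm V a s l \<epsilon> \<sigma> q) \<Longrightarrow>
      \<beta> * mixed_norm V a s l \<epsilon> \<sigma> p \<le> M"
begin

section \<open>Semidefinite forms and the dual seminorm\<close>

abbreviation "K \<equiv> kernel_complement V s l"
abbreviation "enorm v \<equiv> sqrt (a v v)"
abbreviation "star \<equiv> dual_seminorm V a s"
abbreviation "N \<equiv> mixed_norm V a s l"
abbreviation "C \<equiv> mixed_form a s l"

lemma subspace_V: "subspace V" and zero_V: "0 \<in> V"
  using V by (auto simp: fin_dim_subspace_def subspace_0)

lemma a_nonneg: "v \<in> V \<Longrightarrow> 0 \<le> a v v"
  using s_nonneg s_le_a by (meson order_trans)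

lemma K_subset: "K \<subseteq> V"
  by (auto simp: kernel_complement_def)

lemma subspace_K: "subspace K"
  using bilin(3) zero_V subspace_V functional_on_zero[OF bilinear_on_left[OF bilin(3)]]
  by (auto simp: kernel_complement_def bilinear_on_def subspace_def)

lemma fin_dim_K: "fin_dim_subspace K"
  using fin_dim_subspace_subset[OF V subspace_K K_subset] .

lemma zero_K: "0 \<in> K"
  using subspace_K subspace_0 by blast

lemma s_cauchy_schwarz: "x \<in> V \<Longrightarrow> y \<in> V \<Longrightarrow> \<bar>s x y\<bar> \<le> sqrt (s x x) * sqrt (s y y)"
  using psd_cauchy_schwarz[OF subspace_V bilin(2)] s_sym s_nonneg by blast

lemma s_kernel: "x \<in> V \<Longrightarrow> y \<in> V \<Longrightarrow> s x x = 0 \<or> s y y = 0 \<Longrightarrow> s x y = 0"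
  using s_cauchy_schwarz[of x y] by auto

text \<open>Boundedness gives the real supremum in \<open>star\<close> its meaning. The bound is
  Cauchy-Schwarz for \<open>s\<close> followed by \<open>s_le_a\<close>; a zero denominator
  contributes 0.\<close>

lemma star_bdd: 
  assumes "\<xi> \<in> V" shows "bdd_above ((\<lambda>v. s \<xi> v / enorm v) ` V)"
proof (rule bdd_aboveI2)
  fix v assume v: "v \<in> V"
  have "s \<xi> v \<le> sqrt (s \<xi> \<xi>) * sqrt (s v v)" using s_cauchy_schwarz[OF assms v] by simp
  also have "\<dots> \<le> sqrt (s \<xi> \<xi>) * enorm v" using s_le_a[OF v] s_nonneg[OF assms] by (intro mult_left_mono) auto
  finally show "s \<xi> v / enorm v \<le> sqrt (s \<xi> \<xi>)"
    using a_nonneg[OF v] s_nonneg[OF assms] by (cases "a v v = 0") (simp_all add: pos_divide_le_eq)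
qed

text \<open>The supremum is over signed quotients, so the absolute value comes from using both
  \<open>v\<close> and its negative. If \<open>v\<close> has energy zero the quotient carries no
  information, but then \<open>s v v = 0\<close> and Cauchy-Schwarz gives
  \<open>s \<xi> v = 0\<close>.\<close>

lemma s_le_star:
  assumes "\<xi> \<in> V" "v \<in> V" shows "\<bar>s \<xi> v\<bar> \<le> star \<xi> * enorm v"
proof (cases "a v v = 0")
  case True
  then have "s v v = 0" using s_nonneg[OF assms(2)] s_le_a[OF assms(2)] by linarith
  then have "s \<xi> v = 0" using s_kernel[OF assms] by blast
  then show ?thesis using True by simp
next
  case False
  then have p: "0 < enorm v" using a_nonneg[OF assms(2)] by simp
  have le: "s \<xi> w / enorm w \<le> star \<xi>" if "w \<in> V" for w
    unfolding dual_seminorm_def using star_bdd[OF assms(1)] that by (rule cSUP_upper2) auto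
  have m: "(- 1) *\<^sub>R v \<in> V" using subspace_V assms by (simp only: subspace_scale)
  have "s \<xi> ((- 1) *\<^sub>R v) = (- 1) * s \<xi> v"
    using bilin(2) assms unfolding bilinear_on_def by blast
  moreover have "a ((- 1) *\<^sub>R v) ((- 1) *\<^sub>R v) = (- 1) * a v ((- 1) *\<^sub>R v)" "a v ((- 1) *\<^sub>R v) = (- 1) * a v v"
    using bilin(1) assms m unfolding bilinear_on_def by blast+
  ultimately have "s \<xi> ((- 1) *\<^sub>R v) = - s \<xi> v" "a ((- 1) *\<^sub>R v) ((- 1) *\<^sub>R v) = a v v"
    by simp_all
  then show ?thesis using le[OF assms(2)] le[OF m] p by (simp add: pos_divide_le_eq minus_divide_left abs_le_iff del: minus_divide_left[symmetric])
qed

lemma zero_right: "x \<in> V \<Longrightarrow> a x 0 = 0" "x \<in> V \<Longrightarrow> s x 0 = 0" "x \<in> V \<Longrightarrow> l x 0 = 0"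
  using functional_on_zero[OF bilinear_on_right[OF bilin(1)]] functional_on_zero[OF bilinear_on_right[OF bilin(2)]]
    functional_on_zero[OF bilinear_on_right[OF bilin(3)]] zero_V by simp_all

lemma star_nonneg: "\<xi> \<in> V \<Longrightarrow> 0 \<le> star \<xi>"
  unfolding dual_seminorm_def
  by (rule cSUP_upper2[OF star_bdd zero_V]) (simp_all add: zero_right)

lemma star_kernel:
  assumes "\<xi> \<in> V" "s \<xi> \<xi> = 0" shows "star \<xi> = 0"
proof -
  have "(\<lambda>v. s \<xi> v / enorm v) ` V = {0}"
    using s_kernel[OF assms(1)] assms(2) zero_V by (auto simp: image_iff zero_right[OF assms(1)])
  then show ?thesis unfolding dual_seminorm_def by simp
qed

lemma mixed_norm_bounds:
  assumes "u \<in> V" "\<xi> \<in> V" "0 \<le> \<epsilon>" "0 \<le> \<sigma>"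
  shows "enorm u \<le> N \<epsilon> \<sigma> (u, \<xi>)" "star \<xi> \<le> N \<epsilon> \<sigma> (u, \<xi>)" "0 \<le> N \<epsilon> \<sigma> (u, \<xi>)"
proof -
  have nn: "0 \<le> \<epsilon> * (sqrt (s \<xi> \<xi>))\<^sup>2" "0 \<le> \<sigma> * l \<xi> \<xi>" using assms l_nonneg by simp_all
  show "enorm u \<le> N \<epsilon> \<sigma> (u, \<xi>)" "star \<xi> \<le> N \<epsilon> \<sigma> (u, \<xi>)"
    unfolding mixed_norm_def prod.case by (rule real_le_rsqrt, use nn in simp)+
  then show "0 \<le> N \<epsilon> \<sigma> (u, \<xi>)" using star_nonneg[OF assms(2)] by linarith
qed

lemma inf_sup:
  assumes "\<epsilon> \<in> {0..1}" "0 \<le> \<sigma>" "p \<in> V \<times> K" "0 \<le> M" "\<And>q. q \<in> V \<times> K \<Longrightarrow> C \<epsilon> \<sigma> p q \<le> M * N \<epsilon> \<sigma> q"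
  shows "\<beta> * N \<epsilon> \<sigma> p \<le> M"
proof (cases "p = 0")
  case True
  then have "N \<epsilon> \<sigma> p = 0"
    using star_kernel[OF zero_V] zero_right[OF zero_V] by (simp add: mixed_norm_def zero_prod_def)
  then show ?thesis using assms(4) by simp
qed (use inf_sup_nonzero assms in blast)

text \<open>For epsilon = sigma = 0 and first component 0, the mixed norm reduces to
  \<open>star \<xi>\<close>, which vanishes on the kernel of \<open>s\<close>; definiteness leaves
  only zero.\<close>

lemma K_kernel_trivial:
  assumes "\<xi> \<in> K" "s \<xi> \<xi> = 0" shows "\<xi> = 0"
proof (rule ccontr)
  assume "\<xi> \<noteq> 0"
  then have "0 < N 0 0 (0, \<xi>)"
    using assms(1) zero_V by (intro mixed_norm_pos) (auto simp: zero_prod_def)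
  then show False
    using assms star_kernel[of \<xi>] zero_right(1)[OF zero_V] K_subset by (auto simp: mixed_norm_def)
qed

text \<open>\<open>s\<close> is nondegenerate on \<open>K\<close>: an element annihilated by all of
  \<open>K\<close> is annihilated by itself. So \<open>F\<close> is pairing with some
  \<open>p\<close> in \<open>s\<close>, and the energy norm of \<open>p\<close> serves as the
  constant.\<close>

lemma star_dominates:
  assumes "functional_on K F" shows "\<exists>c. \<forall>w\<in>K. \<bar>F w\<bar> \<le> c * star w"
proof -
  obtain p where p: "p \<in> K" "\<forall>q\<in>K. s p q = F q"
    using nondegenerate_representation[OF fin_dim_K bilinear_on_subset[OF bilin(2) K_subset] assms] 
      K_kernel_trivial by blast
  have "\<bar>F w\<bar> \<le> enorm p * star w" if "w \<in> K" for w
    using s_le_star[of w p] p that K_subset s_sym[of p w] by (auto simp: mult.commute)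
  then show ?thesis by blast
qed

lemma bilinear_le_star:
  assumes "bilinear_on V Q"
  shows "\<exists>k\<ge>0. \<forall>w\<in>K. \<forall>z\<in>K. \<bar>Q w z\<bar> \<le> k * star w * star z"
proof (rule bilinear_on_bounded[OF fin_dim_K])
  show "bilinear_on K Q" by (rule bilinear_on_subset[OF assms K_subset])
qed (use star_dominates star_nonneg K_subset in auto)

section \<open>Unique solvability and the a priori bound\<close>

lemma bilinear_C: "bilinear_on (V \<times> V) (C \<epsilon> \<sigma>)"
  using bilin unfolding bilinear_on_def mixed_form_def
  by (auto simp: algebra_simps)

lemma VK_subset: "V \<times> K \<subseteq> V \<times> V"
  using K_subset by auto

text \<open>The sum of the two equations, as one variational problem on a product space. Testing
  with a zero component separates them again, see \<open>solution_iff\<close>.\<close>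

definition solution :: "'v set \<Rightarrow> ('v \<Rightarrow> real) \<Rightarrow> real \<Rightarrow> real \<Rightarrow> 'v \<times> 'v \<Rightarrow> bool" where
  "solution W f \<epsilon> \<sigma> p \<longleftrightarrow> p \<in> V \<times> W \<and> (\<forall>q\<in>V \<times> W. C \<epsilon> \<sigma> p q = f (fst q))"

lemma C_nondegenerate:
  assumes "\<epsilon> \<in> {0..1}" "0 \<le> \<sigma>" "p \<in> V \<times> K" "\<And>q. q \<in> V \<times> K \<Longrightarrow> C \<epsilon> \<sigma> p q = 0"
  shows "p = 0"
proof (rule ccontr)
  assume "p \<noteq> 0"
  then have "0 < N \<epsilon> \<sigma> p" using mixed_norm_pos assms by blast
  moreover have "\<beta> * N \<epsilon> \<sigma> p \<le> 0" using inf_sup[of \<epsilon> \<sigma> p 0] assms by simp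
  ultimately show False using beta_pos by (simp add: mult_le_0_iff)
qed

lemma stabilized_in_K:
  assumes "0 < \<sigma>" "p \<in> V \<times> V" "\<And>w. w \<in> V \<Longrightarrow> C \<epsilon> \<sigma> p (0, w) = 0"
  shows "p \<in> V \<times> K"
proof -
  obtain u \<xi> where p: "p = (u, \<xi>)" "u \<in> V" "\<xi> \<in> V" using assms(2) by auto
  \<comment> \<open>For \<open>w\<close> in the kernel, Cauchy-Schwarz removes both terms with
    \<open>s\<close>, so the second equation reads \<open>\<sigma> * l \<xi> w = 0\<close>, and
    sigma can be cancelled.\<close>
  have "l \<xi> w = 0" if w: "w \<in> V" "s w w = 0" for w
    using assms(3)[OF w(1)] assms(1) s_kernel[of u w] s_kernel[of \<xi> w] w p
      functional_on_zero[OF bilinear_on_right[OF bilin(1)], of u]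
      functional_on_zero[OF bilinear_on_right[OF bilin(2)], of \<xi>] zero_V
    by (simp add: mixed_form_def)
  then show ?thesis using p by (auto simp: kernel_complement_def)
qed

text \<open>The inf-sup condition speaks about \<open>V \<times> K\<close> only. Tests with
  vanishing first component place \<open>p\<close> in that space before it is applied.\<close>

lemma C_nondegenerate_V:
  assumes "\<epsilon> \<in> {0..1}" "0 < \<sigma>" "p \<in> V \<times> V" "\<And>q. q \<in> V \<times> V \<Longrightarrow> C \<epsilon> \<sigma> p q = 0"
  shows "p = 0"
proof (rule C_nondegenerate)
  show "p \<in> V \<times> K" using stabilized_in_K[OF assms(2,3)] assms(4) zero_V by blast
  show "C \<epsilon> \<sigma> p q = 0" if "q \<in> V \<times> K" for q
    using assms(4) that VK_subset by blast
qed (use assms in auto)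

lemma unique_solution:
  assumes W: "subspace W" "W \<subseteq> V" and f: "functional_on V f"
    and nondeg: "\<And>p. p \<in> V \<times> W \<Longrightarrow> (\<And>q. q \<in> V \<times> W \<Longrightarrow> C \<epsilon> \<sigma> p q = 0) \<Longrightarrow> p = 0"
  shows "\<exists>!p. solution W f \<epsilon> \<sigma> p"
proof -
  have fin: "fin_dim_subspace (V \<times> W)"
    using V fin_dim_subspace_subset[OF V W] by (rule fin_dim_subspace_Times)
  have C: "bilinear_on (V \<times> W) (C \<epsilon> \<sigma>)"
    by (rule bilinear_on_subset[OF bilinear_C]) (use W(2) in auto)
  have F: "functional_on (V \<times> W) (\<lambda>q. f (fst q))"
    using f by (auto simp: functional_on_def)
  obtain p where p: "solution W f \<epsilon> \<sigma> p"
    using nondegenerate_representation[OF fin C F] nondeg unfolding solution_def by blast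
  have "p' = p" if p': "solution W f \<epsilon> \<sigma> p'" for p'
  proof -
    have sub: "subspace (V \<times> W)" using fin by (simp add: fin_dim_subspace_def)
    have "p' - p = 0"
    proof (rule nondeg)
      show "p' - p \<in> V \<times> W" using p p' sub unfolding solution_def by (blast intro: subspace_diff)
      show "C \<epsilon> \<sigma> (p' - p) q = 0" if "q \<in> V \<times> W" for q
        using bilinear_on_diff(1)[OF C sub, of p' p q] p p' that unfolding solution_def by simp
    qed
    then show ?thesis by simp
  qed
  then show ?thesis using p by blast
qed

lemma unique_solution_stabilized:
  "\<epsilon> \<in> {0..1} \<Longrightarrow> 0 < \<sigma> \<Longrightarrow> functional_on V f \<Longrightarrow> \<exists>!p. solution V f \<epsilon> \<sigma> p"
  using subspace_V C_nondegenerate_V by (intro unique_solution) blast+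

lemma unique_solution_limit:
  "\<epsilon> \<in> {0..1} \<Longrightarrow> functional_on V f \<Longrightarrow> \<exists>!p. solution K f \<epsilon> 0 p"
  using subspace_K K_subset C_nondegenerate[OF _ order_refl] by (intro unique_solution) blast+

text \<open>Brings the stabilised and the limit problem onto the same trial and test space, so that
  their solutions can be subtracted.\<close>

lemma stabilized_solution_K:
  assumes "0 < \<sigma>" "functional_on V f" "solution V f \<epsilon> \<sigma> p"
  shows "solution K f \<epsilon> \<sigma> p"
proof -
  have "p \<in> V \<times> K"
    using stabilized_in_K[of \<sigma> p \<epsilon>] assms functional_on_zero[OF assms(2) zero_V] zero_V
    unfolding solution_def by force
  then show ?thesis using assms(3) VK_subset unfolding solution_def by blast
qed

text \<open>The inf-sup condition with \<open>M = F\<close>: the right-hand side sees only the first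
  test component, whose energy norm is part of the mixed norm. The bound is the same for all epsilon
  and sigma, which both perturbation lemmas exploit.\<close>

lemma solution_bound:
  assumes "\<epsilon> \<in> {0..1}" "0 \<le> \<sigma>" "solution K f \<epsilon> \<sigma> p" and F: "0 \<le> F" "\<And>v. v \<in> V \<Longrightarrow> f v \<le> F * enorm v"
  shows "N \<epsilon> \<sigma> p \<le> F / \<beta>"
proof -
  have "\<beta> * N \<epsilon> \<sigma> p \<le> F"
  proof (rule inf_sup)
    fix q assume q: "q \<in> V \<times> K"
    have "C \<epsilon> \<sigma> p q = f (fst q)" using assms(3) q unfolding solution_def by blast
    also have "\<dots> \<le> F * enorm (fst q)" using F(2) q by auto
    also have "\<dots> \<le> F * N \<epsilon> \<sigma> q"
      using mixed_norm_bounds(1)[of "fst q" "snd q"] q assms K_subset F(1) by (intro mult_left_mono) auto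
    finally show "C \<epsilon> \<sigma> p q \<le> F * N \<epsilon> \<sigma> q" .
  qed (use assms in \<open>auto simp: solution_def\<close>)
  then show ?thesis using beta_pos by (simp add: field_simps)
qed

text \<open>Everything is measured at sigma = 0, so the norm does not change along the limit in
  sigma. The left side of \<open>le\<close> is the residual of \<open>p\<close> in the problem
  solved by \<open>p'\<close>.\<close>

lemma perturbation_bound:
  assumes eps: "\<epsilon> \<in> {0..1}" and p: "p \<in> V \<times> K" "p' \<in> V \<times> K" and M: "0 \<le> M"
    and le: "\<And>q. q \<in> V \<times> K \<Longrightarrow> C \<epsilon> 0 p q - C \<epsilon> 0 p' q \<le> M * N \<epsilon> 0 q"
  shows "\<beta> * N \<epsilon> 0 (p - p') \<le> M"
proof (rule inf_sup[OF eps order_refl _ M])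
  have sub: "subspace (V \<times> V)" "subspace (V \<times> K)"
    using subspace_V subspace_K by (auto intro: subspace_Times)
  show "p - p' \<in> V \<times> K" using sub p by (blast intro: subspace_diff)
  show "C \<epsilon> 0 (p - p') q \<le> M * N \<epsilon> 0 q" if "q \<in> V \<times> K" for q
    using bilinear_on_diff(1)[OF bilinear_C sub(1), of p p' q \<epsilon> 0] le[OF that] p that VK_subset
    by (metis subsetD)
qed

text \<open>The L2 part of the norm has weight sigma and is lost in the limit. What survives
  uniformly is \<open>star (snd p) \<le> F / \<beta>\<close>, and \<open>bilinear_le_star\<close>
  bounds the L2 product by it.\<close>

lemma sigma_perturbation:
  assumes eps: "\<epsilon> \<in> {0..1}" and F: "0 \<le> F" "\<And>v. v \<in> V \<Longrightarrow> f v \<le> F * enorm v"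
  shows "\<exists>k. \<forall>\<sigma> p p0. 0 \<le> \<sigma> \<longrightarrow> solution K f \<epsilon> \<sigma> p \<longrightarrow> solution K f \<epsilon> 0 p0 \<longrightarrow> N \<epsilon> 0 (p - p0) \<le> k * \<sigma>"
proof -
  obtain k where k: "0 \<le> k" "\<And>w z. w \<in> K \<Longrightarrow> z \<in> K \<Longrightarrow> \<bar>l w z\<bar> \<le> k * star w * star z"
    using bilinear_le_star[OF bilin(3)] by blast
  have "N \<epsilon> 0 (p - p0) \<le> (k * (F / \<beta>) / \<beta>) * \<sigma>"
    if \<sigma>: "0 \<le> \<sigma>" and p: "solution K f \<epsilon> \<sigma> p" "solution K f \<epsilon> 0 p0" for \<sigma> p p0
  proof -
    have pV: "p \<in> V \<times> K" "p0 \<in> V \<times> K" using p by (auto simp: solution_def)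
    have "N \<epsilon> \<sigma> p \<le> F / \<beta>" by (rule solution_bound[OF eps \<sigma> p(1) F])
    then have st: "star (snd p) \<le> F / \<beta>" "0 \<le> star (snd p)"
      using mixed_norm_bounds(2)[of "fst p" "snd p" \<epsilon> \<sigma>] star_nonneg[of "snd p"] pV eps \<sigma> K_subset by auto
    have "\<beta> * N \<epsilon> 0 (p - p0) \<le> \<sigma> * (k * (F / \<beta>))"
    proof (rule perturbation_bound[OF eps pV])
      fix q assume q: "q \<in> V \<times> K"
      have "C \<epsilon> 0 p q - C \<epsilon> 0 p0 q = \<sigma> * l (snd p) (snd q)"
      proof -
        \<comment> \<open>Both sides equal \<open>f (fst q)\<close>, so only the stabilisation term
          is left in the residual.\<close>
        have "C \<epsilon> \<sigma> p q = C \<epsilon> 0 p0 q" using p q unfolding solution_def by metis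
        moreover have "C \<epsilon> 0 p q = C \<epsilon> \<sigma> p q + \<sigma> * l (snd p) (snd q)"
          by (simp add: mixed_form_def split_beta)
        ultimately show ?thesis by simp
      qed
      also have "\<dots> \<le> \<sigma> * (k * star (snd p) * star (snd q))"
        using k(2)[of "snd p" "snd q"] pV q \<sigma> by (intro mult_left_mono) auto
      also have "\<dots> \<le> \<sigma> * (k * (F / \<beta>) * N \<epsilon> 0 q)"
        using mixed_norm_bounds(2)[of "fst q" "snd q" \<epsilon> 0] st k(1) \<sigma> q K_subset eps star_nonneg[of "snd q"] F(1) beta_pos
        by (intro mult_left_mono mult_mono) auto
      finally show "C \<epsilon> 0 p q - C \<epsilon> 0 p0 q \<le> \<sigma> * (k * (F / \<beta>)) * N \<epsilon> 0 q" by (simp add: mult_ac)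
    qed (use \<sigma> k F(1) beta_pos in auto)
    then show ?thesis using beta_pos by (simp add: field_simps)
  qed
  then show ?thesis by blast
qed

lemma epsilon_perturbation:
  assumes F: "0 \<le> F" "\<And>v. v \<in> V \<Longrightarrow> f v \<le> F * enorm v"
  shows "\<exists>k. \<forall>\<epsilon>\<in>{0..1}. \<forall>p p0. solution K f \<epsilon> 0 p \<longrightarrow> solution K f 0 0 p0 \<longrightarrow> N 0 0 (p - p0) \<le> k * \<epsilon>"
proof -
  obtain k where k: "0 \<le> k" "\<And>w z. w \<in> K \<Longrightarrow> z \<in> K \<Longrightarrow> \<bar>s w z\<bar> \<le> k * star w * star z"
    using bilinear_le_star[OF bilin(2)] by blast
  have "N 0 0 (p - p0) \<le> ((F / \<beta>) * (1 + k) / \<beta>) * \<epsilon>"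
    if eps: "\<epsilon> \<in> {0..1}" and p: "solution K f \<epsilon> 0 p" "solution K f 0 0 p0" for \<epsilon> p p0
  proof -
    have pV: "p \<in> V \<times> K" "p0 \<in> V \<times> K" using p by (auto simp: solution_def)
    have "N \<epsilon> 0 p \<le> F / \<beta>" by (rule solution_bound[OF eps order_refl p(1) F])
    then have st: "star (snd p) \<le> F / \<beta>" "0 \<le> star (snd p)"
      using mixed_norm_bounds(2)[of "fst p" "snd p" \<epsilon> 0] star_nonneg[of "snd p"] pV eps K_subset by auto
    have "\<beta> * N 0 0 (p - p0) \<le> \<epsilon> * ((F / \<beta>) * (1 + k))"
    proof (rule perturbation_bound[OF _ pV])
      fix q assume q: "q \<in> V \<times> K"
      note nb = mixed_norm_bounds[of "fst q" "snd q" 0 0]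
      \<comment> \<open>Two terms, since epsilon occurs in both equations: through
        \<open>1 - \<epsilon>\<close> in the first and as a factor in the second.\<close>
      have "C 0 0 p q - C 0 0 p0 q = \<epsilon> * (s (snd p) (fst q) + s (snd p) (snd q))"
      proof -
        have "C \<epsilon> 0 p q = C 0 0 p0 q" using p q unfolding solution_def by metis
        moreover have "C 0 0 p q = C \<epsilon> 0 p q + \<epsilon> * (s (snd p) (fst q) + s (snd p) (snd q))"
          by (simp add: mixed_form_def split_beta algebra_simps)
        ultimately show ?thesis by simp
      qed
      \<comment> \<open>The first term is bounded by duality. In the second, \<open>snd q\<close> is
        controlled only through its dual seminorm at epsilon = 0, so the finite-dimensional bound
        with \<open>k\<close> is used.\<close>
      also have "\<dots> \<le> \<epsilon> * (star (snd p) * enorm (fst q) + k * star (snd p) * star (snd q))"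
        using k(2)[of "snd p" "snd q"] s_le_star[of "snd p" "fst q"] pV q eps K_subset
        by (intro mult_left_mono add_mono) auto
      also have "\<dots> \<le> \<epsilon> * ((F / \<beta>) * N 0 0 q + k * (F / \<beta>) * N 0 0 q)"
        using nb st k(1) q K_subset eps star_nonneg[of "snd q"] a_nonneg[of "fst q"] F(1) beta_pos
        by (intro mult_left_mono add_mono mult_mono) auto
      finally show "C 0 0 p q - C 0 0 p0 q \<le> \<epsilon> * ((F / \<beta>) * (1 + k)) * N 0 0 q"
        by (simp add: algebra_simps add_divide_distrib)
    qed (use eps k F(1) beta_pos in auto)
    then show ?thesis using beta_pos by (simp add: field_simps)
  qed
  then show ?thesis by blast
qed

text \<open>The mixed norm contains no energy norm of the second component. Applying
  \<open>bilinear_le_star\<close> to \<open>a\<close> on the diagonal turns smallness of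
  \<open>star\<close> into convergence in the energy norm.\<close>

lemma enorm_le_star: "\<exists>k\<ge>0. \<forall>w\<in>K. enorm w \<le> k * star w"
proof -
  obtain k where k: "0 \<le> k" "\<And>w z. w \<in> K \<Longrightarrow> z \<in> K \<Longrightarrow> \<bar>a w z\<bar> \<le> k * star w * star z"
    using bilinear_le_star[OF bilin(1)] by blast
  have "enorm w \<le> sqrt k * star w" if w: "w \<in> K" for w
  proof -
    have "enorm w \<le> sqrt (k * (star w)\<^sup>2)"
      using k(2)[OF w w] by (auto simp: power2_eq_square mult.assoc)
    then show ?thesis using star_nonneg w K_subset by (auto simp: real_sqrt_mult)
  qed
  then show ?thesis using k(1) by (intro exI[of _ "sqrt k"]) auto
qed

lemma tendsto_of_mixed_norm:
  assumes p: "\<forall>\<^sub>F t in G. (u t - u0, \<xi> t - \<xi>0) \<in> V \<times> K \<and> N \<epsilon> 0 (u t - u0, \<xi> t - \<xi>0) \<le> k * r t"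
    and eps: "0 \<le> \<epsilon>" and r: "(r \<longlongrightarrow> 0) G"
  shows "((\<lambda>t. enorm (u t - u0)) \<longlongrightarrow> 0) G" "((\<lambda>t. enorm (\<xi> t - \<xi>0)) \<longlongrightarrow> 0) G"
proof -
  obtain c where c: "0 \<le> c" "\<And>w. w \<in> K \<Longrightarrow> enorm w \<le> c * star w" using enorm_le_star by blast
  have lim: "((\<lambda>t. k * r t) \<longlongrightarrow> 0) G" "((\<lambda>t. c * (k * r t)) \<longlongrightarrow> 0) G"
    using r by (auto intro: tendsto_mult_right_zero)
  have "\<forall>\<^sub>F t in G. norm (enorm (u t - u0)) \<le> k * r t"
    using p by eventually_elim (use mixed_norm_bounds(1)[OF _ _ eps order_refl] a_nonneg K_subset in force)
  then show "((\<lambda>t. enorm (u t - u0)) \<longlongrightarrow> 0) G" using lim(1) by (rule Lim_null_comparison)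
  have "\<forall>\<^sub>F t in G. norm (enorm (\<xi> t - \<xi>0)) \<le> c * (k * r t)"
    using p
  proof eventually_elim
    case (elim t)
    then have *: "\<xi> t - \<xi>0 \<in> K" "u t - u0 \<in> V" "\<xi> t - \<xi>0 \<in> V" using K_subset by auto
    have "enorm (\<xi> t - \<xi>0) \<le> c * star (\<xi> t - \<xi>0)" using c(2) * by blast
    also have "\<dots> \<le> c * (k * r t)"
      using mixed_norm_bounds(2)[OF *(2,3) eps order_refl] elim c(1) by (intro mult_left_mono) auto
    finally show ?case using a_nonneg[OF *(3)] by simp
  qed
  then show "((\<lambda>t. enorm (\<xi> t - \<xi>0)) \<longlongrightarrow> 0) G" using lim(2) by (rule Lim_null_comparison)
qed

lemma solution_iff:
  assumes f: "functional_on V f" and W: "0 \<in> W" "W \<subseteq> V"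
  shows "solution W f \<epsilon> \<sigma> (u, \<xi>) \<longleftrightarrow> u \<in> V \<and> \<xi> \<in> W \<and>
    (\<forall>v\<in>V. a u v + (1 - \<epsilon>) * s \<xi> v = f v) \<and> (\<forall>w\<in>W. s u w - \<epsilon> * s \<xi> w - \<sigma> * l \<xi> w = 0)"
    (is "_ \<longleftrightarrow> ?r")
proof
  assume sol: "solution W f \<epsilon> \<sigma> (u, \<xi>)"
  then have mem: "u \<in> V" "\<xi> \<in> W" "\<xi> \<in> V" using W by (auto simp: solution_def)
  have eq: "C \<epsilon> \<sigma> (u, \<xi>) (v, w) = f v" if "v \<in> V" "w \<in> W" for v w
    using sol that unfolding solution_def by force
  have "a u v + (1 - \<epsilon>) * s \<xi> v = f v" if "v \<in> V" for v
    using eq[OF that W(1)] mem by (simp add: mixed_form_def zero_right)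
  moreover have "s u w - \<epsilon> * s \<xi> w - \<sigma> * l \<xi> w = 0" if "w \<in> W" for w
    using eq[OF zero_V that] mem functional_on_zero[OF f zero_V] by (simp add: mixed_form_def zero_right)
  ultimately show ?r using mem by blast
next
  assume ?r
  then show "solution W f \<epsilon> \<sigma> (u, \<xi>)"
    unfolding solution_def mixed_form_def by (force simp: algebra_simps)
qed

text \<open>Columns belong to trial functions and rows to test functions. A kernel vector therefore
  lists the coordinates of a pair on which the form vanishes against every basis pair, hence against
  all of \<open>V \<times> V\<close>. Entries are affine in epsilon, which gives continuity.\<close>

lemma stabilized_matrix_bound:
  fixes \<phi> :: "'n::finite \<Rightarrow> 'v"
  defines "e \<equiv> case_sum (\<lambda>i. (\<phi> i, 0)) (\<lambda>i. (0, \<phi> i))"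
  assumes \<phi>: "range \<phi> \<subseteq> V" and basis: "\<And>v. v \<in> V \<Longrightarrow> \<exists>!c. v = (\<Sum>i\<in>UNIV. c i *\<^sub>R \<phi> i)" and \<sigma>: "0 < \<sigma>"
  shows "\<exists>B. \<forall>\<epsilon>\<in>{0..1}. invertible (\<chi> I J. C \<epsilon> \<sigma> (e J) (e I)) \<and> cond2 (\<chi> I J. C \<epsilon> \<sigma> (e J) (e I)) \<le> B"
proof (rule cond2_bounded)
  show "continuous_on {0..1} (\<lambda>\<epsilon>. \<chi> I J. C \<epsilon> \<sigma> (e J) (e I))"
    unfolding mixed_form_def split_beta by (intro continuous_on_vec_lambda continuous_intros)
next
  fix \<epsilon> :: real and x :: "real^('n + 'n)"
  assume eps: "\<epsilon> \<in> {0..1}" and ker: "(\<chi> I J. C \<epsilon> \<sigma> (e J) (e I)) *v x = 0"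
  have sub: "subspace (V \<times> V)" using subspace_V by (intro subspace_Times)
  have e: "e I \<in> V \<times> V" for I using \<phi> zero_V by (cases I) (auto simp: e_def)
  have split: "(\<Sum>I\<in>UNIV. y I *\<^sub>R e I) = ((\<Sum>i\<in>UNIV. y (Inl i) *\<^sub>R \<phi> i), (\<Sum>i\<in>UNIV. y (Inr i) *\<^sub>R \<phi> i))" for y
    unfolding UNIV_Plus_UNIV[symmetric] sum.Plus[OF finite finite]
    by (simp add: e_def sum_prod prod_eq_iff fst_sum snd_sum)
  define p where "p = (\<Sum>J\<in>UNIV. x $ J *\<^sub>R e J)"
  have p: "p \<in> V \<times> V" unfolding p_def using e sub by (auto intro!: subspace_sum subspace_scale)
  have test: "C \<epsilon> \<sigma> p (e I) = 0" for I
  proof -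
    have "C \<epsilon> \<sigma> p (e I) = (\<Sum>J\<in>UNIV. x $ J * C \<epsilon> \<sigma> (e J) (e I))"
      unfolding p_def by (rule functional_on_sum[OF bilinear_on_left[OF bilinear_C e] sub e])
    also have "\<dots> = ((\<chi> I J. C \<epsilon> \<sigma> (e J) (e I)) *v x) $ I"
      by (simp add: matrix_vector_mult_def mult.commute)
    finally show ?thesis using ker by simp
  qed
  have "C \<epsilon> \<sigma> p q = 0" if q: "q \<in> V \<times> V" for q
  proof -
    obtain c d where "fst q = (\<Sum>i\<in>UNIV. c i *\<^sub>R \<phi> i)" "snd q = (\<Sum>i\<in>UNIV. d i *\<^sub>R \<phi> i)"
      using basis[of "fst q"] basis[of "snd q"] q by (auto simp: mem_Times_iff)
    then have "q = (\<Sum>I\<in>UNIV. case_sum c d I *\<^sub>R e I)" by (simp add: split prod_eq_iff)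
    then have "C \<epsilon> \<sigma> p q = (\<Sum>I\<in>UNIV. case_sum c d I * C \<epsilon> \<sigma> p (e I))"
      using functional_on_sum[OF bilinear_on_right[OF bilinear_C p] sub e] by simp
    then show ?thesis by (simp add: test)
  qed
  then have "p = 0" using C_nondegenerate_V[OF eps \<sigma> p] by blast
  then have zero: "(\<Sum>i\<in>UNIV. x $ Inl i *\<^sub>R \<phi> i) = 0" "(\<Sum>i\<in>UNIV. x $ Inr i *\<^sub>R \<phi> i) = 0"
    unfolding p_def split[of "($) x"] by (simp_all add: zero_prod_def)
  \<comment> \<open>Uniqueness of the coefficients of the zero vector is linear independence of the
    basis.\<close>
  have unique: "c i = 0" if c: "(\<Sum>i\<in>UNIV. c i *\<^sub>R \<phi> i) = 0" for c i
  proof -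
    have "c = (\<lambda>_. 0)"
      using the1_equality[OF basis[OF zero_V], of c] the1_equality[OF basis[OF zero_V], of "\<lambda>_. 0"] c by simp
    then show ?thesis by simp
  qed
  have "x $ I = 0" for I
    using unique[OF zero(1)] unique[OF zero(2)] by (cases I) auto
  then show "x = 0" by (simp add: vec_eq_iff)
qed simp

end

text \<open>Translates the quotient form into the two locale assumptions. If \<open>N p = 0\<close>,
  all quotients for \<open>p\<close> are 0 and their supremum cannot reach beta. Positivity, once
  known for every nonzero element, also allows clearing the denominator \<open>N q\<close>.\<close>

lemma inf_sup_ereal:
  fixes C :: "'p \<Rightarrow> 'p \<Rightarrow> real"
  assumes le: "ereal \<beta> \<le> (INF p\<in>X - {z}. SUP q\<in>X - {z}. ereal (C p q / (N p * N q)))" and \<beta>: "0 < \<beta>"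
    and N: "\<And>p. p \<in> X \<Longrightarrow> 0 \<le> N p"
  shows inf_sup_ereal_pos: "\<And>p. p \<in> X \<Longrightarrow> p \<noteq> z \<Longrightarrow> 0 < N p"
    and inf_sup_ereal_bound:
      "\<And>p M. p \<in> X \<Longrightarrow> p \<noteq> z \<Longrightarrow> (\<And>q. q \<in> X \<Longrightarrow> C p q \<le> M * N q) \<Longrightarrow> \<beta> * N p \<le> M"
proof -
  have sup: "ereal \<beta> \<le> (SUP q\<in>X - {z}. ereal (C p q / (N p * N q)))" if "p \<in> X" "p \<noteq> z" for p
    using le INF_lower[of p "X - {z}"] that by (blast intro: order_trans)
  show pos: "0 < N p" if p: "p \<in> X" "p \<noteq> z" for p
  proof (rule ccontr)
    assume "\<not> 0 < N p"
    then have "N p = 0" using N[OF p(1)] by simp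
    then have "(SUP q\<in>X - {z}. ereal (C p q / (N p * N q))) \<le> ereal 0"
      by (intro SUP_least) simp
    then have "ereal \<beta> \<le> ereal 0" using sup[OF p] by (rule order_trans[rotated])
    then show False using \<beta> by simp
  qed
  show "\<beta> * N p \<le> M" if p: "p \<in> X" "p \<noteq> z" and M: "\<And>q. q \<in> X \<Longrightarrow> C p q \<le> M * N q" for p M
  proof -
    have "C p q / (N p * N q) \<le> M / N p" if "q \<in> X - {z}" for q
      using M[of q] pos[of q] pos[OF p] that by (simp add: field_simps)
    then have "(SUP q\<in>X - {z}. ereal (C p q / (N p * N q))) \<le> ereal (M / N p)"
      by (intro SUP_least) simp
    then have "ereal \<beta> \<le> ereal (M / N p)" using sup[OF p] by (rule order_trans[rotated])
    then show ?thesis using pos[OF p] by (simp add: field_simps)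
  qed
qed

subsection \<open>Bump functions\<close>

lemma frechet_derivative_eqI: "(f has_derivative f') (at x) \<Longrightarrow> frechet_derivative f (at x) = f'"
  by (rule frechet_derivative_at[symmetric])

lemma Ck_on_Suc_imp: "Ck_on S f (Suc k) \<Longrightarrow> Ck_on S f k"
proof (induction k arbitrary: f)
  case 0
  then show ?case
    by (auto intro!: continuous_at_imp_continuous_on differentiable_imp_continuous_within)
qed auto

lemma Ck_on_const: "Ck_on UNIV (\<lambda>_. c) k"
proof (induction k arbitrary: c)
  case (Suc k)
  have "frechet_derivative (\<lambda>_. c) (at x) = (\<lambda>_. 0)" for x :: 'a
    by (rule frechet_derivative_eqI) simp
  then show ?case using Suc by simp
qed simp

lemma Ck_on_add: "Ck_on UNIV f k \<Longrightarrow> Ck_on UNIV g k \<Longrightarrow> Ck_on UNIV (\<lambda>x. f x + g x) k"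
proof (induction k arbitrary: f g)
  case 0
  then show ?case by (auto intro: continuous_on_add)
next
  case (Suc k)
  have "frechet_derivative (\<lambda>x. f x + g x) (at x) = (\<lambda>v. frechet_derivative f (at x) v + frechet_derivative g (at x) v)" for x
    using Suc.prems by (intro frechet_derivative_eqI has_derivative_add) (auto simp: frechet_derivative_works[symmetric])
  then show ?case using Suc by (auto intro: differentiable_add)
qed

text \<open>The product rule multiplies a derivative by an undifferentiated factor. The recursion in
  \<open>Ck_on\<close> gives order k only to the derivatives, hence \<open>Ck_on_Suc_imp\<close> for
  the factors.\<close>

lemma Ck_on_mult:
  fixes f g :: "'a::real_normed_vector \<Rightarrow> real"
  shows "Ck_on UNIV f k \<Longrightarrow> Ck_on UNIV g k \<Longrightarrow> Ck_on UNIV (\<lambda>x. f x * g x) k"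
proof (induction k arbitrary: f g)
  case 0
  then show ?case by (auto intro: continuous_on_mult)
next
  case (Suc k)
  have eq: "frechet_derivative (\<lambda>x. f x * g x) (at x) = (\<lambda>v. f x * frechet_derivative g (at x) v + frechet_derivative f (at x) v * g x)" for x
    using Suc.prems by (intro frechet_derivative_eqI has_derivative_mult) (auto simp: frechet_derivative_works[symmetric])
  have "Ck_on UNIV f k" "Ck_on UNIV g k" using Suc.prems Ck_on_Suc_imp by blast+
  then show ?case using Suc unfolding Ck_on.simps eq by (auto intro!: differentiable_mult Ck_on_add)
qed

lemma smooth_on_const: "smooth_on UNIV (\<lambda>_. c)"
  and smooth_on_add: "smooth_on UNIV f \<Longrightarrow> smooth_on UNIV g \<Longrightarrow> smooth_on UNIV (\<lambda>x. f x + g x)"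
  by (simp_all add: smooth_on_def Ck_on_const Ck_on_add)

lemma smooth_on_mult:
  fixes f g :: "'a::real_normed_vector \<Rightarrow> real"
  shows "smooth_on UNIV f \<Longrightarrow> smooth_on UNIV g \<Longrightarrow> smooth_on UNIV (\<lambda>x. f x * g x)"
  by (simp add: smooth_on_def Ck_on_mult)

lemma smooth_on_prod:
  fixes f :: "'i \<Rightarrow> 'a::real_normed_vector \<Rightarrow> real"
  shows "(\<And>i. i \<in> I \<Longrightarrow> smooth_on UNIV (f i)) \<Longrightarrow> smooth_on UNIV (\<lambda>x. \<Prod>i\<in>I. f i x)"
  by (induction I rule: infinite_finite_induct) (auto simp: smooth_on_const smooth_on_mult)

lemma smooth_onD:
  assumes "smooth_on UNIV f"
  shows "f differentiable (at x)" "continuous_on UNIV f" "continuous_on UNIV (\<lambda>x. frechet_derivative f (at x) v)"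
proof -
  have "Ck_on UNIV f (Suc 0)" "Ck_on UNIV f 0" using assms unfolding smooth_on_def by blast+
  then show "f differentiable (at x)" "continuous_on UNIV f" "continuous_on UNIV (\<lambda>x. frechet_derivative f (at x) v)"
    by auto
qed

text \<open>The family is closed under differentiation, up to linear combinations.\<close>

definition flat_exp :: "nat \<Rightarrow> real \<Rightarrow> real" where
  "flat_exp m t = (if 0 < t then exp (- inverse t) * inverse t ^ m else 0)"

lemma flat_exp_tendsto_0: "(flat_exp m \<longlongrightarrow> 0) (at_right 0)"
proof -
  have "((\<lambda>t::real. inverse t ^ m / exp (inverse t)) \<longlongrightarrow> 0) (at_right 0)"
    using filterlim_compose[OF tendsto_power_div_exp_0 filterlim_inverse_at_top_right] .
  moreover have "\<forall>\<^sub>F t in at_right 0. inverse t ^ m / exp (inverse t) = flat_exp m t"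
    by (rule eventually_mono[OF eventually_at_right_less]) (simp add: flat_exp_def exp_minus divide_inverse)
  ultimately show ?thesis
    by (rule Lim_transform_eventually)
qed

lemma flat_exp_deriv:
  "(flat_exp m has_real_derivative flat_exp (m + 2) t - real m * flat_exp (m + 1) t) (at t)"
proof -
  consider "t > 0" | "t < 0" | "t = 0" by linarith
  then show ?thesis
  proof cases
    case 1
    have "((\<lambda>t. exp (- inverse t) * inverse t ^ m) has_real_derivative
        exp (- inverse t) * (inverse t)\<^sup>2 * inverse t ^ m +
        exp (- inverse t) * (real m * inverse t ^ (m - 1) * (- ((inverse t)\<^sup>2)))) (at t)"
      using 1 by (auto intro!: derivative_eq_intros simp: power2_eq_square)
    also have "exp (- inverse t) * (inverse t)\<^sup>2 * inverse t ^ m +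
        exp (- inverse t) * (real m * inverse t ^ (m - 1) * (- ((inverse t)\<^sup>2))) =
        flat_exp (m + 2) t - real m * flat_exp (m + 1) t"
      \<comment> \<open>The case split deals with the truncated exponent \<open>m - 1\<close> at
        \<open>m = 0\<close>, where the coefficient \<open>real m\<close> vanishes.\<close>
      using 1 by (cases m) (auto simp: flat_exp_def power2_eq_square algebra_simps)
    finally show ?thesis
      by (rule has_field_derivative_transform_within_open[where S = "{0<..}"]) (use 1 in \<open>auto simp: flat_exp_def\<close>)
  next
    case 2
    have "((\<lambda>_. 0) has_real_derivative 0) (at t)" by simp
    then have "(flat_exp m has_real_derivative 0) (at t)"
      by (rule has_field_derivative_transform_within_open[where S = "{..<0}"]) (use 2 in \<open>auto simp: flat_exp_def\<close>)
    then show ?thesis using 2 by (simp add: flat_exp_def)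
  next
    case 3
    \<comment> \<open>The difference quotient at 0. Dividing by positive \<open>y\<close> raises the
      index by one, so the right limit is that of \<open>flat_exp (m + 1)\<close>; on the left the
      function is zero.\<close>
    have "((\<lambda>y. flat_exp m y / y) \<longlongrightarrow> 0) (at_right 0)"
    proof -
      have "\<forall>\<^sub>F y in at_right 0. flat_exp (m + 1) y = flat_exp m y / y"
        by (rule eventually_mono[OF eventually_at_right_less]) (simp add: flat_exp_def divide_inverse)
      then show ?thesis by (rule Lim_transform_eventually[OF flat_exp_tendsto_0])
    qed
    moreover have "((\<lambda>y. flat_exp m y / y) \<longlongrightarrow> 0) (at_left 0)"
    proof -
      have "\<forall>\<^sub>F y in at_left 0. 0 = flat_exp m y / y"
        by (auto simp: flat_exp_def eventually_at_filter)
      then show ?thesis by (rule Lim_transform_eventually[OF tendsto_const])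
    qed
    ultimately have "((\<lambda>y. flat_exp m y / y) \<longlongrightarrow> 0) (at 0)"
      by (simp add: filterlim_split_at)
    then show ?thesis using 3 by (simp add: has_field_derivative_iff flat_exp_def)
  qed
qed

lemma Ck_on_flat_exp:
  fixes w :: "'a::euclidean_space"
  shows "Ck_on UNIV (\<lambda>x. flat_exp m (w \<bullet> x + c)) k"
proof (induction k arbitrary: m)
  case 0
  have "continuous_on UNIV (flat_exp m)"
    by (intro continuous_at_imp_continuous_on ballI DERIV_isCont) (rule flat_exp_deriv)
  then have "continuous_on UNIV (\<lambda>x. flat_exp m (w \<bullet> x + c))"
    by (rule continuous_on_compose2) (auto intro!: continuous_intros)
  then show ?case by simp
next
  case (Suc k)
  \<comment> \<open>The derivative is written with sums and constant factors only, so that the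
    closure lemmas and the induction hypothesis, for every index \<open>m\<close>, apply to
    it.\<close>
  let ?d = "\<lambda>x v. (w \<bullet> v) * (flat_exp (m + 2) (w \<bullet> x + c) + (- real m) * flat_exp (m + 1) (w \<bullet> x + c))"
  have d: "((\<lambda>x. flat_exp m (w \<bullet> x + c)) has_derivative ?d x) (at x)" for x
  proof -
    have "((\<lambda>x. w \<bullet> x + c) has_derivative (\<lambda>v. w \<bullet> v)) (at x)"
      by (auto intro!: derivative_eq_intros)
    from has_derivative_compose[OF this flat_exp_deriv[THEN has_field_derivative_imp_has_derivative]]
    show ?thesis by (simp add: algebra_simps)
  qed
  have "Ck_on UNIV (\<lambda>x. ?d x v) k" for v
    by (intro Ck_on_mult Ck_on_add Ck_on_const Suc)
  moreover have "frechet_derivative (\<lambda>x. flat_exp m (w \<bullet> x + c)) (at x) = ?d x" for x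
    by (rule frechet_derivative_eqI[OF d])
  ultimately show ?case using d by (auto simp: differentiable_def simp del: mult_minus_left)
qed

lemma smooth_on_flat_exp:
  fixes w :: "'a::euclidean_space" shows "smooth_on UNIV (\<lambda>x. flat_exp m (w \<bullet> x + c))"
  by (simp add: smooth_on_def Ck_on_flat_exp)

lemma flat_exp_0_bounds: "0 \<le> flat_exp 0 t" "flat_exp 0 t \<le> 1" "flat_exp 0 t = 0 \<longleftrightarrow> t \<le> 0"
  by (auto simp: flat_exp_def)

text \<open>A positive argument t is scaled to (n + 1) t, and exp (-1 / ((n + 1) t)) tends to 1. The
  products thus approach the indicator of the open box from within [0, 1], all with support in the
  same closed box.\<close>

definition box_bump :: "'a::euclidean_space \<Rightarrow> 'a \<Rightarrow> nat \<Rightarrow> 'a \<Rightarrow> real" where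
  "box_bump l u n x =
     (\<Prod>i\<in>Basis. flat_exp 0 (real (Suc n) * (x \<bullet> i - l \<bullet> i)) * flat_exp 0 (real (Suc n) * (u \<bullet> i - x \<bullet> i)))"

lemma smooth_on_box_bump: "smooth_on UNIV (box_bump l u n)"
proof -
  have "c * (x \<bullet> i - l \<bullet> i) = (c *\<^sub>R i) \<bullet> x + - (c * (l \<bullet> i))"
    "c * (u \<bullet> i - x \<bullet> i) = (- c *\<^sub>R i) \<bullet> x + c * (u \<bullet> i)" for c x i
    by (simp_all add: inner_commute[of x] right_diff_distrib)
  then show ?thesis
    unfolding box_bump_def by (simp only:) (intro smooth_on_prod smooth_on_mult smooth_on_flat_exp)
qed

lemma box_bump_bounds: "0 \<le> box_bump l u n x" "box_bump l u n x \<le> 1"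
  unfolding box_bump_def using flat_exp_0_bounds
  by (auto intro!: prod_nonneg prod_le_1 mult_le_one)

lemma box_bump_zero: "x \<notin> box l u \<Longrightarrow> box_bump l u n x = 0"
  unfolding box_bump_def by (auto simp: mem_box flat_exp_0_bounds not_less mult_le_0_iff)

lemma test_function_box_bump: "cbox l u \<subseteq> \<Omega> \<Longrightarrow> test_function \<Omega> (box_bump l u n)"
  unfolding test_function_def using box_bump_zero[of _ l u n] box_subset_cbox[of l u]
  by (intro conjI smooth_on_box_bump exI[of _ "cbox l u"]) auto

lemma box_bump_tendsto: "(\<lambda>n. box_bump l u n x) \<longlonglongrightarrow> indicator (box l u) x"
proof (cases "x \<in> box l u")
  case True
  have lim: "(\<lambda>n. flat_exp 0 (real (Suc n) * t)) \<longlonglongrightarrow> 1" if "0 < t" for t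
  proof -
    have "(\<lambda>n. exp (- inverse (real (Suc n)) * inverse t)) \<longlonglongrightarrow> exp (- 0 * inverse t)"
      by (intro tendsto_intros LIMSEQ_inverse_real_of_nat)
    then show ?thesis using that by (simp add: flat_exp_def inverse_mult_distrib)
  qed
  have "(\<lambda>n. box_bump l u n x) \<longlonglongrightarrow> (\<Prod>i\<in>(Basis::'a set). 1 * 1)"
    unfolding box_bump_def using True by (intro tendsto_prod tendsto_mult lim) (auto simp: mem_box)
  then show ?thesis using True by simp
qed (simp add: box_bump_zero)

subsection \<open>Integration by parts\<close>

lemma integrable_continuous_compact_support:
  fixes f :: "'a::euclidean_space \<Rightarrow> real"
  assumes "continuous_on UNIV f" "compact K" "\<And>x. x \<notin> K \<Longrightarrow> f x = 0"
  shows "integrable lborel f"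
proof -
  have "integrable lborel (\<lambda>x. indicator K x *\<^sub>R f x)"
    using assms by (intro borel_integrable_compact) (auto intro: continuous_on_subset)
  moreover have "(\<lambda>x. indicator K x *\<^sub>R f x) = f"
    using assms(3) by (auto simp: indicator_def fun_eq_iff)
  ultimately show ?thesis by simp
qed

lemma lborel_integral_shift:
  fixes f :: "'a::euclidean_space \<Rightarrow> real"
  assumes "f \<in> borel_measurable borel"
  shows "(LINT x|lborel. f (x + c)) = (LINT x|lborel. f x)"
proof -
  have "(LINT x|lborel. f x) = (LINT x|distr lborel borel ((+) c). f x)"
    by (simp add: lborel_distr_plus)
  also have "\<dots> = (LINT x|lborel. f (c + x))"
    using assms by (intro integral_distr) auto
  finally show ?thesis by (simp add: add.commute)
qed

lemma integrable_lborel_shift: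
  fixes f :: "'a::euclidean_space \<Rightarrow> real"
  assumes "integrable lborel f"
  shows "integrable lborel (\<lambda>x. f (x + c))"
proof -
  have "integrable (distr lborel borel ((+) c)) f"
    using assms by (simp add: lborel_distr_plus)
  then have "integrable lborel (\<lambda>x. f (c + x))"
    using assms by (subst (asm) integrable_distr_eq) (auto dest: borel_measurable_integrable)
  then show ?thesis by (simp add: add.commute)
qed

lemma frechet_derivative_zero_outside:
  assumes "closed K" "\<And>x. x \<notin> K \<Longrightarrow> f x = 0" "x \<notin> K"
  shows "frechet_derivative f (at x) v = 0"
proof -
  have "((\<lambda>_. 0) has_derivative (\<lambda>_. 0)) (at x)" by simp
  then have "(f has_derivative (\<lambda>_. 0)) (at x)"
    by (rule has_derivative_transform_within_open[OF _ open_Compl[OF assms(1)]]) (use assms in auto)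
  then show ?thesis by (simp add: frechet_derivative_eqI)
qed

text \<open>The difference quotients of \<open>F\<close> in direction \<open>v\<close> have integral zero by translation
  invariance, and dominated convergence passes to the limit.\<close>

lemma integral_directional_derivative:
  fixes F :: "'a::euclidean_space \<Rightarrow> real"
  assumes F: "smooth_on UNIV F" and K: "compact K" "\<And>x. x \<notin> K \<Longrightarrow> F x = 0"
  shows "(LINT x|lborel. frechet_derivative F (at x) v) = 0"
proof -
  define D where "D x = frechet_derivative F (at x) v" for x
  define t where "t n = inverse (real (Suc n))" for n
  define q where "q n x = (F (x + t n *\<^sub>R v) - F x) / t n" for n x
  have t: "0 < t n" "t n \<le> 1" "t \<longlonglongrightarrow> 0" for n
    unfolding t_def using LIMSEQ_inverse_real_of_nat by (simp_all add: inverse_le_1_iff)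
  have diff: "F differentiable (at x)" for x using smooth_onD(1)[OF F] .
  have cont: "continuous_on UNIV F" "continuous_on UNIV D"
    unfolding D_def using smooth_onD(2,3)[OF F] by auto
  have line: "((\<lambda>r. F (x + r *\<^sub>R v)) has_real_derivative D (x + r *\<^sub>R v)) (at r)" for x r
  proof -
    have "((\<lambda>r. x + r *\<^sub>R v) has_derivative (\<lambda>h. h *\<^sub>R v)) (at r)"
      by (auto intro!: derivative_eq_intros)
    from has_derivative_compose[OF this diff[THEN frechet_derivative_works[THEN iffD1]]]
    have "((\<lambda>r. F (x + r *\<^sub>R v)) has_derivative (\<lambda>h. frechet_derivative F (at (x + r *\<^sub>R v)) (h *\<^sub>R v))) (at r)" .
    then show ?thesis
      by (rule has_derivative_imp_has_field_derivative)
        (simp add: D_def linear_scale[OF linear_frechet_derivative[OF diff]])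
  qed
  obtain B where B: "\<And>x. \<bar>D x\<bar> \<le> B" "0 \<le> B"
  proof -
    have "compact (D ` K)" using compact_continuous_image[OF continuous_on_subset[OF cont(2)] K(1)] by simp
    then obtain B where "\<forall>y\<in>D ` K. \<bar>y\<bar> \<le> B" using compact_imp_bounded bounded_real by metis
    then have "\<bar>D x\<bar> \<le> max B 0" for x
      using frechet_derivative_zero_outside[of K F x v] K(2) compact_imp_closed[OF K(1)]
      by (cases "x \<in> K") (auto simp: D_def)
    then show ?thesis using that[of "max B 0"] by simp
  qed
  obtain R where R: "K \<subseteq> cball 0 R" using compact_imp_bounded[OF K(1)] by (auto simp: bounded_iff subset_iff)
  \<comment> \<open>Dominating function. Steps are at most 1, so outside this larger ball neither
    point of the difference quotient lies in \<open>K\<close>; inside, the mean value theorem gives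
    the bound \<open>B\<close>.\<close>
  let ?w = "\<lambda>x. indicator (cball 0 (R + norm v)) x *\<^sub>R B"
  have bound: "norm (q n x) \<le> ?w x" for n x
  proof (cases "x \<in> cball 0 (R + norm v)")
    case True
    obtain r where "F (x + t n *\<^sub>R v) - F (x + 0 *\<^sub>R v) = (t n - 0) * D (x + r *\<^sub>R v)"
      using MVT2[OF t(1)[of n], where f = "\<lambda>r. F (x + r *\<^sub>R v)" and f' = "\<lambda>r. D (x + r *\<^sub>R v)", OF line]
      by blast
    then have "q n x = D (x + r *\<^sub>R v)" using t(1)[of n] by (simp add: q_def)
    then show ?thesis using B True by simp
  next
    case False
    have "norm (t n *\<^sub>R v) \<le> norm v"
      using t(1,2)[of n] by (simp add: mult_left_le_one_le)
    moreover have "norm y \<le> R" if "y \<in> K" for y using R that by auto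
    moreover have "R + norm v < norm x" using False by simp
    ultimately have "x \<notin> K" "x + t n *\<^sub>R v \<notin> K"
      using norm_diff_ineq[of x "t n *\<^sub>R v"] norm_ge_zero[of v] by (smt (verit))+
    then show ?thesis using K(2) B(2) by (simp add: q_def)
  qed
  have "(\<lambda>n. q n x) \<longlonglongrightarrow> D x" for x
  proof -
    have "((\<lambda>y. (F (x + y *\<^sub>R v) - F (x + 0 *\<^sub>R v)) / (y - 0)) \<longlongrightarrow> D x) (at 0)"
      using line[of x 0] by (simp add: has_field_derivative_iff)
    moreover have "filterlim t (at 0) sequentially"
      using t by (intro filterlim_atI) (auto simp: less_imp_neq[symmetric] eventually_sequentially)
    ultimately show ?thesis
      unfolding q_def using filterlim_compose[where f = t] by fastforce
  qed
  moreover have meas: "F \<in> borel_measurable borel" "D \<in> borel_measurable borel"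
    using cont by (auto intro: borel_measurable_continuous_onI)
  moreover have "integrable lborel ?w"
    by (rule borel_integrable_compact) auto
  ultimately have "(\<lambda>n. LINT x|lborel. q n x) \<longlonglongrightarrow> (LINT x|lborel. D x)"
    using bound by (intro integral_dominated_convergence[where w = ?w]) (auto simp: q_def)
  moreover have "(LINT x|lborel. q n x) = 0" for n
  proof -
    have int: "integrable lborel F" by (rule integrable_continuous_compact_support[OF cont(1) K])
    have "(LINT x|lborel. F (x + t n *\<^sub>R v) - F x) = 0"
      using int integrable_lborel_shift[OF int] lborel_integral_shift[OF meas(1)] by simp
    then show ?thesis unfolding q_def by simp
  qed
  ultimately show ?thesis unfolding D_def using LIMSEQ_unique[OF _ tendsto_const] by auto
qed

subsection \<open>Weak gradients\<close>

lemma continuous_imp_lebesgue_measurable: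
  fixes f :: "'a::euclidean_space \<Rightarrow> 'b::euclidean_space"
  shows "continuous_on UNIV f \<Longrightarrow> f \<in> borel_measurable lebesgue"
  by (rule measurable_completion) (simp add: borel_measurable_continuous_onI)

lemma indicator_mult_lebesgue_measurable:
  fixes h :: "'a::euclidean_space \<Rightarrow> real"
  shows "B \<in> sets borel \<Longrightarrow> h \<in> borel_measurable lebesgue \<Longrightarrow> (\<lambda>x. indicator B x * h x) \<in> borel_measurable lebesgue"
  by (intro borel_measurable_times borel_measurable_indicator) auto

lemma integrable_locally_L1_mult:
  fixes w :: "'a::euclidean_space \<Rightarrow> real"
  assumes \<Omega>: "open \<Omega>" and w: "locally_L1 \<Omega> w" and \<psi>: "continuous_on UNIV \<psi>"
    and K: "compact K" "K \<subseteq> \<Omega>" "\<And>x. x \<notin> K \<Longrightarrow> \<psi> x = 0"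
  shows "integrable (lebesgue_on \<Omega>) (\<lambda>x. w x * \<psi> x)"
proof -
  have int: "integrable lebesgue (\<lambda>x. indicator K x * w x)"
    using w K(1,2) by (simp add: locally_L1_def set_integrable_def)
  obtain B where B: "\<And>x. x \<in> K \<Longrightarrow> \<bar>\<psi> x\<bar> \<le> B"
    using compact_imp_bounded[OF compact_continuous_image[OF continuous_on_subset[OF \<psi> subset_UNIV] K(1)]]
    by (auto simp: bounded_real)
  have "integrable lebesgue (\<lambda>x. (indicator K x * w x) * \<psi> x)"
  proof (rule Bochner_Integration.integrable_bound)
    show "integrable lebesgue (\<lambda>x. B * (indicator K x * w x))" using int by simp
    have "\<psi> \<in> borel_measurable lebesgue"
      using \<psi> by (rule continuous_imp_lebesgue_measurable)
    then show "(\<lambda>x. indicator K x * w x * \<psi> x) \<in> borel_measurable lebesgue"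
      using borel_measurable_integrable[OF int] by (rule borel_measurable_times[rotated])
    show "AE x in lebesgue. norm (indicator K x * w x * \<psi> x) \<le> norm (B * (indicator K x * w x))"
    proof (rule AE_I2)
      fix x
      have "\<bar>w x\<bar> * \<bar>\<psi> x\<bar> \<le> \<bar>B\<bar> * \<bar>w x\<bar>" if "x \<in> K"
        by (subst mult.commute) (use B[OF that] in \<open>auto intro!: mult_right_mono\<close>)
      then show "norm (indicator K x * w x * \<psi> x) \<le> norm (B * (indicator K x * w x))"
        by (auto simp: indicator_def abs_mult)
    qed
  qed
  moreover have "(\<lambda>x. indicator K x * w x * \<psi> x) = (\<lambda>x. indicator \<Omega> x *\<^sub>R (w x * \<psi> x))"
    using K(2,3) by (auto simp: indicator_def fun_eq_iff)
  ultimately show ?thesis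
    using \<Omega> by (simp add: integrable_restrict_space)
qed

lemma locally_L1_add: "locally_L1 \<Omega> u \<Longrightarrow> locally_L1 \<Omega> v \<Longrightarrow> locally_L1 \<Omega> (\<lambda>x. u x + v x)"
  unfolding locally_L1_def by (auto intro: set_integral_add)

lemma locally_L1_scaleR: "locally_L1 \<Omega> u \<Longrightarrow> locally_L1 \<Omega> (\<lambda>x. c *\<^sub>R u x)"
  unfolding locally_L1_def set_integrable_def
  by (auto simp only: scaleR_left_commute[of _ c] intro!: integrable_scaleR_right)

lemma locally_L1_inner: "locally_L1 \<Omega> u \<Longrightarrow> locally_L1 \<Omega> (\<lambda>x. u x \<bullet> v)"
  unfolding locally_L1_def set_integrable_def real_scaleR_def
  by (auto simp only: inner_scaleR_left[symmetric] intro!: integrable_inner_left)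

lemma locally_L1_continuous: "continuous_on UNIV u \<Longrightarrow> locally_L1 \<Omega> u"
  unfolding locally_L1_def set_integrable_def
  by (auto intro!: borel_integrable_compact integrable_completion[THEN iffD2] borel_measurable_integrable
      intro: continuous_on_subset)

text \<open>The bumps of a closed box inside the domain are admissible test functions. They are
  bounded by 1 and converge to the indicator of the open box, so dominated convergence carries the
  vanishing integrals over.\<close>

lemma locally_L1_integral_box:
  fixes g :: "'a::euclidean_space \<Rightarrow> real"
  assumes \<Omega>: "open \<Omega>" and g: "locally_L1 \<Omega> g"
    and zero: "\<And>\<phi>. test_function \<Omega> \<phi> \<Longrightarrow> (LINT x|lebesgue_on \<Omega>. g x * \<phi> x) = 0"
    and sub: "cbox l u \<subseteq> \<Omega>"
  shows "(LINT x|lebesgue. indicator (box l u) x * g x) = 0"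
proof -
  have int: "integrable lebesgue (\<lambda>x. indicator (cbox l u) x * g x)"
    using g sub by (simp add: locally_L1_def set_integrable_def)
  have meas: "box_bump l u n \<in> borel_measurable lebesgue" for n
    using smooth_onD(2)[OF smooth_on_box_bump] by (rule continuous_imp_lebesgue_measurable)
  have "(\<lambda>n. LINT x|lebesgue. box_bump l u n x * (indicator (cbox l u) x * g x)) \<longlonglongrightarrow>
      (LINT x|lebesgue. indicator (box l u) x * (indicator (cbox l u) x * g x))"
  proof (rule integral_dominated_convergence[where w = "\<lambda>x. norm (indicator (cbox l u) x * g x)"])
    show "(\<lambda>x. indicator (box l u) x * (indicator (cbox l u) x * g x)) \<in> borel_measurable lebesgue"
      using borel_measurable_integrable[OF int] by (rule indicator_mult_lebesgue_measurable[rotated]) auto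
    show "(\<lambda>x. box_bump l u n x * (indicator (cbox l u) x * g x)) \<in> borel_measurable lebesgue" for n
      by (rule borel_measurable_times[OF meas borel_measurable_integrable[OF int]])
    show "AE x in lebesgue. (\<lambda>n. box_bump l u n x * (indicator (cbox l u) x * g x)) \<longlonglongrightarrow>
        indicator (box l u) x * (indicator (cbox l u) x * g x)"
      by (intro AE_I2 tendsto_mult box_bump_tendsto tendsto_const)
    show "AE x in lebesgue. norm (box_bump l u n x * (indicator (cbox l u) x * g x)) \<le> norm (indicator (cbox l u) x * g x)" for n
      unfolding norm_mult using box_bump_bounds[of l u n] by (intro AE_I2 mult_left_le_one_le) auto
  qed (use int in simp)
  moreover have "(LINT x|lebesgue. box_bump l u n x * (indicator (cbox l u) x * g x)) = 0" for n
  proof -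
    have "(\<lambda>x. box_bump l u n x * (indicator (cbox l u) x * g x)) = (\<lambda>x. indicator \<Omega> x *\<^sub>R (g x * box_bump l u n x))"
      using sub box_bump_zero[of _ l u n] box_subset_cbox[of l u] by (auto simp: indicator_def fun_eq_iff)
    then show ?thesis
      using zero[OF test_function_box_bump[OF sub], of n] \<Omega> by (simp add: integral_restrict_space)
  qed
  moreover have "(\<lambda>x. indicator (box l u) x * (indicator (cbox l u) x * g x)) = (\<lambda>x. indicator (box l u) x * g x)"
    using box_subset_cbox[of l u] by (auto simp: indicator_def fun_eq_iff)
  ultimately show ?thesis by (simp add: LIMSEQ_const_iff)
qed

text \<open>Dynkin argument: open boxes are stable under intersection and generate the Borel sets,
  so the integral vanishes over every Borel set. The whole space is not itself a box;
  \<open>total\<close> is what the complement step uses.\<close>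

lemma integrable_zero_if_box_integrals_zero:
  fixes h :: "'a::euclidean_space \<Rightarrow> real"
  assumes h: "integrable lborel h" and box: "\<And>l u. (LINT x|lborel. indicator (box l u) x * h x) = 0"
    and total: "(LINT x|lborel. h x) = 0"
  shows "AE x in lborel. h x = 0"
proof (rule sigma_finite_measure.density_zero[OF sigma_finite_lborel h])
  fix A :: "'a set" assume "A \<in> sets lborel"
  then have A: "A \<in> sigma_sets UNIV (range (\<lambda>(a, b). box a b))"
    by (simp add: borel_eq_box)
  have sets: "B \<in> sets lborel" if "B \<in> sigma_sets UNIV (range (\<lambda>(a, b). box a b))" for B :: "'a set"
    using that by (simp add: borel_eq_box)
  have int: "set_integrable lborel B h" if "B \<in> sets lborel" for B
    using h that unfolding set_integrable_def by (rule integrable_mult_indicator[rotated])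
  have "Int_stable (range (\<lambda>(a, b). box a b :: 'a set))"
    by (auto simp: Int_stable_def box_Int_box)
  moreover have "range (\<lambda>(a, b). box a b :: 'a set) \<subseteq> Pow UNIV" by simp
  ultimately show "set_lebesgue_integral lborel A h = 0"
    using A
  proof (induction A rule: sigma_sets_induct_disjoint)
    case (basic A)
    then show ?case using box by (auto simp: set_lebesgue_integral_def)
  next
    case (compl A)
    have "set_lebesgue_integral lborel (A \<union> (UNIV - A)) h =
        set_lebesgue_integral lborel A h + set_lebesgue_integral lborel (UNIV - A) h"
      using sets[OF compl(1)] by (intro set_integral_Un int) auto
    then show ?case using compl total by (simp add: set_lebesgue_integral_def)
  next
    case (union A)
    have "set_lebesgue_integral lborel (\<Union>i. A i) h = (\<Sum>i. set_lebesgue_integral lborel (A i) h)"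
      using union sets
      by (intro lebesgue_integral_countable_add int) (auto simp: disjoint_family_on_def subset_iff)
    then show ?case using union by simp
  qed (auto simp: set_lebesgue_integral_def)
qed

text \<open>\<open>g\<close> need not be integrable over the whole domain. Cut off to one closed box
  it is, and every box meets that box, up to a null set, in a smaller box inside the domain.
  Countably many closed boxes then exhaust the domain.\<close>

lemma locally_L1_AE_zero:
  fixes g :: "'a::euclidean_space \<Rightarrow> real"
  assumes \<Omega>: "open \<Omega>" and g: "locally_L1 \<Omega> g"
    and zero: "\<And>\<phi>. test_function \<Omega> \<phi> \<Longrightarrow> (LINT x|lebesgue_on \<Omega>. g x * \<phi> x) = 0"
  shows "AE x in lebesgue_on \<Omega>. g x = 0"
proof -
  have loc: "AE x in lebesgue. x \<in> cbox c d \<longrightarrow> g x = 0" if sub: "cbox c d \<subseteq> \<Omega>" for c d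
  proof -
    \<comment> \<open>The faces of the box are null, so closed and open boxes are interchangeable
      under integrals.\<close>
    have boundary: "AE x in lebesgue. x \<notin> cbox c d - box c d"
      using negligible_frontier_interval[of c d] unfolding negligible_iff_null_sets by (rule AE_not_in)
    define h where "h x = indicator (cbox c d) x * g x" for x
    have int: "integrable lebesgue h"
      unfolding h_def using g sub by (simp add: locally_L1_def set_integrable_def)
    \<comment> \<open>A Borel representative, because the Dynkin argument runs on
      \<open>lborel\<close> and \<open>h\<close> is only Lebesgue measurable.\<close>
    obtain h' where h': "h' \<in> borel_measurable lborel" "AE x in lborel. h x = h' x"
      using completion_ex_borel_measurable_real[OF borel_measurable_integrable[OF int]] by blast
    have ae: "AE x in lebesgue. h x = h' x" using h'(2) by (rule AE_completion)
    have mh': "h' \<in> borel_measurable lebesgue" using h'(1) by (rule measurable_completion)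
    have "integrable lebesgue h'"
      using int ae mh' borel_measurable_integrable[OF int] by (subst integrable_cong_AE[symmetric]) auto
    then have int': "integrable lborel h'" using h'(1) by (simp add: integrable_completion)
    have eq: "(LINT x|lborel. indicator B x * h' x) = (LINT x|lebesgue. indicator B x * h x)" if "B \<in> sets borel" for B
    proof -
      have "(LINT x|lborel. indicator B x * h' x) = (LINT x|lebesgue. indicator B x * h' x)"
        using h'(1) that by (intro integral_completion[symmetric] borel_measurable_times) auto
      also have "\<dots> = (LINT x|lebesgue. indicator B x * h x)"
        using mh' borel_measurable_integrable[OF int] that ae
        by (intro integral_cong_AE indicator_mult_lebesgue_measurable) auto
      finally show ?thesis .
    qed
    have "AE x in lborel. h' x = 0"
    proof (rule integrable_zero_if_box_integrals_zero[OF int'])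
      have *: "(LINT x|lebesgue. indicator (box l u) x * h x) = 0" for l u
      proof -
        obtain l' u' where b: "box l u \<inter> box c d = box l' u'" by (auto simp: box_Int_box)
        have "(LINT x|lebesgue. indicator (box l u) x * h x) = (LINT x|lebesgue. indicator (box l' u') x * g x)"
        proof (rule integral_cong_AE)
          have m: "(\<lambda>x. indicator (box l u) x * h x) \<in> borel_measurable lebesgue"
            using borel_measurable_integrable[OF int] by (rule indicator_mult_lebesgue_measurable[rotated]) auto
          then show "(\<lambda>x. indicator (box l u) x * h x) \<in> borel_measurable lebesgue" .
          from boundary show ae: "AE x in lebesgue. indicator (box l u) x * h x = indicator (box l' u') x * g x"
          proof eventually_elim
            case (elim x)
            then show ?case using b[symmetric] box_subset_cbox[of c d] by (auto simp: h_def indicator_def)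
          qed
          show "(\<lambda>x. indicator (box l' u') x * g x) \<in> borel_measurable lebesgue"
            by (rule borel_measurable_AE[OF m ae])
        qed
        also have "\<dots> = 0"
        \<comment> \<open>For an empty open box, \<open>cbox l' u'\<close> may still be a degenerate
          nonempty box outside \<open>cbox c d\<close>. Only in the nonempty case is it the closure
          of the open box, hence contained.\<close>
        proof (cases "box l' u' = {}")
          case False
          then have "cbox l' u' \<subseteq> cbox c d"
            using b by (metis Int_lower2 closure_box closure_mono box_subset_cbox closed_cbox closure_minimal order_trans)
          then show ?thesis using sub by (intro locally_L1_integral_box[OF \<Omega> g zero]) auto
        qed simp
        finally show ?thesis .
      qed
      show "(LINT x|lborel. indicator (box l u) x * h' x) = 0" for l u
        using eq[of "box l u"] * by simp
      have "(LINT x|lborel. h' x) = (LINT x|lebesgue. h x)" using eq[of UNIV] by simp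
      also have "\<dots> = (LINT x|lebesgue. indicator (box c d) x * h x)"
      proof (rule integral_cong_AE)
        from boundary show "AE x in lebesgue. h x = indicator (box c d) x * h x"
          by eventually_elim (auto simp: h_def indicator_def)
      qed (use borel_measurable_integrable[OF int] in \<open>auto intro!: indicator_mult_lebesgue_measurable\<close>)
      finally show "(LINT x|lborel. h' x) = 0" using * by simp
    qed
    then have "AE x in lebesgue. h' x = 0" by (rule AE_completion)
    with ae show ?thesis by eventually_elim (auto simp: h_def)
  qed
  obtain \<D> where \<D>: "countable \<D>" "\<D> \<subseteq> Pow \<Omega>" "\<And>X. X \<in> \<D> \<Longrightarrow> \<exists>a b. X = cbox a b" "\<Union>\<D> = \<Omega>"
    using open_countable_Union_open_cbox[OF \<Omega>] by blast
  have "AE x in lebesgue. \<forall>X\<in>\<D>. x \<in> X \<longrightarrow> g x = 0"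
    using \<D>(2,3) loc by (intro AE_ball_countable[OF \<D>(1), THEN iffD2]) blast
  then have "AE x in lebesgue. x \<in> \<Omega> \<longrightarrow> g x = 0"
    by eventually_elim (use \<D>(4) in blast)
  then show ?thesis using \<Omega> by (simp add: AE_restrict_space_iff)
qed

section \<open>Weak gradients: linearity, uniqueness, and the smooth case\<close>

lemma test_functionE:
  assumes "test_function \<Omega> \<phi>"
  obtains K where "smooth_on UNIV \<phi>" "compact K" "K \<subseteq> \<Omega>" "\<And>x. x \<notin> K \<Longrightarrow> \<phi> x = 0"
    "\<And>x v. x \<notin> K \<Longrightarrow> frechet_derivative \<phi> (at x) v = 0"
proof -
  obtain K where K: "smooth_on UNIV \<phi>" "compact K" "K \<subseteq> \<Omega>" "\<And>x. x \<notin> K \<Longrightarrow> \<phi> x = 0"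
    using assms by (auto simp: test_function_def)
  moreover have "frechet_derivative \<phi> (at x) v = 0" if "x \<notin> K" for x v
    using frechet_derivative_zero_outside[of K \<phi> x v] compact_imp_closed[OF K(2)] K(4) that by blast
  ultimately show ?thesis using that by blast
qed

lemma integrable_locally_L1_test:
  fixes w :: "'a::euclidean_space \<Rightarrow> real"
  assumes \<Omega>: "open \<Omega>" and w: "locally_L1 \<Omega> w" and \<phi>: "test_function \<Omega> \<phi>"
  shows "integrable (lebesgue_on \<Omega>) (\<lambda>x. w x * \<phi> x)"
    and "integrable (lebesgue_on \<Omega>) (\<lambda>x. w x * frechet_derivative \<phi> (at x) v)"
proof -
  obtain K where K: "smooth_on UNIV \<phi>" "compact K" "K \<subseteq> \<Omega>" "\<And>x. x \<notin> K \<Longrightarrow> \<phi> x = 0"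
    "\<And>x v. x \<notin> K \<Longrightarrow> frechet_derivative \<phi> (at x) v = 0"
    using test_functionE[OF \<phi>] by blast
  show "integrable (lebesgue_on \<Omega>) (\<lambda>x. w x * \<phi> x)"
    by (rule integrable_locally_L1_mult[OF \<Omega> w smooth_onD(2)[OF K(1)] K(2,3,4)])
  show "integrable (lebesgue_on \<Omega>) (\<lambda>x. w x * frechet_derivative \<phi> (at x) v)"
    by (rule integrable_locally_L1_mult[OF \<Omega> w smooth_onD(3)[OF K(1)] K(2,3,5)])
qed

lemma has_weak_grad_add:
  assumes \<Omega>: "open \<Omega>" and "has_weak_grad \<Omega> u g" "has_weak_grad \<Omega> v k"
  shows "has_weak_grad \<Omega> (\<lambda>x. u x + v x) (\<lambda>x. g x + k x)"
proof -
  have l: "locally_L1 \<Omega> u" "locally_L1 \<Omega> v" "locally_L1 \<Omega> g" "locally_L1 \<Omega> k"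
    using assms by (auto simp: has_weak_grad_def)
  have "(LINT x|lebesgue_on \<Omega>. (u x + v x) * frechet_derivative \<phi> (at x) w) =
      - (LINT x|lebesgue_on \<Omega>. ((g x + k x) \<bullet> w) * \<phi> x)" if "test_function \<Omega> \<phi>" for \<phi> w
    using integrable_locally_L1_test[OF \<Omega> l(1) that] integrable_locally_L1_test[OF \<Omega> l(2) that]
      integrable_locally_L1_test(1)[OF \<Omega> locally_L1_inner[OF l(3)] that]
      integrable_locally_L1_test(1)[OF \<Omega> locally_L1_inner[OF l(4)] that] assms(2,3) that
    by (simp add: has_weak_grad_def distrib_right inner_add_left)
  then show ?thesis
    unfolding has_weak_grad_def using l by (auto intro: locally_L1_add)
qed

lemma has_weak_grad_scale:
  assumes "has_weak_grad \<Omega> u g"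
  shows "has_weak_grad \<Omega> (\<lambda>x. c * u x) (\<lambda>x. c *\<^sub>R g x)"
proof -
  have "(LINT x|lebesgue_on \<Omega>. (c * u x) * frechet_derivative \<phi> (at x) w) =
      - (LINT x|lebesgue_on \<Omega>. ((c *\<^sub>R g x) \<bullet> w) * \<phi> x)" if "test_function \<Omega> \<phi>" for \<phi> w
    using assms that by (simp add: has_weak_grad_def mult.assoc)
  then show ?thesis
    using assms locally_L1_scaleR[of \<Omega> u c] locally_L1_scaleR[of \<Omega> g c] by (auto simp: has_weak_grad_def)
qed

text \<open>Each component of the difference integrates to zero against all test functions, so the
  fundamental lemma applies to it. Finitely many exceptional null sets are joined over the basis
  directions.\<close>

lemma has_weak_grad_unique:
  fixes \<Omega> :: "'a::euclidean_space set"
  assumes \<Omega>: "open \<Omega>" and "has_weak_grad \<Omega> u g" "has_weak_grad \<Omega> u k"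
  shows "AE x in lebesgue_on \<Omega>. g x = k x"
proof -
  have l: "locally_L1 \<Omega> g" "locally_L1 \<Omega> (\<lambda>x. (-1) *\<^sub>R k x)"
    using assms(2) locally_L1_scaleR[of \<Omega> k "-1"] assms(3) unfolding has_weak_grad_def by blast+
  have loc: "locally_L1 \<Omega> (\<lambda>x. (g x - k x) \<bullet> w)" for w
    using locally_L1_inner[OF locally_L1_add[OF l]] by simp
  have "AE x in lebesgue_on \<Omega>. (g x - k x) \<bullet> w = 0" for w
  proof (rule locally_L1_AE_zero[OF \<Omega> loc])
    fix \<phi> assume \<phi>: "test_function \<Omega> \<phi>"
    have "locally_L1 \<Omega> k" using assms by (simp add: has_weak_grad_def)
    then have "(LINT x|lebesgue_on \<Omega>. (g x \<bullet> w) * \<phi> x - (k x \<bullet> w) * \<phi> x) =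
        (LINT x|lebesgue_on \<Omega>. (g x \<bullet> w) * \<phi> x) - (LINT x|lebesgue_on \<Omega>. (k x \<bullet> w) * \<phi> x)"
      using integrable_locally_L1_test(1)[OF \<Omega> locally_L1_inner \<phi>] l(1) by (intro Bochner_Integration.integral_diff)
    also have "\<dots> = 0"
    proof -
      have "(LINT x|lebesgue_on \<Omega>. u x * frechet_derivative \<phi> (at x) w) = - (LINT x|lebesgue_on \<Omega>. (g x \<bullet> w) * \<phi> x)"
        "(LINT x|lebesgue_on \<Omega>. u x * frechet_derivative \<phi> (at x) w) = - (LINT x|lebesgue_on \<Omega>. (k x \<bullet> w) * \<phi> x)"
        using assms(2,3) \<phi> unfolding has_weak_grad_def by blast+
      then show ?thesis by simp
    qed
    finally show "(LINT x|lebesgue_on \<Omega>. ((g x - k x) \<bullet> w) * \<phi> x) = 0"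
      by (simp add: inner_diff_left left_diff_distrib)
  qed
  then have "AE x in lebesgue_on \<Omega>. \<forall>w\<in>Basis. (g x - k x) \<bullet> w = 0"
    by (intro AE_finite_allI) auto
  then show ?thesis
    by eventually_elim (metis euclidean_all_zero_iff eq_iff_diff_eq_0)
qed

definition gradient :: "('a::euclidean_space \<Rightarrow> real) \<Rightarrow> 'a \<Rightarrow> 'a" where
  "gradient u x = (\<Sum>i\<in>Basis. frechet_derivative u (at x) i *\<^sub>R i)"

lemma gradient_inner:
  assumes "u differentiable (at x)"
  shows "gradient u x \<bullet> v = frechet_derivative u (at x) v"
proof -
  have "frechet_derivative u (at x) v = frechet_derivative u (at x) (\<Sum>i\<in>Basis. (v \<bullet> i) *\<^sub>R i)"
    by (simp add: euclidean_representation)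
  also have "\<dots> = (\<Sum>i\<in>Basis. (v \<bullet> i) * frechet_derivative u (at x) i)"
    using linear_frechet_derivative[OF assms] by (simp add: linear_sum linear_scale)
  also have "\<dots> = gradient u x \<bullet> v"
    unfolding gradient_def inner_sum_left inner_scaleR_left
    by (intro sum.cong refl) (simp add: inner_commute mult.commute)
  finally show ?thesis ..
qed

lemma continuous_gradient: "smooth_on UNIV u \<Longrightarrow> continuous_on UNIV (gradient u)"
  unfolding gradient_def by (intro continuous_on_sum continuous_on_scaleR smooth_onD(3) continuous_on_const)

text \<open>The product of \<open>u\<close> with a test function is smooth with compact support, so
  its directional derivatives have integral zero. The product rule splits that integral into the two
  sides of the definition.\<close>

lemma has_weak_grad_gradient:
  fixes u :: "'a::euclidean_space \<Rightarrow> real"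
  assumes \<Omega>: "open \<Omega>" and u: "smooth_on UNIV u"
  shows "has_weak_grad \<Omega> u (gradient u)"
proof -
  have loc: "locally_L1 \<Omega> u" "locally_L1 \<Omega> (gradient u)"
    using u by (auto intro: locally_L1_continuous smooth_onD continuous_gradient)
  have "(LINT x|lebesgue_on \<Omega>. u x * frechet_derivative \<phi> (at x) v) =
      - (LINT x|lebesgue_on \<Omega>. (gradient u x \<bullet> v) * \<phi> x)" if \<phi>: "test_function \<Omega> \<phi>" for \<phi> v
  proof -
    obtain K where K: "smooth_on UNIV \<phi>" "compact K" "K \<subseteq> \<Omega>" "\<And>x. x \<notin> K \<Longrightarrow> \<phi> x = 0"
      "\<And>x v. x \<notin> K \<Longrightarrow> frechet_derivative \<phi> (at x) v = 0"
      using test_functionE[OF \<phi>] by blast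
    have F: "smooth_on UNIV (\<lambda>x. u x * \<phi> x)" using u K(1) by (rule smooth_on_mult)
    have d: "frechet_derivative (\<lambda>x. u x * \<phi> x) (at x) v =
        u x * frechet_derivative \<phi> (at x) v + (gradient u x \<bullet> v) * \<phi> x" for x
      using smooth_onD(1)[OF u] smooth_onD(1)[OF K(1)]
      by (subst frechet_derivative_eqI[OF has_derivative_mult])
        (auto simp: frechet_derivative_works[symmetric] gradient_inner)
    have "(LINT x|lborel. frechet_derivative (\<lambda>x. u x * \<phi> x) (at x) v) = 0"
      by (rule integral_directional_derivative[OF F K(2)]) (simp add: K(4))
    moreover have "(LINT x|lborel. frechet_derivative (\<lambda>x. u x * \<phi> x) (at x) v) =
        (LINT x|lebesgue. frechet_derivative (\<lambda>x. u x * \<phi> x) (at x) v)"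
      using smooth_onD(3)[OF F] by (intro integral_completion[symmetric]) (simp add: borel_measurable_continuous_onI)
    moreover have "(\<lambda>x. frechet_derivative (\<lambda>x. u x * \<phi> x) (at x) v) =
        (\<lambda>x. indicator \<Omega> x *\<^sub>R (u x * frechet_derivative \<phi> (at x) v + (gradient u x \<bullet> v) * \<phi> x))"
    proof (rule ext)
      fix x
      have "x \<notin> K" if "x \<notin> \<Omega>" using K(3) that by blast
      then show "frechet_derivative (\<lambda>x. u x * \<phi> x) (at x) v =
          indicator \<Omega> x *\<^sub>R (u x * frechet_derivative \<phi> (at x) v + (gradient u x \<bullet> v) * \<phi> x)"
        unfolding d using K(4)[of x] K(5)[of x v] by (cases "x \<in> \<Omega>") auto
    qed
    ultimately have "(LINT x|lebesgue_on \<Omega>. u x * frechet_derivative \<phi> (at x) v + (gradient u x \<bullet> v) * \<phi> x) = 0"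
      using \<Omega> by (simp add: integral_restrict_space)
    then show ?thesis
      using integrable_locally_L1_test(2)[OF \<Omega> loc(1) \<phi>, of v]
        integrable_locally_L1_test(1)[OF \<Omega> locally_L1_inner[OF loc(2)] \<phi>, of v] by simp
  qed
  then show ?thesis using loc by (simp add: has_weak_grad_def)
qed

section \<open>Square-integrable functions and \<open>H1\<close>\<close>

lemma L2_add:
  assumes "L2 \<Omega> u" "L2 \<Omega> v" shows "L2 \<Omega> (\<lambda>x. u x + v x)"
proof -
  have m: "u \<in> borel_measurable (lebesgue_on \<Omega>)" "v \<in> borel_measurable (lebesgue_on \<Omega>)"
    using assms by (auto simp: L2_def)
  have "integrable (lebesgue_on \<Omega>) (\<lambda>x. (norm (u x + v x))\<^sup>2)"
  proof (rule Bochner_Integration.integrable_bound)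
    show "integrable (lebesgue_on \<Omega>) (\<lambda>x. 2 * (norm (u x))\<^sup>2 + 2 * (norm (v x))\<^sup>2)"
      using assms by (auto simp: L2_def)
    have "(norm (u x + v x))\<^sup>2 \<le> 2 * (norm (u x))\<^sup>2 + 2 * (norm (v x))\<^sup>2" for x
    proof -
      have "(norm (u x + v x))\<^sup>2 \<le> (norm (u x) + norm (v x))\<^sup>2"
        by (intro power_mono norm_triangle_ineq) auto
      also have "\<dots> \<le> 2 * (norm (u x))\<^sup>2 + 2 * (norm (v x))\<^sup>2"
        using sum_squares_bound[of "norm (u x)" "norm (v x)"] by (simp add: power2_sum)
      finally show ?thesis .
    qed
    then show "AE x in lebesgue_on \<Omega>. norm ((norm (u x + v x))\<^sup>2) \<le> norm (2 * (norm (u x))\<^sup>2 + 2 * (norm (v x))\<^sup>2)"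
      by simp
  qed (use m in measurable)
  then show ?thesis using m by (simp add: L2_def borel_measurable_add)
qed

lemma L2_scaleR: "L2 \<Omega> u \<Longrightarrow> L2 \<Omega> (\<lambda>x. c *\<^sub>R u x)"
  by (auto simp: L2_def power_mult_distrib)

lemma L2_continuous:
  fixes u :: "'a::euclidean_space \<Rightarrow> 'b::euclidean_space"
  assumes "bounded \<Omega>" "open \<Omega>" "continuous_on UNIV u" shows "L2 \<Omega> u"
proof -
  have "integrable lborel (\<lambda>x. indicator (closure \<Omega>) x *\<^sub>R (norm (u x))\<^sup>2)"
    using assms by (intro borel_integrable_compact)
      (auto intro!: continuous_intros simp: compact_closure intro: continuous_on_subset)
  then have int: "integrable lebesgue (\<lambda>x. indicator (closure \<Omega>) x *\<^sub>R (norm (u x))\<^sup>2)"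
    by (subst integrable_completion) (auto dest: borel_measurable_integrable)
  have "integrable lebesgue (\<lambda>x. indicator \<Omega> x *\<^sub>R (indicator (closure \<Omega>) x *\<^sub>R (norm (u x))\<^sup>2))"
    by (rule integrable_mult_indicator[OF _ int]) (use assms(2) in simp)
  moreover have "(\<lambda>x. indicator \<Omega> x *\<^sub>R (indicator (closure \<Omega>) x *\<^sub>R (norm (u x))\<^sup>2)) = (\<lambda>x. indicator \<Omega> x *\<^sub>R (norm (u x))\<^sup>2)"
    using closure_subset[of \<Omega>] by (auto simp: indicator_def fun_eq_iff)
  moreover have "u \<in> borel_measurable (lebesgue_on \<Omega>)"
    by (rule measurable_restrict_space1[OF continuous_imp_lebesgue_measurable[OF assms(3)]])
  ultimately show ?thesis
    using assms(2) by (simp add: L2_def integrable_restrict_space)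
qed

text \<open>Completeness of Lebesgue measure. It makes an arbitrarily chosen weak gradient
  measurable once some weak gradient is.\<close>

lemma lebesgue_on_measurable_AE:
  fixes f g :: "'a::euclidean_space \<Rightarrow> 'b::euclidean_space"
  assumes \<Omega>: "open \<Omega>" and f: "f \<in> borel_measurable (lebesgue_on \<Omega>)" and ae: "AE x in lebesgue_on \<Omega>. f x = g x"
  shows "g \<in> borel_measurable (lebesgue_on \<Omega>)"
proof -
  have S: "\<Omega> \<inter> space lebesgue \<in> sets lebesgue" using \<Omega> by simp
  have "AE x in lebesgue. x \<in> \<Omega> \<longrightarrow> f x = g x"
    using ae S by (simp add: AE_restrict_space_iff)
  then have "AE x in lebesgue. indicator \<Omega> x *\<^sub>R f x = indicator \<Omega> x *\<^sub>R g x"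
    by eventually_elim (auto simp: indicator_def)
  with f show ?thesis
    unfolding borel_measurable_restrict_space_iff[OF S] by (rule borel_measurable_AE)
qed

text \<open>The choice in \<open>weak_grad\<close> does not ask for square integrability. By
  uniqueness almost everywhere, the chosen gradient inherits it from the witness in
  \<open>H1\<close>.\<close>

lemma weak_grad_H1:
  assumes \<Omega>: "open \<Omega>" and u: "u \<in> H1 \<Omega>"
  shows "has_weak_grad \<Omega> u (weak_grad \<Omega> u)" "L2 \<Omega> (weak_grad \<Omega> u)"
proof -
  obtain g where g: "has_weak_grad \<Omega> u g" "L2 \<Omega> g" using u by (auto simp: H1_def)
  show w: "has_weak_grad \<Omega> u (weak_grad \<Omega> u)"
    unfolding weak_grad_def using someI[of "has_weak_grad \<Omega> u", OF g(1)] .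
  have ae: "AE x in lebesgue_on \<Omega>. g x = weak_grad \<Omega> u x"
    by (rule has_weak_grad_unique[OF \<Omega> g(1) w])
  have m: "g \<in> borel_measurable (lebesgue_on \<Omega>)" "weak_grad \<Omega> u \<in> borel_measurable (lebesgue_on \<Omega>)"
    using g(2) lebesgue_on_measurable_AE[OF \<Omega> _ ae] by (auto simp: L2_def)
  have "integrable (lebesgue_on \<Omega>) (\<lambda>x. (norm (g x))\<^sup>2) \<longleftrightarrow> integrable (lebesgue_on \<Omega>) (\<lambda>x. (norm (weak_grad \<Omega> u x))\<^sup>2)"
  proof (rule integrable_cong_AE)
    show "AE x in lebesgue_on \<Omega>. (norm (g x))\<^sup>2 = (norm (weak_grad \<Omega> u x))\<^sup>2"
      using ae by eventually_elim simp
  qed (use m in measurable)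
  then show "L2 \<Omega> (weak_grad \<Omega> u)" using g(2) m by (simp add: L2_def)
qed

lemma weak_grad_eqI:
  assumes "open \<Omega>" "has_weak_grad \<Omega> u g"
  shows "AE x in lebesgue_on \<Omega>. weak_grad \<Omega> u x = g x"
proof -
  have "has_weak_grad \<Omega> u (weak_grad \<Omega> u)"
    unfolding weak_grad_def using someI[of "has_weak_grad \<Omega> u", OF assms(2)] .
  then show ?thesis by (rule has_weak_grad_unique[OF assms(1) _ assms(2)])
qed

lemma H1_add: 
  assumes "open \<Omega>" "u \<in> H1 \<Omega>" "v \<in> H1 \<Omega>" shows "(\<lambda>x. u x + v x) \<in> H1 \<Omega>"
  using assms has_weak_grad_add[OF assms(1)] unfolding H1_def by (blast intro: L2_add)

lemma H1_scale: "u \<in> H1 \<Omega> \<Longrightarrow> (\<lambda>x. c * u x) \<in> H1 \<Omega>"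
  using L2_scaleR[of \<Omega> u c] has_weak_grad_scale[of \<Omega> u _ c] L2_scaleR[of \<Omega> _ c]
  unfolding H1_def real_scaleR_def by blast

lemma weak_grad_add:
  assumes "open \<Omega>" "u \<in> H1 \<Omega>" "v \<in> H1 \<Omega>"
  shows "AE x in lebesgue_on \<Omega>. weak_grad \<Omega> (\<lambda>x. u x + v x) x = weak_grad \<Omega> u x + weak_grad \<Omega> v x"
  using assms by (intro weak_grad_eqI has_weak_grad_add weak_grad_H1)

lemma weak_grad_scale:
  assumes "open \<Omega>" "u \<in> H1 \<Omega>"
  shows "AE x in lebesgue_on \<Omega>. weak_grad \<Omega> (\<lambda>x. c * u x) x = c *\<^sub>R weak_grad \<Omega> u x"
  using assms by (intro weak_grad_eqI has_weak_grad_scale weak_grad_H1)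

lemma H1_smooth:
  assumes "open \<Omega>" "bounded \<Omega>" "smooth_on UNIV u" shows "u \<in> H1 \<Omega>"
  using L2_continuous[OF assms(2,1) smooth_onD(2)[OF assms(3)]] has_weak_grad_gradient[OF assms(1,3)]
    L2_continuous[OF assms(2,1) continuous_gradient[OF assms(3)]]
  unfolding H1_def by blast

subsection \<open>Finite element spaces as subspaces of a space of functions\<close>

instantiation "fun" :: (type, real_vector) real_vector
begin

definition scaleR_fun_def: "scaleR c f = (\<lambda>x. c *\<^sub>R f x)"

instance
  by standard (auto simp: scaleR_fun_def fun_eq_iff scaleR_add_right scaleR_add_left)

end

lemma sum_fun_apply: "(\<Sum>i\<in>I. f i) x = (\<Sum>i\<in>I. f i x :: 'b::real_vector)"
  by (induction I rule: infinite_finite_induct) auto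

section \<open>The \<open>H1\<close> norm and traces\<close>

lemma H1_norm_nonneg: "0 \<le> H1_norm \<Omega> u"
  unfolding H1_norm_def by (intro real_sqrt_ge_zero add_nonneg_nonneg Bochner_Integration.integral_nonneg) auto

lemma H1_norm_squared:
  "(H1_norm \<Omega> u)\<^sup>2 = (LINT x|lebesgue_on \<Omega>. (u x)\<^sup>2) + (LINT x|lebesgue_on \<Omega>. (norm (weak_grad \<Omega> u x))\<^sup>2)"
  unfolding H1_norm_def by (intro real_sqrt_pow2 add_nonneg_nonneg Bochner_Integration.integral_nonneg) auto

text \<open>A triangle inequality up to the factor 2, from the pointwise bound for squares. It
  stands in for Minkowski, as only convergence to zero is at stake.\<close>

lemma integral_norm_add_squared_le:
  fixes f g :: "'a \<Rightarrow> 'b::euclidean_space"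
  assumes "integrable M (\<lambda>x. (norm (f x))\<^sup>2)" "integrable M (\<lambda>x. (norm (g x))\<^sup>2)"
    "h \<in> borel_measurable M" "AE x in M. h x = f x + g x"
  shows "(LINT x|M. (norm (h x))\<^sup>2) \<le> 2 * (LINT x|M. (norm (f x))\<^sup>2) + 2 * (LINT x|M. (norm (g x))\<^sup>2)"
proof -
  have le: "AE x in M. (norm (h x))\<^sup>2 \<le> 2 * (norm (f x))\<^sup>2 + 2 * (norm (g x))\<^sup>2"
    using assms(4)
  proof eventually_elim
    case (elim x)
    have "(norm (h x))\<^sup>2 \<le> (norm (f x) + norm (g x))\<^sup>2"
      unfolding elim by (intro power_mono norm_triangle_ineq) auto
    also have "\<dots> \<le> 2 * (norm (f x))\<^sup>2 + 2 * (norm (g x))\<^sup>2"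
      using sum_squares_bound[of "norm (f x)" "norm (g x)"] by (simp add: power2_sum)
    finally show ?case .
  qed
  have int: "integrable M (\<lambda>x. 2 * (norm (f x))\<^sup>2 + 2 * (norm (g x))\<^sup>2)" using assms by simp
  have "(LINT x|M. (norm (h x))\<^sup>2) \<le> (LINT x|M. 2 * (norm (f x))\<^sup>2 + 2 * (norm (g x))\<^sup>2)"
  proof (rule integral_mono_AE[OF _ int le])
    show "integrable M (\<lambda>x. (norm (h x))\<^sup>2)"
      by (rule Bochner_Integration.integrable_bound[OF int])
        (use assms(3) in measurable, use le in eventually_elim, simp)
  qed
  then show ?thesis using assms by simp
qed

lemma H1_norm_add_squared_le:
  assumes \<Omega>: "open \<Omega>" and "u \<in> H1 \<Omega>" "v \<in> H1 \<Omega>"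
  shows "(H1_norm \<Omega> (\<lambda>x. u x + v x))\<^sup>2 \<le> 2 * (H1_norm \<Omega> u)\<^sup>2 + 2 * (H1_norm \<Omega> v)\<^sup>2"
proof -
  let ?M = "lebesgue_on \<Omega>"
  have uv: "(\<lambda>x. u x + v x) \<in> H1 \<Omega>" by (rule H1_add[OF assms])
  have "(LINT x|?M. (norm (u x + v x))\<^sup>2) \<le> 2 * (LINT x|?M. (norm (u x))\<^sup>2) + 2 * (LINT x|?M. (norm (v x))\<^sup>2)"
    using assms uv by (intro integral_norm_add_squared_le) (auto simp: H1_def L2_def)
  moreover have "(LINT x|?M. (norm (weak_grad \<Omega> (\<lambda>x. u x + v x) x))\<^sup>2) \<le>
      2 * (LINT x|?M. (norm (weak_grad \<Omega> u x))\<^sup>2) + 2 * (LINT x|?M. (norm (weak_grad \<Omega> v x))\<^sup>2)"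
    using weak_grad_H1(2)[OF \<Omega>] assms uv
    by (intro integral_norm_add_squared_le weak_grad_add) (auto simp: L2_def)
  ultimately show ?thesis unfolding H1_norm_squared by (simp add: algebra_simps)
qed

lemma H1_norm_scale:
  assumes \<Omega>: "open \<Omega>" and u: "u \<in> H1 \<Omega>"
  shows "H1_norm \<Omega> (\<lambda>x. c * u x) = \<bar>c\<bar> * H1_norm \<Omega> u"
proof -
  have "(LINT x|lebesgue_on \<Omega>. (norm (weak_grad \<Omega> (\<lambda>x. c * u x) x))\<^sup>2) =
      (LINT x|lebesgue_on \<Omega>. c\<^sup>2 * (norm (weak_grad \<Omega> u x))\<^sup>2)"
  proof (rule integral_cong_AE)
    show "AE x in lebesgue_on \<Omega>. (norm (weak_grad \<Omega> (\<lambda>x. c * u x) x))\<^sup>2 = c\<^sup>2 * (norm (weak_grad \<Omega> u x))\<^sup>2"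
      using weak_grad_scale[OF assms, of c] by eventually_elim (simp add: power_mult_distrib)
  qed (use weak_grad_H1(2)[OF \<Omega> u] weak_grad_H1(2)[OF \<Omega> H1_scale[OF u, of c]] in \<open>auto simp: L2_def\<close>)
  then have "(H1_norm \<Omega> (\<lambda>x. c * u x))\<^sup>2 = (\<bar>c\<bar> * H1_norm \<Omega> u)\<^sup>2"
    unfolding power_mult_distrib H1_norm_squared by (simp add: algebra_simps power_mult_distrib)
  then show ?thesis by (rule power2_eq_imp_eq) (simp_all add: H1_norm_nonneg)
qed

text \<open>\<open>measure_of\<close> takes its sigma-algebra from the generating sets alone,
  whatever values the Hausdorff function has.\<close>

lemma sets_surface_measure: "sets surface_measure = sets borel" "space surface_measure = UNIV"
  unfolding surface_measure_def using sets.sigma_sets_eq[of borel] by (simp_all add: sets_measure_of space_measure_of)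

lemma boundary_error_measurable:
  assumes [measurable]: "f \<in> borel_measurable borel" "h \<in> borel_measurable borel"
  shows "(\<lambda>x. ennreal ((f x - h x)\<^sup>2) * indicator (frontier \<Omega>) x) \<in> borel_measurable surface_measure"
proof -
  have [measurable]: "frontier \<Omega> \<in> sets borel" by (simp add: borel_closed)
  show ?thesis
    unfolding measurable_cong_sets[OF sets_surface_measure(1) refl] by measurable
qed

text \<open>Add the approximating sequences. The quasi-triangle inequality holds for members of
  \<open>H1\<close>, so the smooth approximants must be known to lie there; this is where classical
  gradients are used as weak ones.\<close>

lemma has_trace_add:
  assumes \<Omega>: "open \<Omega>" "bounded \<Omega>" and H1: "v \<in> H1 \<Omega>" "w \<in> H1 \<Omega>" and "has_trace \<Omega> v g" "has_trace \<Omega> w k"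
  shows "has_trace \<Omega> (\<lambda>x. v x + w x) (\<lambda>x. g x + k x)"
proof -
  obtain \<phi> \<psi> where
    \<phi>: "\<And>n. smooth_on UNIV (\<phi> n)" "(\<lambda>n. H1_norm \<Omega> (\<lambda>x. \<phi> n x - v x)) \<longlonglongrightarrow> 0"
      "(\<lambda>n. \<integral>\<^sup>+x\<in>frontier \<Omega>. ennreal ((\<phi> n x - g x)\<^sup>2) \<partial>surface_measure) \<longlonglongrightarrow> 0" and
    \<psi>: "\<And>n. smooth_on UNIV (\<psi> n)" "(\<lambda>n. H1_norm \<Omega> (\<lambda>x. \<psi> n x - w x)) \<longlonglongrightarrow> 0"
      "(\<lambda>n. \<integral>\<^sup>+x\<in>frontier \<Omega>. ennreal ((\<psi> n x - k x)\<^sup>2) \<partial>surface_measure) \<longlonglongrightarrow> 0" and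
    gk: "g \<in> borel_measurable borel" "k \<in> borel_measurable borel"
    using assms(5,6) unfolding has_trace_def by blast
  have diff_H1: "(\<lambda>x. \<phi> n x - v x) \<in> H1 \<Omega>" "(\<lambda>x. \<psi> n x - w x) \<in> H1 \<Omega>" for n
    using H1_add[OF \<Omega>(1) H1_smooth[OF \<Omega> \<phi>(1)] H1_scale[OF H1(1), of "-1"]]
      H1_add[OF \<Omega>(1) H1_smooth[OF \<Omega> \<psi>(1)] H1_scale[OF H1(2), of "-1"]] by auto
  have "(\<lambda>n. H1_norm \<Omega> (\<lambda>x. (\<phi> n x + \<psi> n x) - (v x + w x))) \<longlonglongrightarrow> 0"
  proof (rule Lim_null_comparison)
    show "(\<lambda>n. sqrt (2 * (H1_norm \<Omega> (\<lambda>x. \<phi> n x - v x))\<^sup>2 + 2 * (H1_norm \<Omega> (\<lambda>x. \<psi> n x - w x))\<^sup>2)) \<longlonglongrightarrow> 0"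
      using \<phi>(2) \<psi>(2) by (auto intro!: tendsto_eq_intros)
    have "H1_norm \<Omega> (\<lambda>x. (\<phi> n x + \<psi> n x) - (v x + w x)) \<le>
        sqrt (2 * (H1_norm \<Omega> (\<lambda>x. \<phi> n x - v x))\<^sup>2 + 2 * (H1_norm \<Omega> (\<lambda>x. \<psi> n x - w x))\<^sup>2)" for n
      using H1_norm_add_squared_le[OF \<Omega>(1) diff_H1, of n n]
      by (intro real_le_rsqrt) (simp add: algebra_simps)
    then show "\<forall>\<^sub>F n in sequentially. norm (H1_norm \<Omega> (\<lambda>x. (\<phi> n x + \<psi> n x) - (v x + w x))) \<le>
        sqrt (2 * (H1_norm \<Omega> (\<lambda>x. \<phi> n x - v x))\<^sup>2 + 2 * (H1_norm \<Omega> (\<lambda>x. \<psi> n x - w x))\<^sup>2)"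
      by (simp add: abs_of_nonneg[OF H1_norm_nonneg])
  qed
  moreover have "(\<lambda>n. \<integral>\<^sup>+x\<in>frontier \<Omega>. ennreal (((\<phi> n x + \<psi> n x) - (g x + k x))\<^sup>2) \<partial>surface_measure) \<longlonglongrightarrow> 0"
  \<comment> \<open>Boundary errors may be infinite for some n, so the estimate stays in
    \<open>ennreal\<close>.\<close>
  proof (rule tendsto_sandwich[where f = "\<lambda>_. 0", OF _ _ tendsto_const])
    let ?I = "\<lambda>f. \<integral>\<^sup>+x\<in>frontier \<Omega>. ennreal ((f x)\<^sup>2) \<partial>surface_measure"
    show "(\<lambda>n. 2 * ?I (\<lambda>x. \<phi> n x - g x) + 2 * ?I (\<lambda>x. \<psi> n x - k x)) \<longlonglongrightarrow> 0"
      using \<phi>(3) \<psi>(3) by (auto intro!: tendsto_eq_intros ennreal_tendsto_cmult)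
    have "?I (\<lambda>x. (\<phi> n x + \<psi> n x) - (g x + k x)) \<le> 2 * ?I (\<lambda>x. \<phi> n x - g x) + 2 * ?I (\<lambda>x. \<psi> n x - k x)" for n
    proof -
      have m: "\<phi> n \<in> borel_measurable borel" "\<psi> n \<in> borel_measurable borel"
        using smooth_onD(2) \<phi>(1) \<psi>(1) by (auto intro: borel_measurable_continuous_onI)
      have "?I (\<lambda>x. (\<phi> n x + \<psi> n x) - (g x + k x)) \<le>
          (\<integral>\<^sup>+x. 2 * (ennreal ((\<phi> n x - g x)\<^sup>2) * indicator (frontier \<Omega>) x) +
            2 * (ennreal ((\<psi> n x - k x)\<^sup>2) * indicator (frontier \<Omega>) x) \<partial>surface_measure)"
      proof (rule nn_integral_mono)
        fix x
        have "((\<phi> n x + \<psi> n x) - (g x + k x))\<^sup>2 \<le> 2 * (\<phi> n x - g x)\<^sup>2 + 2 * (\<psi> n x - k x)\<^sup>2"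
          using sum_squares_bound[of "\<phi> n x - g x" "\<psi> n x - k x"] by (simp add: power2_eq_square algebra_simps)
        then have "ennreal (((\<phi> n x + \<psi> n x) - (g x + k x))\<^sup>2) \<le> ennreal (2 * (\<phi> n x - g x)\<^sup>2 + 2 * (\<psi> n x - k x)\<^sup>2)"
          by (rule ennreal_leI)
        also have "\<dots> = 2 * ennreal ((\<phi> n x - g x)\<^sup>2) + 2 * ennreal ((\<psi> n x - k x)\<^sup>2)"
          by (simp add: ennreal_mult)
        finally show "ennreal (((\<phi> n x + \<psi> n x) - (g x + k x))\<^sup>2) * indicator (frontier \<Omega>) x \<le>
            2 * (ennreal ((\<phi> n x - g x)\<^sup>2) * indicator (frontier \<Omega>) x) +
            2 * (ennreal ((\<psi> n x - k x)\<^sup>2) * indicator (frontier \<Omega>) x)"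
          by (simp add: indicator_def)
      qed
      also have "\<dots> = 2 * ?I (\<lambda>x. \<phi> n x - g x) + 2 * ?I (\<lambda>x. \<psi> n x - k x)"
        using boundary_error_measurable[OF m(1) gk(1)] boundary_error_measurable[OF m(2) gk(2)]
        by (subst nn_integral_add) (auto simp: nn_integral_cmult)
      finally show ?thesis .
    qed
    then show "\<forall>\<^sub>F n in sequentially. ?I (\<lambda>x. (\<phi> n x + \<psi> n x) - (g x + k x)) \<le>
        2 * ?I (\<lambda>x. \<phi> n x - g x) + 2 * ?I (\<lambda>x. \<psi> n x - k x)" by simp
  qed simp
  ultimately show ?thesis
    unfolding has_trace_def using gk smooth_on_add[OF \<phi>(1) \<psi>(1)]
    by (intro conjI exI[of _ "\<lambda>n x. \<phi> n x + \<psi> n x"]) auto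
qed

lemma has_trace_scale:
  assumes \<Omega>: "open \<Omega>" "bounded \<Omega>" and H1: "v \<in> H1 \<Omega>" and "has_trace \<Omega> v g"
  shows "has_trace \<Omega> (\<lambda>x. c * v x) (\<lambda>x. c * g x)"
proof -
  obtain \<phi> where
    \<phi>: "\<And>n. smooth_on UNIV (\<phi> n)" "(\<lambda>n. H1_norm \<Omega> (\<lambda>x. \<phi> n x - v x)) \<longlonglongrightarrow> 0"
      "(\<lambda>n. \<integral>\<^sup>+x\<in>frontier \<Omega>. ennreal ((\<phi> n x - g x)\<^sup>2) \<partial>surface_measure) \<longlonglongrightarrow> 0" and
    g: "g \<in> borel_measurable borel"
    using assms(4) unfolding has_trace_def by blast
  have diff_H1: "(\<lambda>x. \<phi> n x - v x) \<in> H1 \<Omega>" for n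
    using H1_add[OF \<Omega>(1) H1_smooth[OF \<Omega> \<phi>(1)] H1_scale[OF H1(1), of "-1"]] by auto
  have "H1_norm \<Omega> (\<lambda>x. c * \<phi> n x - c * v x) = \<bar>c\<bar> * H1_norm \<Omega> (\<lambda>x. \<phi> n x - v x)" for n
    using H1_norm_scale[OF \<Omega>(1) diff_H1, of c n] by (simp add: right_diff_distrib)
  then have "(\<lambda>n. H1_norm \<Omega> (\<lambda>x. c * \<phi> n x - c * v x)) \<longlonglongrightarrow> 0"
    using tendsto_mult_right_zero[OF \<phi>(2), of "\<bar>c\<bar>"] by simp
  moreover have "(\<lambda>n. \<integral>\<^sup>+x\<in>frontier \<Omega>. ennreal ((c * \<phi> n x - c * g x)\<^sup>2) \<partial>surface_measure) \<longlonglongrightarrow> 0"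
  proof -
    have "(\<integral>\<^sup>+x\<in>frontier \<Omega>. ennreal ((c * \<phi> n x - c * g x)\<^sup>2) \<partial>surface_measure) =
        ennreal (c\<^sup>2) * (\<integral>\<^sup>+x\<in>frontier \<Omega>. ennreal ((\<phi> n x - g x)\<^sup>2) \<partial>surface_measure)" for n
    proof -
      have "\<phi> n \<in> borel_measurable borel"
        using smooth_onD(2) \<phi>(1) by (auto intro: borel_measurable_continuous_onI)
      then have "(\<lambda>x. ennreal ((\<phi> n x - g x)\<^sup>2) * indicator (frontier \<Omega>) x) \<in> borel_measurable surface_measure"
        using g by (rule boundary_error_measurable)
      moreover have "ennreal ((c * \<phi> n x - c * g x)\<^sup>2) * indicator (frontier \<Omega>) x =
          ennreal (c\<^sup>2) * (ennreal ((\<phi> n x - g x)\<^sup>2) * indicator (frontier \<Omega>) x)" for x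
        by (simp add: ennreal_mult[symmetric] power_mult_distrib right_diff_distrib[symmetric] mult.assoc[symmetric])
      ultimately show ?thesis by (simp add: nn_integral_cmult)
    qed
    then show ?thesis using ennreal_tendsto_cmult[OF _ \<phi>(3), of "ennreal (c\<^sup>2)"] by simp
  qed
  ultimately show ?thesis
    unfolding has_trace_def using g smooth_on_mult[OF smooth_on_const \<phi>(1), of c]
    by (intro conjI exI[of _ "\<lambda>n x. c * \<phi> n x"]) auto
qed

lemma has_trace_zero:
  assumes "open \<Omega>" "bounded \<Omega>" shows "has_trace \<Omega> (\<lambda>_. 0) (\<lambda>_. 0)"
proof -
  have "H1_norm \<Omega> (\<lambda>_. 0) = 0"
    using H1_norm_scale[OF assms(1) H1_smooth[OF assms smooth_on_const], of 0 0] by simp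
  then show ?thesis
    unfolding has_trace_def using smooth_on_const by (intro conjI exI[of _ "\<lambda>_ _. 0"]) auto
qed

lemma V_space_subspace:
  assumes "open \<Omega>" "bounded \<Omega>"
  shows "(\<lambda>_. 0) \<in> V_space \<Omega> b"
    and "u \<in> V_space \<Omega> b \<Longrightarrow> v \<in> V_space \<Omega> b \<Longrightarrow> (\<lambda>x. u x + v x) \<in> V_space \<Omega> b"
    and "u \<in> V_space \<Omega> b \<Longrightarrow> (\<lambda>x. c * u x) \<in> V_space \<Omega> b"
proof -
  show "(\<lambda>_. 0) \<in> V_space \<Omega> b"
    unfolding V_space_def using H1_smooth[OF assms smooth_on_const] has_trace_zero[OF assms] by auto
next
  assume uv: "u \<in> V_space \<Omega> b" "v \<in> V_space \<Omega> b"
  then obtain g k where gk: "has_trace \<Omega> u g" "AE x in surface_measure. x \<in> Gamma_D \<Omega> b \<longrightarrow> g x = 0"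
    "has_trace \<Omega> v k" "AE x in surface_measure. x \<in> Gamma_D \<Omega> b \<longrightarrow> k x = 0"
    by (auto simp: V_space_def)
  have "AE x in surface_measure. x \<in> Gamma_D \<Omega> b \<longrightarrow> g x + k x = 0"
    using gk(2,4) by eventually_elim simp
  then show "(\<lambda>x. u x + v x) \<in> V_space \<Omega> b"
    using uv has_trace_add[OF assms _ _ gk(1,3)] H1_add[OF assms(1)] unfolding V_space_def by blast
next
  assume u: "u \<in> V_space \<Omega> b"
  then obtain g where g: "has_trace \<Omega> u g" "AE x in surface_measure. x \<in> Gamma_D \<Omega> b \<longrightarrow> g x = 0"
    by (auto simp: V_space_def)
  have "AE x in surface_measure. x \<in> Gamma_D \<Omega> b \<longrightarrow> c * g x = 0"
    using g(2) by eventually_elim simp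
  then show "(\<lambda>x. c * u x) \<in> V_space \<Omega> b"
    using u has_trace_scale[OF assms _ g(1)] H1_scale unfolding V_space_def by blast
qed

section \<open>Piecewise polynomial spaces are finite dimensional\<close>

lemma finite_exponents: "finite (exponents ty k :: ('d::finite \<Rightarrow> nat) set)"
proof -
  have "\<alpha> i \<le> k" if "\<alpha> \<in> exponents ty k" for \<alpha> :: "'d \<Rightarrow> nat" and i
    using that member_le_sum[of i UNIV \<alpha>] by (cases ty) auto
  then have "exponents ty k \<subseteq> (UNIV \<rightarrow>\<^sub>E {..k} :: ('d \<Rightarrow> nat) set)" by (auto simp: PiE_def)
  then show ?thesis by (rule finite_subset) (auto intro: finite_PiE)
qed

lemma poly_space_add: "p \<in> poly_space ty k \<Longrightarrow> q \<in> poly_space ty k \<Longrightarrow> (\<lambda>x. p x + q x) \<in> poly_space ty k"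
proof -
  assume "p \<in> poly_space ty k" "q \<in> poly_space ty k"
  then obtain c d where "p = (\<lambda>x. \<Sum>\<alpha>\<in>exponents ty k. c \<alpha> * (\<Prod>i\<in>UNIV. x $ i ^ \<alpha> i))"
    "q = (\<lambda>x. \<Sum>\<alpha>\<in>exponents ty k. d \<alpha> * (\<Prod>i\<in>UNIV. x $ i ^ \<alpha> i))" by (auto simp: poly_space_def)
  then have "(\<lambda>x. p x + q x) = (\<lambda>x. \<Sum>\<alpha>\<in>exponents ty k. (c \<alpha> + d \<alpha>) * (\<Prod>i\<in>UNIV. x $ i ^ \<alpha> i))"
    by (simp add: distrib_right sum.distrib)
  then show ?thesis unfolding poly_space_def by (intro CollectI exI[of _ "\<lambda>\<alpha>. c \<alpha> + d \<alpha>"]) simp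
qed

lemma poly_space_scale: "p \<in> poly_space ty k \<Longrightarrow> (\<lambda>x. r * p x) \<in> poly_space ty k"
proof -
  assume "p \<in> poly_space ty k"
  then obtain c where "p = (\<lambda>x. \<Sum>\<alpha>\<in>exponents ty k. c \<alpha> * (\<Prod>i\<in>UNIV. x $ i ^ \<alpha> i))" by (auto simp: poly_space_def)
  then have "(\<lambda>x. r * p x) = (\<lambda>x. \<Sum>\<alpha>\<in>exponents ty k. (r * c \<alpha>) * (\<Prod>i\<in>UNIV. x $ i ^ \<alpha> i))"
    by (simp add: sum_distrib_left mult.assoc)
  then show ?thesis unfolding poly_space_def by (intro CollectI exI[of _ "\<lambda>\<alpha>. r * c \<alpha>"]) simp
qed

lemma poly_space_zero: "(\<lambda>_. 0) \<in> poly_space ty k"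
  unfolding poly_space_def by (intro CollectI exI[of _ "\<lambda>_. 0"]) simp

lemma subspace_fe_space:
  assumes "open \<Omega>" "bounded \<Omega>" shows "subspace (fe_space \<Omega> b ty k \<T>)"
  unfolding subspace_def
proof (intro conjI ballI allI)
  show "0 \<in> fe_space \<Omega> b ty k \<T>"
    unfolding fe_space_def zero_fun_def using V_space_subspace(1)[OF assms]
    by (auto intro!: bexI[OF _ poly_space_zero])
next
  fix u v assume u: "u \<in> fe_space \<Omega> b ty k \<T>" and v: "v \<in> fe_space \<Omega> b ty k \<T>"
  have "\<exists>p\<in>poly_space ty k. \<forall>x\<in>K. u x + v x = p x" if K: "K \<in> \<T>" for K
  proof -
    obtain p q where "p \<in> poly_space ty k" "\<forall>x\<in>K. u x = p x" "q \<in> poly_space ty k" "\<forall>x\<in>K. v x = q x"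
      using u v K unfolding fe_space_def by blast
    then show ?thesis by (intro bexI[of _ "\<lambda>x. p x + q x"]) (auto intro: poly_space_add)
  qed
  then show "u + v \<in> fe_space \<Omega> b ty k \<T>"
    using u v V_space_subspace(2)[OF assms] unfolding fe_space_def plus_fun_def by (auto intro: continuous_on_add)
next
  fix c u assume u: "u \<in> fe_space \<Omega> b ty k \<T>"
  have "\<exists>p\<in>poly_space ty k. \<forall>x\<in>K. c * u x = p x" if K: "K \<in> \<T>" for K
  proof -
    obtain p where "p \<in> poly_space ty k" "\<forall>x\<in>K. u x = p x"
      using u K unfolding fe_space_def by blast
    then show ?thesis by (intro bexI[of _ "\<lambda>x. c * p x"]) (auto intro: poly_space_scale)
  qed
  then show "c *\<^sub>R u \<in> fe_space \<Omega> b ty k \<T>"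
    using u V_space_subspace(3)[OF assms] unfolding fe_space_def scaleR_fun_def by (auto intro: continuous_on_mult)
qed

text \<open>On each element a function is a combination of finitely many monomials, so monomials cut
  off to the elements span. These pieces are in general discontinuous and outside the space.\<close>

lemma fin_dim_fe_space:
  assumes \<Omega>: "open \<Omega>" "bounded \<Omega>" and mesh: "fe_mesh \<Omega> ty h \<T>"
  shows "fin_dim_subspace (fe_space \<Omega> b ty k \<T>)"
proof -
  \<comment> \<open>Elements share faces. Assigning each point to a single element keeps shared
    points from being counted twice in the expansion.\<close>
  define pick where "pick x = (SOME K. K \<in> \<T> \<and> x \<in> K)" for x
  define e where "e = (\<lambda>(K, \<alpha>) x. if x \<in> closure \<Omega> \<and> pick x = K then \<Prod>i\<in>UNIV. x $ i ^ \<alpha> i else 0)"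
  have \<T>: "finite \<T>" "\<Union>\<T> = closure \<Omega>" using mesh by (auto simp: fe_mesh_def)
  have pick: "pick x \<in> \<T>" "x \<in> pick x" if "x \<in> closure \<Omega>" for x
    using someI_ex[of "\<lambda>K. K \<in> \<T> \<and> x \<in> K"] that \<T>(2) unfolding pick_def by blast+
  let ?S = "e ` (\<T> \<times> exponents ty k)"
  have "v \<in> span ?S" if v: "v \<in> fe_space \<Omega> b ty k \<T>" for v
  proof -
    have "\<forall>K\<in>\<T>. \<exists>c. \<forall>x\<in>K. v x = (\<Sum>\<alpha>\<in>exponents ty k. c \<alpha> * (\<Prod>i\<in>UNIV. x $ i ^ \<alpha> i))"
      using v unfolding fe_space_def poly_space_def by fast
    then obtain c where c: "\<And>K x. K \<in> \<T> \<Longrightarrow> x \<in> K \<Longrightarrow> v x = (\<Sum>\<alpha>\<in>exponents ty k. c K \<alpha> * (\<Prod>i\<in>UNIV. x $ i ^ \<alpha> i))"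
      by metis
    have "v x = (\<Sum>K\<in>\<T>. \<Sum>\<alpha>\<in>exponents ty k. c K \<alpha> * e (K, \<alpha>) x)" for x
    proof (cases "x \<in> closure \<Omega>")
      case True
      have "(\<Sum>K\<in>\<T>. \<Sum>\<alpha>\<in>exponents ty k. c K \<alpha> * e (K, \<alpha>) x) =
          (\<Sum>K\<in>\<T>. if pick x = K then v x else 0)"
        using True c[OF pick[OF True]] by (intro sum.cong) (auto simp: e_def)
      then show ?thesis using pick(1)[OF True] \<T>(1) by simp
    next
      case False
      then show ?thesis using v by (simp add: fe_space_def e_def)
    qed
    then have "v = (\<Sum>K\<in>\<T>. \<Sum>\<alpha>\<in>exponents ty k. c K \<alpha> *\<^sub>R e (K, \<alpha>))"
      by (simp add: fun_eq_iff scaleR_fun_def sum_fun_apply)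
    also have "\<dots> \<in> span ?S"
      by (intro span_sum span_scale span_base) auto
    finally show ?thesis .
  qed
  then show ?thesis
    unfolding fin_dim_subspace_def using subspace_fe_space[OF \<Omega>] \<T>(1)
    by (intro conjI exI[of _ ?S] finite_imageI finite_cartesian_product finite_exponents) auto
qed

subsection \<open>The bilinear forms of the anisotropic problem\<close>

lemma L2_dominated:
  assumes g: "L2 \<Omega> g" and f: "f \<in> borel_measurable (lebesgue_on \<Omega>)"
    and le: "AE x in lebesgue_on \<Omega>. norm (f x) \<le> C * norm (g x)"
  shows "L2 \<Omega> f"
proof -
  have "integrable (lebesgue_on \<Omega>) (\<lambda>x. (norm (f x))\<^sup>2)"
  proof (rule Bochner_Integration.integrable_bound)
    show "integrable (lebesgue_on \<Omega>) (\<lambda>x. C\<^sup>2 * (norm (g x))\<^sup>2)" using g by (simp add: L2_def)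
    show "AE x in lebesgue_on \<Omega>. norm ((norm (f x))\<^sup>2) \<le> norm (C\<^sup>2 * (norm (g x))\<^sup>2)"
      using le
    proof eventually_elim
      case (elim x)
      then show ?case using power_mono[OF elim, of 2] by (simp add: power_mult_distrib)
    qed
  qed (use f in measurable)
  then show ?thesis using f by (simp add: L2_def)
qed

lemma L2_component:
  fixes g :: "'a::euclidean_space \<Rightarrow> real^'d"
  shows "L2 \<Omega> g \<Longrightarrow> L2 \<Omega> (\<lambda>x. g x $ i)"
proof (rule L2_dominated[of \<Omega> g _ 1])
  assume g: "L2 \<Omega> g"
  then have "g \<in> borel_measurable (lebesgue_on \<Omega>)" by (simp add: L2_def)
  then show "(\<lambda>x. g x $ i) \<in> borel_measurable (lebesgue_on \<Omega>)"
    by (rule borel_measurable_continuous_on[rotated]) (intro continuous_intros)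
qed (auto intro!: AE_I2 simp: component_le_norm_cart)

lemma integrable_Linf_L2_L2:
  fixes m f g :: "'a::euclidean_space \<Rightarrow> real"
  assumes "Linf \<Omega> m" "L2 \<Omega> f" "L2 \<Omega> g"
  shows "integrable (lebesgue_on \<Omega>) (\<lambda>x. m x * (f x * g x))"
proof -
  have [measurable]: "m \<in> borel_measurable (lebesgue_on \<Omega>)" "f \<in> borel_measurable (lebesgue_on \<Omega>)"
    "g \<in> borel_measurable (lebesgue_on \<Omega>)"
    using assms by (auto simp: Linf_def L2_def)
  obtain C where C: "AE x in lebesgue_on \<Omega>. norm (m x) \<le> C" using assms(1) by (auto simp: Linf_def)
  show ?thesis
  proof (rule Bochner_Integration.integrable_bound)
    show "integrable (lebesgue_on \<Omega>) (\<lambda>x. C * ((norm (f x))\<^sup>2 + (norm (g x))\<^sup>2))"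
      using assms by (simp add: L2_def)
    show "AE x in lebesgue_on \<Omega>. norm (m x * (f x * g x)) \<le> norm (C * ((norm (f x))\<^sup>2 + (norm (g x))\<^sup>2))"
      using C
    proof eventually_elim
      case (elim x)
      have "\<bar>f x * g x\<bar> \<le> (f x)\<^sup>2 + (g x)\<^sup>2"
      proof -
        have "2 * \<bar>f x * g x\<bar> \<le> (f x)\<^sup>2 + (g x)\<^sup>2"
          using sum_squares_bound[of "\<bar>f x\<bar>" "\<bar>g x\<bar>"] by (simp add: abs_mult)
        then show ?thesis using abs_ge_zero[of "f x * g x"] by linarith
      qed
      then have "\<bar>m x\<bar> * \<bar>f x * g x\<bar> \<le> \<bar>C\<bar> * ((f x)\<^sup>2 + (g x)\<^sup>2)"
        using elim by (intro mult_mono) auto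
      then show ?case by (simp add: abs_mult)
    qed
  qed measurable
qed

lemma tensor_sq_mult: "tensor_sq b *v w = (b \<bullet> w) *\<^sub>R b"
  by (simp add: vec_eq_iff tensor_sq_def matrix_vector_mult_def inner_vec_def sum_distrib_left mult_ac)

lemma complement_tensor_sq_inner: "((mat 1 - tensor_sq b) *v y) \<bullet> z = y \<bullet> (z - (b \<bullet> z) *\<^sub>R b)"
  by (simp add: matrix_vector_mult_diff_rdistrib tensor_sq_mult inner_diff_left inner_diff_right inner_commute)

definition perp_part :: "real^'d \<Rightarrow> real^'d \<Rightarrow> real^'d" where
  "perp_part b w = w - (b \<bullet> w) *\<^sub>R b"

lemma perp_part_inner: "norm b = 1 \<Longrightarrow> perp_part b w \<bullet> b = 0"
  by (simp add: perp_part_def inner_diff_left inner_commute[of w] norm_eq_1)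

text \<open>For a unit vector, \<open>tensor_sq\<close> is the orthogonal projection onto its span.
  Being symmetric, the outer projections move to the other argument, and the form splits into a
  parallel and a perpendicular part.\<close>

lemma diffusion_inner:
  assumes "norm (b x) = 1"
  shows "(diffusion b Apar Aperp x *v w) \<bullet> z =
    Apar x * ((b x \<bullet> w) * (b x \<bullet> z)) + (Aperp x *v perp_part (b x) w) \<bullet> perp_part (b x) z"
proof -
  have bb: "b x \<bullet> b x = 1" using assms by (simp add: norm_eq_1)
  have "tensor_sq (b x) *v (Apar x *\<^sub>R tensor_sq (b x) *v w) = (Apar x * (b x \<bullet> w)) *\<^sub>R b x"
    by (simp add: scaleR_matrix_vector_assoc[symmetric] tensor_sq_mult matrix_vector_mult_scaleR bb)
  moreover have "(mat 1 - tensor_sq (b x)) *v w = perp_part (b x) w"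
    by (simp add: matrix_vector_mult_diff_rdistrib tensor_sq_mult perp_part_def)
  ultimately show ?thesis
    unfolding diffusion_def matrix_vector_mult_add_rdistrib matrix_vector_mul_assoc[symmetric] inner_add_left
      complement_tensor_sq_inner
    by (simp add: perp_part_def)
qed

text \<open>Common source of bilinearity for \<open>a_form\<close> and \<open>a_par\<close>. Chosen
  weak gradients are additive and homogeneous only almost everywhere, which suffices under the
  integral.\<close>

lemma bilinear_on_weak_grad:
  fixes \<Omega> :: "'a::euclidean_space set" and B :: "'a \<Rightarrow> 'a \<Rightarrow> 'a \<Rightarrow> real"
  assumes \<Omega>: "open \<Omega>" and V: "V \<subseteq> H1 \<Omega>" and bil: "\<And>x. bilinear (B x)"
    and int: "\<And>g k. L2 \<Omega> g \<Longrightarrow> L2 \<Omega> k \<Longrightarrow> integrable (lebesgue_on \<Omega>) (\<lambda>x. B x (g x) (k x))"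
  shows "bilinear_on V (\<lambda>u v. LINT x|lebesgue_on \<Omega>. B x (weak_grad \<Omega> u x) (weak_grad \<Omega> v x))"
proof -
  have L2: "L2 \<Omega> (weak_grad \<Omega> u)" if "u \<in> H1 \<Omega>" for u using weak_grad_H1(2)[OF \<Omega> that] .
  have meas: "(\<lambda>x. B x (g x) (k x)) \<in> borel_measurable (lebesgue_on \<Omega>)" if "L2 \<Omega> g" "L2 \<Omega> k" for g k
    using int[OF that] by (rule borel_measurable_integrable)
  let ?D = "weak_grad \<Omega>"
  have add: "(LINT x|lebesgue_on \<Omega>. B x (?D (u + v) x) (?D w x)) =
      (LINT x|lebesgue_on \<Omega>. B x (?D u x) (?D w x)) + (LINT x|lebesgue_on \<Omega>. B x (?D v x) (?D w x))"
    "(LINT x|lebesgue_on \<Omega>. B x (?D w x) (?D (u + v) x)) =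
      (LINT x|lebesgue_on \<Omega>. B x (?D w x) (?D u x)) + (LINT x|lebesgue_on \<Omega>. B x (?D w x) (?D v x))"
    if "u \<in> H1 \<Omega>" "v \<in> H1 \<Omega>" "w \<in> H1 \<Omega>" for u v w
  proof -
    have uv: "u + v \<in> H1 \<Omega>" using H1_add[OF \<Omega> that(1,2)] by (simp add: plus_fun_def)
    have ae: "AE x in lebesgue_on \<Omega>. ?D (u + v) x = ?D u x + ?D v x"
      using weak_grad_add[OF \<Omega> that(1,2)] by (simp add: plus_fun_def)
    have "(LINT x|lebesgue_on \<Omega>. B x (?D (u + v) x) (?D w x)) =
        (LINT x|lebesgue_on \<Omega>. B x (?D u x) (?D w x) + B x (?D v x) (?D w x))"
      using that uv ae meas L2
      by (intro integral_cong_AE borel_measurable_add) (auto simp: bilinear_ladd[OF bil])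
    then show "(LINT x|lebesgue_on \<Omega>. B x (?D (u + v) x) (?D w x)) =
        (LINT x|lebesgue_on \<Omega>. B x (?D u x) (?D w x)) + (LINT x|lebesgue_on \<Omega>. B x (?D v x) (?D w x))"
      using int L2 that by simp
    have "(LINT x|lebesgue_on \<Omega>. B x (?D w x) (?D (u + v) x)) =
        (LINT x|lebesgue_on \<Omega>. B x (?D w x) (?D u x) + B x (?D w x) (?D v x))"
      using that uv ae meas L2
      by (intro integral_cong_AE borel_measurable_add) (auto simp: bilinear_radd[OF bil])
    then show "(LINT x|lebesgue_on \<Omega>. B x (?D w x) (?D (u + v) x)) =
        (LINT x|lebesgue_on \<Omega>. B x (?D w x) (?D u x)) + (LINT x|lebesgue_on \<Omega>. B x (?D w x) (?D v x))"
      using int L2 that by simp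
  qed
  have scale: "(LINT x|lebesgue_on \<Omega>. B x (?D (c *\<^sub>R u) x) (?D w x)) = c * (LINT x|lebesgue_on \<Omega>. B x (?D u x) (?D w x))"
    "(LINT x|lebesgue_on \<Omega>. B x (?D w x) (?D (c *\<^sub>R u) x)) = c * (LINT x|lebesgue_on \<Omega>. B x (?D w x) (?D u x))"
    if "u \<in> H1 \<Omega>" "w \<in> H1 \<Omega>" for c u w
  proof -
    have cu: "c *\<^sub>R u \<in> H1 \<Omega>" using H1_scale[OF that(1), of c] by (simp add: scaleR_fun_def)
    have ae: "AE x in lebesgue_on \<Omega>. ?D (c *\<^sub>R u) x = c *\<^sub>R ?D u x"
      using weak_grad_scale[OF \<Omega> that(1), of c] by (simp add: scaleR_fun_def)
    have "(LINT x|lebesgue_on \<Omega>. B x (?D (c *\<^sub>R u) x) (?D w x)) = (LINT x|lebesgue_on \<Omega>. c * B x (?D u x) (?D w x))"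
      using that cu ae meas L2
      by (intro integral_cong_AE borel_measurable_times borel_measurable_const) (auto simp: bilinear_lmul[OF bil])
    then show "(LINT x|lebesgue_on \<Omega>. B x (?D (c *\<^sub>R u) x) (?D w x)) = c * (LINT x|lebesgue_on \<Omega>. B x (?D u x) (?D w x))"
      by simp
    have "(LINT x|lebesgue_on \<Omega>. B x (?D w x) (?D (c *\<^sub>R u) x)) = (LINT x|lebesgue_on \<Omega>. c * B x (?D w x) (?D u x))"
      using that cu ae meas L2
      by (intro integral_cong_AE borel_measurable_times borel_measurable_const) (auto simp: bilinear_rmul[OF bil])
    then show "(LINT x|lebesgue_on \<Omega>. B x (?D w x) (?D (c *\<^sub>R u) x)) = c * (LINT x|lebesgue_on \<Omega>. B x (?D w x) (?D u x))"
      by simp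
  qed
  show ?thesis
    unfolding bilinear_on_def using add scale V by (auto simp: subset_iff)
qed

lemma bilinear_on_L2_inner:
  assumes "\<And>v. v \<in> V \<Longrightarrow> L2 \<Omega> v" shows "bilinear_on V (L2_inner \<Omega>)"
proof -
  have "Linf \<Omega> (\<lambda>_. 1::real)" by (auto simp: Linf_def intro!: exI[of _ 1])
  from integrable_Linf_L2_L2[OF this] have int: "integrable (lebesgue_on \<Omega>) (\<lambda>x. u x * v x)" if "u \<in> V" "v \<in> V" for u v
    using assms that by simp
  show ?thesis
    unfolding bilinear_on_def L2_inner_def plus_fun_def scaleR_fun_def
    using int by (auto simp: distrib_left distrib_right mult.assoc mult.left_commute)
qed

locale anisotropic_coefficients =
  fixes \<Omega> :: "(real^'d) set" and b :: "real^'d \<Rightarrow> real^'d"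
    and Apar :: "real^'d \<Rightarrow> real" and Aperp :: "real^'d \<Rightarrow> real^'d^'d" and A0 :: real
  assumes open_\<Omega>: "open \<Omega>" and bounded_\<Omega>: "bounded \<Omega>"
    and b_cont: "continuous_on \<Omega> b" and b_unit: "\<And>x. x \<in> \<Omega> \<Longrightarrow> norm (b x) = 1"
    and A0: "0 < A0" and Apar: "Linf \<Omega> Apar" "AE x in lebesgue_on \<Omega>. A0 \<le> Apar x"
    and Aperp: "\<And>i j. Linf \<Omega> (\<lambda>x. Aperp x $ i $ j)"
      "AE x in lebesgue_on \<Omega>. \<forall>v. v \<bullet> b x = 0 \<longrightarrow> A0 * (norm v)\<^sup>2 \<le> v \<bullet> (Aperp x *v v)"
begin

lemma AE_in_\<Omega>: "AE x in lebesgue_on \<Omega>. x \<in> \<Omega>"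
  using open_\<Omega> by (intro AE_I2) (simp add: space_restrict_space)

lemma b_measurable [measurable]: "b \<in> borel_measurable (lebesgue_on \<Omega>)"
  using b_cont open_\<Omega> by (intro continuous_imp_measurable_on_sets_lebesgue) auto

lemma L2_par: assumes "L2 \<Omega> g" shows "L2 \<Omega> (\<lambda>x. b x \<bullet> g x)"
proof (rule L2_dominated[OF assms, of _ 1])
  have [measurable]: "g \<in> borel_measurable (lebesgue_on \<Omega>)" using assms by (simp add: L2_def)
  show "(\<lambda>x. b x \<bullet> g x) \<in> borel_measurable (lebesgue_on \<Omega>)" by measurable
  show "AE x in lebesgue_on \<Omega>. norm (b x \<bullet> g x) \<le> 1 * norm (g x)"
    using AE_in_\<Omega>
  proof eventually_elim
    case (elim x)
    then show ?case using Cauchy_Schwarz_ineq2[of "b x" "g x"] b_unit by simp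
  qed
qed

lemma L2_perp: assumes "L2 \<Omega> g" shows "L2 \<Omega> (\<lambda>x. perp_part (b x) (g x))"
proof (rule L2_dominated[OF assms, of _ 2])
  have [measurable]: "g \<in> borel_measurable (lebesgue_on \<Omega>)" using assms by (simp add: L2_def)
  show "(\<lambda>x. perp_part (b x) (g x)) \<in> borel_measurable (lebesgue_on \<Omega>)"
    unfolding perp_part_def by measurable
  show "AE x in lebesgue_on \<Omega>. norm (perp_part (b x) (g x)) \<le> 2 * norm (g x)"
    using AE_in_\<Omega>
  proof eventually_elim
    case (elim x)
    have "norm (perp_part (b x) (g x)) \<le> norm (g x) + norm ((b x \<bullet> g x) *\<^sub>R b x)"
      unfolding perp_part_def by (rule norm_triangle_ineq4)
    then show ?case using Cauchy_Schwarz_ineq2[of "b x" "g x"] b_unit[OF elim] by simp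
  qed
qed

lemma integrable_diffusion:
  assumes "L2 \<Omega> g" "L2 \<Omega> k"
  shows "integrable (lebesgue_on \<Omega>) (\<lambda>x. (diffusion b Apar Aperp x *v g x) \<bullet> k x)"
proof -
  let ?f = "\<lambda>x. Apar x * ((b x \<bullet> g x) * (b x \<bullet> k x)) +
      (\<Sum>i\<in>UNIV. \<Sum>j\<in>UNIV. Aperp x $ i $ j * (perp_part (b x) (g x) $ j * perp_part (b x) (k x) $ i))"
  have "integrable (lebesgue_on \<Omega>) ?f"
    using assms Apar(1) Aperp(1)
    by (intro Bochner_Integration.integrable_add Bochner_Integration.integrable_sum integrable_Linf_L2_L2
        L2_par L2_component L2_perp)
  moreover have "integrable (lebesgue_on \<Omega>) ?f = integrable (lebesgue_on \<Omega>) (\<lambda>x. (diffusion b Apar Aperp x *v g x) \<bullet> k x)"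
  proof (rule Bochner_Integration.integrable_cong[OF refl])
    fix x assume "x \<in> space (lebesgue_on \<Omega>)"
    then have "norm (b x) = 1" using b_unit by (simp add: space_restrict_space)
    then show "?f x = (diffusion b Apar Aperp x *v g x) \<bullet> k x"
      unfolding diffusion_inner[of b x, OF \<open>norm (b x) = 1\<close>]
      by (simp add: inner_vec_def matrix_vector_mult_def sum_distrib_right mult.assoc)
  qed
  ultimately show ?thesis by simp
qed

lemma integrable_par:
  assumes "L2 \<Omega> g" "L2 \<Omega> k"
  shows "integrable (lebesgue_on \<Omega>) (\<lambda>x. Apar x * (((b x \<bullet> g x) *\<^sub>R b x) \<bullet> ((b x \<bullet> k x) *\<^sub>R b x)))"
proof -
  have "integrable (lebesgue_on \<Omega>) (\<lambda>x. Apar x * ((b x \<bullet> g x) * (b x \<bullet> k x)))"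
    using assms Apar(1) by (intro integrable_Linf_L2_L2 L2_par)
  moreover have "integrable (lebesgue_on \<Omega>) (\<lambda>x. Apar x * ((b x \<bullet> g x) * (b x \<bullet> k x))) =
      integrable (lebesgue_on \<Omega>) (\<lambda>x. Apar x * (((b x \<bullet> g x) *\<^sub>R b x) \<bullet> ((b x \<bullet> k x) *\<^sub>R b x)))"
    using b_unit by (intro Bochner_Integration.integrable_cong) (auto simp: space_restrict_space norm_eq_1)
  ultimately show ?thesis by simp
qed

lemma bilinear_on_a_form: "V \<subseteq> H1 \<Omega> \<Longrightarrow> bilinear_on V (a_form \<Omega> b Apar Aperp)"
  unfolding a_form_def using integrable_diffusion
  by (intro bilinear_on_weak_grad[OF open_\<Omega>])
    (auto simp: bilinear_def intro!: linearI
      simp: matrix_vector_right_distrib matrix_vector_mult_scaleR inner_add_left inner_add_right)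

lemma bilinear_on_a_par: "V \<subseteq> H1 \<Omega> \<Longrightarrow> bilinear_on V (a_par \<Omega> b Apar)"
  unfolding a_par_def par_grad_def using integrable_par
  by (intro bilinear_on_weak_grad[OF open_\<Omega>])
    (auto simp: bilinear_def intro!: linearI simp: inner_add_right algebra_simps)

lemma a_par_integrand_nonneg:
  "AE x in lebesgue_on \<Omega>. 0 \<le> Apar x * (par_grad \<Omega> b u x \<bullet> par_grad \<Omega> b u x)"
  using Apar(2) by eventually_elim (use A0 in auto)

lemma a_par_nonneg: "0 \<le> a_par \<Omega> b Apar u u"
  unfolding a_par_def by (rule integral_nonneg_AE[OF a_par_integrand_nonneg])

text \<open>The lower bound on \<open>Apar\<close> makes the integrand vanish exactly where the
  parallel gradient does. This turns \<open>G_space\<close> into the null set of a quadratic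
  form.\<close>

lemma a_par_eq_0_iff:
  assumes "u \<in> H1 \<Omega>"
  shows "a_par \<Omega> b Apar u u = 0 \<longleftrightarrow> (AE x in lebesgue_on \<Omega>. par_grad \<Omega> b u x = 0)"
proof -
  have "a_par \<Omega> b Apar u u = 0 \<longleftrightarrow>
      (AE x in lebesgue_on \<Omega>. Apar x * (par_grad \<Omega> b u x \<bullet> par_grad \<Omega> b u x) = 0)"
    unfolding a_par_def
    by (rule integral_nonneg_eq_0_iff_AE[OF _ a_par_integrand_nonneg])
      (use integrable_par[OF weak_grad_H1(2)[OF open_\<Omega> assms] weak_grad_H1(2)[OF open_\<Omega> assms]] in
        \<open>simp add: par_grad_def\<close>)
  also have "\<dots> \<longleftrightarrow> (AE x in lebesgue_on \<Omega>. par_grad \<Omega> b u x = 0)"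
  proof (rule eventually_subst)
    show "AE x in lebesgue_on \<Omega>. (Apar x * (par_grad \<Omega> b u x \<bullet> par_grad \<Omega> b u x) = 0) \<longleftrightarrow> par_grad \<Omega> b u x = 0"
      using Apar(2) by eventually_elim (use A0 in auto)
  qed
  finally show ?thesis .
qed

text \<open>The two integrands differ by the perpendicular part. Its argument is orthogonal to the
  field, so the coercivity of \<open>Aperp\<close> on such vectors makes it nonnegative.\<close>

lemma a_par_le_a_form:
  assumes "u \<in> H1 \<Omega>" shows "a_par \<Omega> b Apar u u \<le> a_form \<Omega> b Apar Aperp u u"
  unfolding a_par_def a_form_def
proof (rule integral_mono_AE)
  have L2: "L2 \<Omega> (weak_grad \<Omega> u)" by (rule weak_grad_H1(2)[OF open_\<Omega> assms])
  show "integrable (lebesgue_on \<Omega>) (\<lambda>x. Apar x * (par_grad \<Omega> b u x \<bullet> par_grad \<Omega> b u x))"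
    unfolding par_grad_def by (rule integrable_par[OF L2 L2])
  show "integrable (lebesgue_on \<Omega>) (\<lambda>x. (diffusion b Apar Aperp x *v weak_grad \<Omega> u x) \<bullet> weak_grad \<Omega> u x)"
    by (rule integrable_diffusion[OF L2 L2])
  show "AE x in lebesgue_on \<Omega>. Apar x * (par_grad \<Omega> b u x \<bullet> par_grad \<Omega> b u x) \<le>
      (diffusion b Apar Aperp x *v weak_grad \<Omega> u x) \<bullet> weak_grad \<Omega> u x"
    using AE_in_\<Omega> Aperp(2)
  proof eventually_elim
    case (elim x)
    let ?w = "perp_part (b x) (weak_grad \<Omega> u x)"
    have n: "norm (b x) = 1" using b_unit elim by blast
    have "0 \<le> A0 * (norm ?w)\<^sup>2" using A0 by simp
    also have "\<dots> \<le> ?w \<bullet> (Aperp x *v ?w)" using elim(2) perp_part_inner[OF n] by blast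
    finally have "0 \<le> ?w \<bullet> (Aperp x *v ?w)" .
    then show ?case
      unfolding diffusion_inner[of b x, OF n] using n by (simp add: par_grad_def norm_eq_1 inner_commute)
  qed
qed

end

lemma V_dual_norm_bound:
  assumes "open \<Omega>" "bounded \<Omega>" and f: "f \<in> V_dual \<Omega> b Apar Aperp"
    and nonneg: "\<And>v. v \<in> V_space \<Omega> b \<Longrightarrow> 0 \<le> a_form \<Omega> b Apar Aperp v v"
  shows "0 \<le> V_dual_norm \<Omega> b Apar Aperp f"
    and "v \<in> V_space \<Omega> b \<Longrightarrow> f v \<le> V_dual_norm \<Omega> b Apar Aperp f * V_norm \<Omega> b Apar Aperp v"
proof -
  let ?n = "V_norm \<Omega> b Apar Aperp"
  obtain C where C: "\<And>v. v \<in> V_space \<Omega> b \<Longrightarrow> \<bar>f v\<bar> \<le> C * ?n v" using f unfolding V_dual_def by blast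
  have n: "0 \<le> ?n v" if "v \<in> V_space \<Omega> b" for v using nonneg[OF that] by (simp add: V_norm_def)
  have bdd: "bdd_above ((\<lambda>v. \<bar>f v\<bar> / ?n v) ` V_space \<Omega> b)"
  proof (rule bdd_aboveI2)
    fix v assume v: "v \<in> V_space \<Omega> b"
    have "\<bar>f v\<bar> \<le> \<bar>C\<bar> * ?n v"
      using C[OF v] n[OF v] by (meson abs_ge_self mult_right_mono order_trans)
    then show "\<bar>f v\<bar> / ?n v \<le> \<bar>C\<bar>"
      using n[OF v] by (cases "?n v = 0") (simp_all add: pos_divide_le_eq)
  qed
  have upper: "\<bar>f v\<bar> / ?n v \<le> V_dual_norm \<Omega> b Apar Aperp f" if "v \<in> V_space \<Omega> b" for v
    unfolding V_dual_norm_def by (rule cSUP_upper[OF that bdd])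
  show "0 \<le> V_dual_norm \<Omega> b Apar Aperp f"
    using upper[OF V_space_subspace(1)[OF assms(1,2)]] n[OF V_space_subspace(1)[OF assms(1,2)]]
    by (meson abs_ge_zero divide_nonneg_nonneg order_trans)
  show "f v \<le> V_dual_norm \<Omega> b Apar Aperp f * ?n v" if v: "v \<in> V_space \<Omega> b"
  proof (cases "?n v = 0")
    case True
    \<comment> \<open>On an element of norm zero the quotient is 0 by convention and says nothing
      about \<open>f v\<close>; the continuity constant forces \<open>f v = 0\<close>.\<close>
    then show ?thesis using C[OF v] by simp
  next
    case False
    then have "\<bar>f v\<bar> \<le> V_dual_norm \<Omega> b Apar Aperp f * ?n v"
      using upper[OF v] n[OF v] by (simp add: pos_divide_le_eq)
    then show ?thesis by simp
  qed
qed

theorem theorem20: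
  fixes \<Omega> :: "(real^'d) set" and b :: "real^'d \<Rightarrow> real^'d"
    and Apar :: "real^'d \<Rightarrow> real" and Aperp :: "real^'d \<Rightarrow> real^'d^'d"
    and A0 A1 h \<beta> :: real and ty :: mesh_type and k :: nat
    and \<T> :: "(real^'d) set set" and Vh Ah :: "(real^'d \<Rightarrow> real) set"
    and f :: "(real^'d \<Rightarrow> real) \<Rightarrow> real"
  assumes dim: "CARD('d) = 2 \<or> CARD('d) = 3"
    and domain: "lipschitz_domain \<Omega>"
    and field: "smooth_on \<Omega> b" "continuous_on (closure \<Omega>) b" "\<forall>x\<in>\<Omega>. norm (b x) = 1"
    and Gamma_D: "top_of_set (frontier \<Omega>) interior_of Gamma_D \<Omega> b \<noteq> {}"
    and A0_A1: "0 < A0" "A0 \<le> A1"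
    and Apar: "W2inf \<Omega> Apar" "AE x in lebesgue_on \<Omega>. A0 \<le> Apar x \<and> Apar x \<le> A1"
    and Aperp: "\<forall>i j. W2inf \<Omega> (\<lambda>x. Aperp x $ i $ j)"
      "AE x in lebesgue_on \<Omega>. \<forall>v. v \<bullet> b x = 0 \<longrightarrow>
         A0 * (norm v)\<^sup>2 \<le> v \<bullet> (Aperp x *v v) \<and> v \<bullet> (Aperp x *v v) \<le> A1 * (norm v)\<^sup>2"
    and mesh: "fe_mesh \<Omega> ty h \<T>" and degree: "1 \<le> k"
    and Vh: "Vh = fe_space \<Omega> b ty k \<T>" and Ah: "Ah = A_space \<Omega> b Vh"
    and beta: "uniform_inf_sup_constant \<Omega> b Apar Aperp ty k \<beta>"
    and f: "f \<in> V_dual \<Omega> b Apar Aperp"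
  shows
    "(\<forall>\<epsilon>\<in>{0..1}. \<forall>\<sigma>>0.
         (\<exists>!p. solves \<Omega> b Apar Aperp Vh Vh f \<epsilon> \<sigma> p) \<and>
         (\<forall>u \<xi>. solves \<Omega> b Apar Aperp Vh Vh f \<epsilon> \<sigma> (u, \<xi>) \<longrightarrow>
            \<xi> \<in> Ah \<and> X_norm \<Omega> b Apar Aperp Vh \<epsilon> \<sigma> (u, \<xi>) \<le> 1 / \<beta> * V_dual_norm \<Omega> b Apar Aperp f)) \<and>
     (\<forall>\<epsilon>\<in>{0..1}. \<exists>!p. solves \<Omega> b Apar Aperp Vh Ah f \<epsilon> 0 p) \<and>
     (\<forall>\<epsilon>\<in>{0..1}. \<forall>u \<xi> u0 \<xi>0.
         (\<forall>\<sigma>>0. solves \<Omega> b Apar Aperp Vh Vh f \<epsilon> \<sigma> (u \<sigma>, \<xi> \<sigma>)) \<and>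
         solves \<Omega> b Apar Aperp Vh Ah f \<epsilon> 0 (u0, \<xi>0) \<longrightarrow>
         ((\<lambda>\<sigma>. V_norm \<Omega> b Apar Aperp (\<lambda>x. u \<sigma> x - u0 x)) \<longlongrightarrow> 0) (at_right 0) \<and>
         ((\<lambda>\<sigma>. V_norm \<Omega> b Apar Aperp (\<lambda>x. \<xi> \<sigma> x - \<xi>0 x)) \<longlongrightarrow> 0) (at_right 0)) \<and>
     (\<forall>u \<xi>. (\<forall>\<epsilon>\<in>{0..1}. solves \<Omega> b Apar Aperp Vh Ah f \<epsilon> 0 (u \<epsilon>, \<xi> \<epsilon>)) \<longrightarrow>
         ((\<lambda>\<epsilon>. V_norm \<Omega> b Apar Aperp (\<lambda>x. u \<epsilon> x - u 0 x)) \<longlongrightarrow> 0) (at_right 0) \<and>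
         ((\<lambda>\<epsilon>. V_norm \<Omega> b Apar Aperp (\<lambda>x. \<xi> \<epsilon> x - \<xi> 0 x)) \<longlongrightarrow> 0) (at_right 0)) \<and>
     (\<forall>\<phi> :: 'n::finite \<Rightarrow> real^'d \<Rightarrow> real. is_fe_basis \<phi> Vh \<longrightarrow>
         (\<forall>\<sigma>>0. \<exists>K. \<forall>\<epsilon>\<in>{0..1}.
            invertible (system_matrix \<Omega> b Apar Aperp \<phi> \<epsilon> \<sigma>) \<and>
            cond2 (system_matrix \<Omega> b Apar Aperp \<phi> \<epsilon> \<sigma>) \<le> K))"
proof -
  let ?a = "a_form \<Omega> b Apar Aperp" and ?s = "a_par \<Omega> b Apar" and ?l = "L2_inner \<Omega>"
    and ?V = "V_norm \<Omega> b Apar Aperp" and ?F = "V_dual_norm \<Omega> b Apar Aperp f"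
  have \<Omega>: "open \<Omega>" "bounded \<Omega>" using domain by (auto simp: lipschitz_domain_def)
  interpret anisotropic_coefficients \<Omega> b Apar Aperp A0
  proof
    show "continuous_on \<Omega> b" using field(2) closure_subset by (rule continuous_on_subset)
    show "AE x in lebesgue_on \<Omega>. A0 \<le> Apar x" using Apar(2) by eventually_elim simp
    show "AE x in lebesgue_on \<Omega>. \<forall>v. v \<bullet> b x = 0 \<longrightarrow> A0 * (norm v)\<^sup>2 \<le> v \<bullet> (Aperp x *v v)"
      using Aperp(2) by eventually_elim blast
  qed (use \<Omega> field A0_A1 Apar Aperp in \<open>auto simp: W2inf_def\<close>)
  have V_H1: "V_space \<Omega> b \<subseteq> H1 \<Omega>" by (auto simp: V_space_def)
  have Vh_V: "Vh \<subseteq> V_space \<Omega> b" by (auto simp: Vh fe_space_def)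
  have Vh_H1: "Vh \<subseteq> H1 \<Omega>" using Vh_V V_H1 by blast
  have a_form_nonneg: "0 \<le> ?a v v" if "v \<in> H1 \<Omega>" for v
    using a_par_nonneg[of v] a_par_le_a_form[OF that] by simp
  have l_nonneg: "0 \<le> ?l v v" for v
    unfolding L2_inner_def by (intro Bochner_Integration.integral_nonneg) simp
  have "G_space \<Omega> b Vh = {v\<in>Vh. ?s v v = 0}"
    unfolding G_space_def using a_par_eq_0_iff Vh_H1 by blast
  then have Ah_eq: "Ah = kernel_complement Vh ?s ?l"
    unfolding Ah A_space_def kernel_complement_def by blast
  have X_norm: "X_norm \<Omega> b Apar Aperp Vh = mixed_norm Vh ?a ?s ?l"
    by (simp add: fun_eq_iff X_norm_def mixed_norm_def V_norm_def par_norm_def star_norm_def dual_seminorm_def)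
  have C_form: "C_form \<Omega> b Apar Aperp = mixed_form ?a ?s ?l"
    by (simp add: fun_eq_iff C_form_def mixed_form_def)
  have V_norm: "?V v = sqrt (?a v v)" for v by (simp add: V_norm_def)
  have N_nonneg: "0 \<le> mixed_norm Vh ?a ?s ?l \<epsilon> \<sigma> p" if "\<epsilon> \<in> {0..1}" "0 \<le> \<sigma>" for \<epsilon> \<sigma> p
    unfolding mixed_norm_def using that a_par_nonneg l_nonneg
    by (auto split: prod.split intro!: real_sqrt_ge_zero add_nonneg_nonneg mult_nonneg_nonneg)
  have zero: "((\<lambda>_. 0), (\<lambda>_. 0)) = (0 :: (real^'d \<Rightarrow> real) \<times> (real^'d \<Rightarrow> real))"
    by (simp add: zero_prod_def zero_fun_def)
  have \<beta>: "0 < \<beta>" using beta by (simp add: uniform_inf_sup_constant_def)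
  have inf_sup: "ereal \<beta> \<le> (INF p\<in>Vh \<times> Ah - {0}. SUP q\<in>Vh \<times> Ah - {0}.
      ereal (mixed_form ?a ?s ?l \<epsilon> \<sigma> p q / (mixed_norm Vh ?a ?s ?l \<epsilon> \<sigma> p * mixed_norm Vh ?a ?s ?l \<epsilon> \<sigma> q)))"
    if "\<epsilon> \<in> {0..1}" "0 \<le> \<sigma>" for \<epsilon> \<sigma>
  proof -
    have "ereal \<beta> \<le> inf_sup \<Omega> b Apar Aperp Vh \<epsilon> \<sigma>"
      using beta mesh that unfolding uniform_inf_sup_constant_def Vh by blast
    then show ?thesis unfolding inf_sup_def X_norm C_form zero Ah .
  qed
  interpret mixed_problem Vh ?a ?s ?l \<beta>
  proof
    show "fin_dim_subspace Vh" unfolding Vh by (rule fin_dim_fe_space[OF \<Omega> mesh])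
    show "bilinear_on Vh ?a" "bilinear_on Vh ?s"
      using Vh_H1 by (rule bilinear_on_a_form, rule bilinear_on_a_par)
    show "bilinear_on Vh ?l"
      using Vh_H1 by (intro bilinear_on_L2_inner) (auto simp: H1_def)
    show "?s x y = ?s y x" for x y by (simp add: a_par_def inner_commute)
    show "?s v v \<le> ?a v v" if "v \<in> Vh" for v using a_par_le_a_form that Vh_H1 by blast
    show "0 < mixed_norm Vh ?a ?s ?l \<epsilon> \<sigma> p"
      if "\<epsilon> \<in> {0..1}" "0 \<le> \<sigma>" "p \<in> Vh \<times> kernel_complement Vh ?s ?l" "p \<noteq> 0" for \<epsilon> \<sigma> p
      using inf_sup_ereal_pos[OF inf_sup[OF that(1,2)] \<beta> N_nonneg[OF that(1,2)]] that Ah_eq by blast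
    show "\<beta> * mixed_norm Vh ?a ?s ?l \<epsilon> \<sigma> p \<le> M"
      if "\<epsilon> \<in> {0..1}" "0 \<le> \<sigma>" "p \<in> Vh \<times> kernel_complement Vh ?s ?l" "p \<noteq> 0"
        "\<And>q. q \<in> Vh \<times> kernel_complement Vh ?s ?l \<Longrightarrow>
          mixed_form ?a ?s ?l \<epsilon> \<sigma> p q \<le> M * mixed_norm Vh ?a ?s ?l \<epsilon> \<sigma> q" for \<epsilon> \<sigma> p M
      using inf_sup_ereal_bound[OF inf_sup[OF that(1,2)] \<beta> N_nonneg[OF that(1,2)], of p M] that Ah_eq by blast
  qed (use a_par_nonneg l_nonneg \<beta> in auto)
  have f_lin: "functional_on Vh f"
    using f Vh_V unfolding V_dual_def functional_on_def plus_fun_def scaleR_fun_def real_scaleR_def by blast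
  have F: "0 \<le> ?F" "\<And>v. v \<in> Vh \<Longrightarrow> f v \<le> ?F * sqrt (?a v v)"
    using V_dual_norm_bound[OF \<Omega> f a_form_nonneg[OF subsetD[OF V_H1]]] Vh_V unfolding V_norm by blast+
  have solves: "solves \<Omega> b Apar Aperp Vh Vh f \<epsilon> \<sigma> = solution Vh f \<epsilon> \<sigma>"
    "solves \<Omega> b Apar Aperp Vh Ah f \<epsilon> 0 = solution Ah f \<epsilon> 0" for \<epsilon> \<sigma>
    using solution_iff[OF f_lin zero_V order_refl, of \<epsilon> \<sigma>] solution_iff[OF f_lin zero_K K_subset, of \<epsilon> 0]
    by (auto simp: solves_def Ah_eq fun_eq_iff)
  \<comment> \<open>Shared by both limits: a linear rate in the mixed norm yields convergence of
    both components. It is asked only for t between 0 and 1, the range in which epsilon is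
    admissible.\<close>
  have limit: "((\<lambda>t. ?V (\<lambda>x. u t x - u0 x)) \<longlongrightarrow> 0) (at_right 0) \<and>
      ((\<lambda>t. ?V (\<lambda>x. \<xi> t x - \<xi>0 x)) \<longlongrightarrow> 0) (at_right 0)"
    if eps: "\<epsilon> \<in> {0..1}" and p0: "solution Ah f \<epsilon> 0 (u0, \<xi>0)"
      and p: "\<And>t. 0 < t \<Longrightarrow> t < 1 \<Longrightarrow> (u t, \<xi> t) \<in> Vh \<times> Ah \<and> mixed_norm Vh ?a ?s ?l \<epsilon> 0 ((u t, \<xi> t) - (u0, \<xi>0)) \<le> k * t"
    for \<epsilon> k :: real and u \<xi> u0 \<xi>0
  proof -
    have "u0 \<in> Vh" "\<xi>0 \<in> Ah" using p0 by (auto simp: solution_def)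
    then have "\<forall>\<^sub>F t in at_right 0. (u t - u0, \<xi> t - \<xi>0) \<in> Vh \<times> kernel_complement Vh ?s ?l \<and>
        mixed_norm Vh ?a ?s ?l \<epsilon> 0 (u t - u0, \<xi> t - \<xi>0) \<le> k * t"
      using p subspace_V subspace_K unfolding Ah_eq
      by (intro eventually_at_rightI[of 0 1]) (auto intro: subspace_diff)
    from tendsto_of_mixed_norm[OF this _ tendsto_ident_at] eps show ?thesis
      by (simp add: V_norm fun_diff_def)
  qed
  show ?thesis
  proof (intro conjI ballI allI impI)
    fix \<epsilon> \<sigma> :: real assume eps: "\<epsilon> \<in> {0..1}" and \<sigma>: "0 < \<sigma>"
    show "\<exists>!p. solves \<Omega> b Apar Aperp Vh Vh f \<epsilon> \<sigma> p"
      unfolding solves by (rule unique_solution_stabilized[OF eps \<sigma> f_lin])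
    fix u \<xi> assume "solves \<Omega> b Apar Aperp Vh Vh f \<epsilon> \<sigma> (u, \<xi>)"
    then have sol: "solution Ah f \<epsilon> \<sigma> (u, \<xi>)"
      unfolding solves unfolding Ah_eq by (rule stabilized_solution_K[OF \<sigma> f_lin])
    then show "\<xi> \<in> Ah" by (auto simp: solution_def)
    show "X_norm \<Omega> b Apar Aperp Vh \<epsilon> \<sigma> (u, \<xi>) \<le> 1 / \<beta> * ?F"
      using solution_bound[OF eps less_imp_le[OF \<sigma>] sol[unfolded Ah_eq] F] by (simp add: X_norm)
  next
    fix \<epsilon> :: real assume eps: "\<epsilon> \<in> {0..1}"
    show "\<exists>!p. solves \<Omega> b Apar Aperp Vh Ah f \<epsilon> 0 p"
      unfolding solves unfolding Ah_eq by (rule unique_solution_limit[OF eps f_lin])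
  next
    fix \<epsilon> :: real and u \<xi> u0 \<xi>0
    assume eps: "\<epsilon> \<in> {0..1}"
      and sol: "(\<forall>\<sigma>>0. solves \<Omega> b Apar Aperp Vh Vh f \<epsilon> \<sigma> (u \<sigma>, \<xi> \<sigma>)) \<and> solves \<Omega> b Apar Aperp Vh Ah f \<epsilon> 0 (u0, \<xi>0)"
    \<comment> \<open>The stabilised solutions are reread as solutions tested on \<open>Ah\<close>,
      the form in which they can be compared with the limit.\<close>
    have p: "solution Ah f \<epsilon> \<sigma> (u \<sigma>, \<xi> \<sigma>)" if "0 < \<sigma>" for \<sigma>
      using sol that stabilized_solution_K[OF that f_lin] unfolding solves unfolding Ah_eq by blast
    have p0: "solution Ah f \<epsilon> 0 (u0, \<xi>0)" using sol unfolding solves by blast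
    obtain k where k: "\<And>\<sigma> p p0. 0 \<le> \<sigma> \<Longrightarrow> solution Ah f \<epsilon> \<sigma> p \<Longrightarrow> solution Ah f \<epsilon> 0 p0 \<Longrightarrow>
        mixed_norm Vh ?a ?s ?l \<epsilon> 0 (p - p0) \<le> k * \<sigma>"
      using sigma_perturbation[OF eps F] unfolding Ah_eq by blast
    have *: "(u t, \<xi> t) \<in> Vh \<times> Ah \<and> mixed_norm Vh ?a ?s ?l \<epsilon> 0 ((u t, \<xi> t) - (u0, \<xi>0)) \<le> k * t" if "0 < t" for t
      using p[OF that] k[OF _ p[OF that] p0] that unfolding solution_def by simp
    show "((\<lambda>\<sigma>. ?V (\<lambda>x. u \<sigma> x - u0 x)) \<longlongrightarrow> 0) (at_right 0)"
      "((\<lambda>\<sigma>. ?V (\<lambda>x. \<xi> \<sigma> x - \<xi>0 x)) \<longlongrightarrow> 0) (at_right 0)"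
      using limit[OF eps p0, of u \<xi> k] * by blast+
  next
    fix u \<xi> assume sol: "\<forall>\<epsilon>\<in>{0..1}. solves \<Omega> b Apar Aperp Vh Ah f \<epsilon> 0 (u \<epsilon>, \<xi> \<epsilon>)"
    then have p: "solution Ah f \<epsilon> 0 (u \<epsilon>, \<xi> \<epsilon>)" if "\<epsilon> \<in> {0..1}" for \<epsilon>
      using that unfolding solves by blast
    have zero_eps: "(0::real) \<in> {0..1}" by simp
    obtain k where k: "\<And>\<epsilon> p p0. \<epsilon> \<in> {0..1} \<Longrightarrow> solution Ah f \<epsilon> 0 p \<Longrightarrow> solution Ah f 0 0 p0 \<Longrightarrow>
        mixed_norm Vh ?a ?s ?l 0 0 (p - p0) \<le> k * \<epsilon>"
      using epsilon_perturbation[OF F] unfolding Ah_eq by blast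
    have *: "(u t, \<xi> t) \<in> Vh \<times> Ah \<and> mixed_norm Vh ?a ?s ?l 0 0 ((u t, \<xi> t) - (u 0, \<xi> 0)) \<le> k * t"
      if "0 < t" "t < 1" for t
      using p[of t] k[OF _ p[of t] p[OF zero_eps]] that unfolding solution_def by simp
    show "((\<lambda>\<epsilon>. ?V (\<lambda>x. u \<epsilon> x - u 0 x)) \<longlongrightarrow> 0) (at_right 0)"
      "((\<lambda>\<epsilon>. ?V (\<lambda>x. \<xi> \<epsilon> x - \<xi> 0 x)) \<longlongrightarrow> 0) (at_right 0)"
      using limit[OF zero_eps p[OF zero_eps], of u \<xi> k] * by blast+
  next
    fix \<phi> :: "'n \<Rightarrow> real^'d \<Rightarrow> real" and \<sigma> :: real
    assume \<phi>: "is_fe_basis \<phi> Vh" and \<sigma>: "0 < \<sigma>"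
    have comb: "(\<Sum>i\<in>UNIV. c i *\<^sub>R \<phi> i) = (\<lambda>x. \<Sum>i\<in>UNIV. c i * \<phi> i x)" for c
      by (simp add: fun_eq_iff sum_fun_apply scaleR_fun_def)
    have basis: "product_basis \<phi> = case_sum (\<lambda>i. (\<phi> i, 0)) (\<lambda>i. (0, \<phi> i))"
    proof
      show "product_basis \<phi> I = case_sum (\<lambda>i. (\<phi> i, 0)) (\<lambda>i. (0, \<phi> i)) I" for I
        by (cases I) (simp_all add: zero_fun_def)
    qed
    show "\<exists>K. \<forall>\<epsilon>\<in>{0..1}. invertible (system_matrix \<Omega> b Apar Aperp \<phi> \<epsilon> \<sigma>) \<and>
        cond2 (system_matrix \<Omega> b Apar Aperp \<phi> \<epsilon> \<sigma>) \<le> K"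
      unfolding system_matrix_def C_form basis
      by (rule stabilized_matrix_bound) (use \<phi> \<sigma> in \<open>auto simp: is_fe_basis_def comb\<close>)
  qed
qed

end
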